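(* Fix $\beta>0$. Let $0<m<1$, let $q_\star\in(0,1]$, and let $\rho$ be a Borel probability measure on $[0,1]$ with $\operatorname{supp}\rho\subseteq[q_\star,1]$. Set \[ \nu=m\delta_0+(1-m)\rho,\qquad \psi(x)=u_\nu(q_\star,x),\qquad U_r=T_{m,r}\psi\quad(r\ge0). \] For $B=\partial_xU_r(x)$, regard $C=\partial_{xx}U_r(x)$ as a function of $(r,B)$, and define \[ K=-\frac{C_B}{2B}-m,\qquad J=-m-\tfrac12C_{BB},\qquad z=-\tfrac12C_B=(m+K)B . \] Then, for every $r\ge0$ and $0\le B<1$, \[ K,\ K_B,\ J,\ J_B\ge0,\qquad CJ_B\le3zJ . \]
   Context: For a Borel probability measure $\nu$ on $[0,1]$, $u_\nu:[0,1]\times\mathbb R\to\mathbb R$ denotes the solution of the Parisi equation \[ \partial_su_\nu+\frac{\beta^2}{2}\left(\partial_{xx}u_\nu+\nu([0,s])(\partial_xu_\nu)^2\right)=0,\qquad u_\nu(1,x)=\log\cosh x . \] (The solution is understood in the usual sense: $u_\nu$ is continuous, its spatial derivatives of every positive order exist and are bounded and jointly continuous on $[0,1]\times\mathbb R$, and for each $x$ the map $s\mapsto u_\nu(s,x)$ is absolutely continuous with the equation holding for almost every $s$; it is known to exist and be unique, to be even in $x$, and to satisfy $|\partial_xu_\nu|\le1$, $\partial_{xx}u_\nu>0$.) For $r\ge0$, $P_rg(x)=\mathbb E\,g(x+\sqrt r\,Z)$ with $Z$ standard Gaussian, and $T_{a,r}\phi(x)=\frac1a\log P_r(\mathrm e^{a\phi})(x)$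 for $a>0$. For each $r$, $x\mapsto\partial_xU_r(x)$ is a smooth increasing bijection of $\mathbb R$ onto $(-1,1)$, so $C(r,B)=\partial_{xx}U_r(x)$ with $\partial_xU_r(x)=B$ is well defined; it is smooth, positive and even in $B$. Subscripts $B$ denote derivatives in $B$ at fixed $r$; at $B=0$, $C_B/B$ is defined by its smooth extension. *)

theory Defs
  imports "HOL-Probability.Probability"
begin

definition absolutely_continuous_fun_on :: "real set \<Rightarrow> (real \<Rightarrow> real) \<Rightarrow> bool" where
  "absolutely_continuous_fun_on S f \<longleftrightarrow>
     (\<forall>\<epsilon>>0. \<exists>\<delta>>0. \<forall>I :: (real \<times> real) set.
        finite I \<longrightarrow> (\<forall>(a, b)\<in>I. a \<le> b \<and> {a..b} \<subseteq> S) \<longrightarrow>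
        disjoint_family_on (\<lambda>(a, b). {a<..<b}) I \<longrightarrow>
        (\<Sum>(a, b)\<in>I. b - a) < \<delta> \<longrightarrow> (\<Sum>(a, b)\<in>I. \<bar>f b - f a\<bar>) < \<epsilon>)"

definition borel_prob_on :: "real set \<Rightarrow> real measure \<Rightarrow> bool" where
  "borel_prob_on S M \<longleftrightarrow> prob_space M \<and> sets M = sets borel \<and> measure M S = 1"

definition measure_support :: "'a::topological_space measure \<Rightarrow> 'a set" where
  "measure_support M = {x. \<forall>W. open W \<longrightarrow> x \<in> W \<longrightarrow> emeasure M W > 0}"

definition mixture :: "real \<Rightarrow> 'a measure \<Rightarrow> 'a measure \<Rightarrow> 'a measure" where
  "mixture m M N = measure_of (space M) (sets M)
     (\<lambda>A. ennreal m * emeasure M A + ennreal (1 - m) * emeasure N A)"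

lemma sets_mixture [simp]: "sets (mixture m M N) = sets M"
  unfolding mixture_def by (simp add: sets.sigma_sets_eq)

lemma space_mixture [simp]: "space (mixture m M N) = space M"
  unfolding mixture_def by (simp add: space_measure_of_conv)

lemma emeasure_mixture:
  assumes "sets M = sets N" and "A \<in> sets M"
  shows "emeasure (mixture m M N) A = ennreal m * emeasure M A + ennreal (1 - m) * emeasure N A"
proof (rule emeasure_measure_of[OF mixture_def])
  show "sets M \<subseteq> Pow (space M)" by (rule sets.space_closed)
  show "A \<in> sets (mixture m M N)" using assms by simp
  show "positive (sets (mixture m M N))
      (\<lambda>A. ennreal m * emeasure M A + ennreal (1 - m) * emeasure N A)"
    by (simp add: positive_def)
  show "countably_additive (sets (mixture m M N))
      (\<lambda>A. ennreal m * emeasure M A + ennreal (1 - m) * emeasure N A)"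
  proof (rule countably_additiveI)
    fix F :: "nat \<Rightarrow> 'a set"
    assume F: "range F \<subseteq> sets (mixture m M N)" "disjoint_family F"
    have "(\<Sum>i. ennreal m * emeasure M (F i) + ennreal (1 - m) * emeasure N (F i)) =
        (\<Sum>i. ennreal m * emeasure M (F i)) + (\<Sum>i. ennreal (1 - m) * emeasure N (F i))"
      by (rule suminf_add[symmetric]) auto
    also have "\<dots> = ennreal m * emeasure M (\<Union>i. F i) + ennreal (1 - m) * emeasure N (\<Union>i. F i)"
      using F assms(1) by (simp add: suminf_emeasure)
    finally show "(\<Sum>i. ennreal m * emeasure M (F i) + ennreal (1 - m) * emeasure N (F i)) =
        ennreal m * emeasure M (\<Union>i. F i) + ennreal (1 - m) * emeasure N (\<Union>i. F i)" .
  qed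
qed

text \<open>The argument order is \<open>u s x\<close>, and only \<open>0 \<le> s \<le> 1\<close> matters. At the endpoints the time derivative
  is one-sided, which is irrelevant under the almost-everywhere quantifier.\<close>

definition parisi_solution :: "real \<Rightarrow> real measure \<Rightarrow> (real \<Rightarrow> real \<Rightarrow> real) \<Rightarrow> bool" where
  "parisi_solution \<beta> \<nu> u \<longleftrightarrow>
     continuous_on ({0..1} \<times> UNIV) (\<lambda>(s, x). u s x) \<and>
     (\<forall>k. \<forall>s\<in>{0..1}. \<forall>x. (deriv ^^ k) (u s) differentiable (at x)) \<and>
     (\<forall>k\<ge>1. bounded ((\<lambda>(s, x). (deriv ^^ k) (u s) x) ` ({0..1} \<times> UNIV)) \<and>
            continuous_on ({0..1} \<times> UNIV) (\<lambda>(s, x). (deriv ^^ k) (u s) x)) \<and>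
     (\<forall>x. absolutely_continuous_fun_on {0..1} (\<lambda>s. u s x)) \<and>
     (\<forall>x. AE s in lebesgue. s \<in> {0..1} \<longrightarrow>
        (\<exists>D. ((\<lambda>t. u t x) has_real_derivative D) (at s within {0..1}) \<and>
             D + \<beta>\<^sup>2 / 2 * (deriv (deriv (u s)) x + measure \<nu> {0..s} * (deriv (u s) x)\<^sup>2) = 0)) \<and>
     (\<forall>x. u 1 x = ln (cosh x))"

definition heat :: "real \<Rightarrow> (real \<Rightarrow> real) \<Rightarrow> real \<Rightarrow> real" where
  "heat r g x = (\<integral>z. g (x + sqrt r * z) \<partial>density lborel std_normal_density)"

definition cole_hopf :: "real \<Rightarrow> real \<Rightarrow> (real \<Rightarrow> real) \<Rightarrow> real \<Rightarrow> real" where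
  "cole_hopf a r \<phi> x = 1 / a * ln (heat r (\<lambda>y. exp (a * \<phi> y)) x)"

text \<open>The second derivative of \<open>U\<close> as a function of the slope \<open>B\<close>; meaningful for \<open>B\<close> in the range
  \<open>(-1, 1)\<close> of the (injective) derivative of \<open>U\<close>.\<close>

definition slope_curvature :: "(real \<Rightarrow> real) \<Rightarrow> real \<Rightarrow> real" where
  "slope_curvature U B = deriv (deriv U) (THE x. deriv U x = B)"

text \<open>The argument \<open>C\<close> below is the function \<open>B \<mapsto> C(r, B)\<close> at a fixed \<open>r\<close>. At \<open>B = 0\<close> the quotient
  \<open>C\<^sub>B / B\<close> takes the value of its continuous (hence of its smooth) extension.\<close>

definition K_fun :: "real \<Rightarrow> (real \<Rightarrow> real) \<Rightarrow> real \<Rightarrow> real" where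
  "K_fun m C B =
     - (if B = 0 then Lim (at 0) (\<lambda>b. deriv C b / b) else deriv C B / B) / 2 - m"

definition J_fun :: "real \<Rightarrow> (real \<Rightarrow> real) \<Rightarrow> real \<Rightarrow> real" where
  "J_fun m C B = - m - 1 / 2 * deriv (deriv C) B"

definition z_fun :: "(real \<Rightarrow> real) \<Rightarrow> real \<Rightarrow> real" where
  "z_fun C B = - 1 / 2 * deriv C B"

lemma z_fun_eq: "B \<noteq> 0 \<Longrightarrow> z_fun C B = (m + K_fun m C B) * B"
  by (simp add: z_fun_def K_fun_def)

end

theory Submission
  imports Defs "HOL-Real_Asymp.Real_Asymp"
begin

text \<open>Run time backwards from \<open>s = 1\<close> and append the Cole--Hopf time \<open>r\<close>: both phases solve
  \<open>\<phi>\<^sub>t = (\<phi>\<^sub>x\<^sub>x + \<alpha>(t) \<phi>\<^sub>x\<^sup>2) / 2\<close> with \<open>\<alpha>\<close> decreasing from at most \<open>1\<close> to \<open>m\<close>, starting from \<open>ln cosh\<close>.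
  With \<open>B = \<phi>\<^sub>x\<close>, \<open>C = \<phi>\<^sub>x\<^sub>x\<close>, \<open>z = - C\<^sub>x / (2 C)\<close> and \<open>b = \<alpha> B - 2 z\<close>, the quantities \<open>N = z\<^sub>x - \<alpha> C = C J\<close>,
  \<open>P = N\<^sub>x + 2 z N = C\<^sup>2 J\<^sub>B\<close> and \<open>W = z N - N\<^sub>x = C (3 z J - C J\<^sub>B)\<close> satisfy, as functions of \<open>(t, x)\<close>,
  \<open>N\<^sub>t = N\<^sub>x\<^sub>x / 2 + b N\<^sub>x - (\<alpha> C + 2 N) N\<close>,
  \<open>P\<^sub>t = P\<^sub>x\<^sub>x / 2 + b P\<^sub>x - (4 \<alpha> C + 8 N) P + 12 \<alpha> C z N + 12 z N\<^sup>2\<close>,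
  \<open>W\<^sub>t = W\<^sub>x\<^sub>x / 2 + b W\<^sub>x - (\<alpha> C + 5 N) W + 3 z N\<^sup>2\<close>.
  All three vanish for \<open>\<alpha> = 1\<close> at \<open>ln cosh\<close>, a downward jump of \<open>\<alpha>\<close> only increases \<open>N\<close> and \<open>W\<close>, and \<open>z, P, W\<close> are
  odd, so the maximum principle gives first \<open>N \<ge> 0\<close> and \<open>z \<ge> 0\<close> and then \<open>P, W \<ge> 0\<close> for \<open>x \<ge> 0\<close>. It applies because
  comparison with \<open>C\<close> shows that \<open>\<phi>\<^sub>x\<^sub>x\<^sub>x / C\<close> and the next two ratios stay bounded. The claims on \<open>K = z / B - m\<close>
  follow from the convexity of \<open>z\<close> in \<open>B\<close>.\<close>

section \<open>A maximum principle\<close>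

text \<open>The quantities come from slope coordinates: for \<open>ln cosh\<close> one has B = tanh
  x and C = 1 - B^2, so J with \<alpha> in place of m vanishes identically at \<alpha> = 1, and with
  it everything built from J. The equation of N has no source, while those of P and W have sources
  and zero-order coefficients whose signs are known only after N \<ge> 0 and z \<ge> 0; this forces
  the order of the steps. Two obstacles shape the form. First, \<alpha> is merely monotone and
  continuous from one side, so time derivatives exist from the left only and N, W may jump; hence a
  maximum principle for lower semicontinuous functions p - \<alpha> q with q \<ge> 0. Secondly, the
  quantities are quotients by C, which already for \<open>ln cosh\<close> decays exponentially, on
  an unbounded line, whereas the maximum principle asks for a bounded drift and a lower bound. So C
  is first kept above a multiple of sech^2, and higher derivatives are then compared with C.
  Finally, the Parisi equation holds only at almost every time; it is integrated in time first and
  differentiated in x under the integral.\<close>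

lemma lsc_attains_min:
  fixes f :: "'a::topological_space \<Rightarrow> real"
  assumes S: "compact S" "S \<noteq> {}"
    and lsc: "\<And>p a. p \<in> S \<Longrightarrow> a < f p \<Longrightarrow> \<forall>\<^sub>F q in at p within S. a < f q"
  shows "\<exists>p\<in>S. \<forall>q\<in>S. f p \<le> f q"
proof (rule ccontr)
  assume "\<not> ?thesis"
  then have "\<forall>p\<in>S. \<exists>q. q \<in> S \<and> f q < f p" by force
  from bchoice[OF this] obtain h where
    h: "\<And>p. p \<in> S \<Longrightarrow> h p \<in> S" "\<And>p. p \<in> S \<Longrightarrow> f (h p) < f p" by blast
  have "\<exists>V. open V \<and> p \<in> V \<and> (\<forall>q\<in>V \<inter> S. f (h p) < f q)" if "p \<in> S" for p
  proof -
    from lsc[OF that h(2)[OF that]] obtain V where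
      "open V" "p \<in> V" "\<forall>q\<in>V. q \<noteq> p \<longrightarrow> q \<in> S \<longrightarrow> f (h p) < f q"
      by (auto simp: eventually_at_topological)
    then show ?thesis using h(2)[OF that] by (intro exI[of _ V]) auto
  qed
  then have "\<forall>p\<in>S. \<exists>V. open V \<and> p \<in> V \<and> (\<forall>q\<in>V \<inter> S. f (h p) < f q)" by blast
  from bchoice[OF this] obtain V where
    V: "\<And>p. p \<in> S \<Longrightarrow> open (V p)" "\<And>p. p \<in> S \<Longrightarrow> p \<in> V p"
      "\<And>p q. p \<in> S \<Longrightarrow> q \<in> V p \<inter> S \<Longrightarrow> f (h p) < f q" by blast
  \<comment> \<open>Among the finitely many values \<open>f (h p)\<close> left by compactness one is
    smallest; but \<open>h p\<close> itself lies in some \<open>V p'\<close>, and then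
    \<open>f (h p')\<close> is smaller still.\<close>
  have "S \<subseteq> (\<Union>p\<in>S. V p)" using V(2) by auto
  then obtain F where F: "F \<subseteq> S" "finite F" "S \<subseteq> (\<Union>p\<in>F. V p)"
    using compactE_image[OF S(1), of S V] V(1) by auto
  have "F \<noteq> {}" using F S by auto
  then obtain p where p: "p \<in> F" "\<And>p'. p' \<in> F \<Longrightarrow> f (h p) \<le> f (h p')"
    using arg_min_if_finite[OF F(2), of "\<lambda>p. f (h p)"] by (metis not_le)
  have "h p \<in> S" using p F h by auto
  then obtain p' where p': "p' \<in> F" "h p \<in> V p'" using F by auto
  then have "f (h p') < f (h p)" using V(3)[of p' "h p"] \<open>h p \<in> S\<close> F by auto
  then show False using p(2)[OF p'(1)] by simp
qed

text \<open>The second derivative is given at the point itself only, so Taylor's formula is replaced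
  by a sign argument: if l < 0, then \<open>f1\<close> is negative just to the right of x and the
  mean value theorem produces a smaller value of f.\<close>

lemma second_derivative_nonneg_at_min:
  fixes f :: "real \<Rightarrow> real"
  assumes f: "\<And>x. (f has_real_derivative f1 x) (at x)" and f1: "(f1 has_real_derivative l) (at x)"
    and e: "0 < e" and min: "\<And>y. \<bar>y - x\<bar> < e \<Longrightarrow> f x \<le> f y"
  shows "f1 x = 0" "0 \<le> l"
proof -
  show f10: "f1 x = 0"
    using DERIV_local_min[OF f e, of x] min by (simp add: abs_minus_commute)
  show "0 \<le> l"
  proof (rule ccontr)
    assume "\<not> 0 \<le> l"
    with DERIV_neg_dec_right[OF f1] f10 obtain d where
      d: "0 < d" "\<And>h. 0 < h \<Longrightarrow> h < d \<Longrightarrow> f1 (x + h) < 0" by fastforce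
    define h where "h = min d e / 2"
    have h: "0 < h" "h < d" "h < e" using d e by (auto simp: h_def)
    obtain \<xi> where \<xi>: "x < \<xi>" "\<xi> < x + h" "f (x + h) - f x = h * f1 \<xi>"
      using MVT2[of x "x + h" f f1] f h by auto
    have "f1 \<xi> < 0" using d(2)[of "\<xi> - x"] \<xi> h by simp
    then have "f (x + h) < f x" using \<xi>(3) h(1) by (smt (verit) mult_pos_neg)
    then show False using min[of "x + h"] h by simp
  qed
qed

lemma left_derivative_nonpos_at_min:
  fixes k :: "real \<Rightarrow> real"
  assumes k: "(k has_real_derivative l) (at t within {0..t})" and t: "0 < t"
    and min: "\<And>s. s \<in> {0..t} \<Longrightarrow> k t \<le> k s"
  shows "l \<le> 0"
proof (rule tendsto_upperbound)
  show "((\<lambda>s. (k s - k t) / (s - t)) \<longlongrightarrow> l) (at t within {0..t})"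
    using k by (simp add: has_field_derivative_iff)
  show "\<forall>\<^sub>F s in at t within {0..t}. (k s - k t) / (s - t) \<le> 0"
    unfolding eventually_at_filter using min by (intro always_eventually) (auto intro!: divide_nonneg_nonpos)
  show "at t within {0..t} \<noteq> bot"
    using t by (simp add: at_within_Icc_at_left)
qed

text \<open>The time derivative is only needed from the left, and only of a majorant \<open>g\<close> touching \<open>w\<close> at the
  point in question; this accommodates functions that jump upwards in time.\<close>

lemma maximum_principle:
  fixes w w1 w2 b :: "real \<Rightarrow> real \<Rightarrow> real" and A c bb T :: real
  assumes D: "closed D"
    and lsc: "\<And>t x a. t \<in> {0..T} \<Longrightarrow> x \<in> D \<Longrightarrow> a < w t x \<Longrightarrow>
        \<forall>\<^sub>F p in at (t, x) within {0..T} \<times> D. a < w (fst p) (snd p)"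
    and init: "\<And>x. x \<in> D \<Longrightarrow> 0 \<le> w 0 x"
    and lower: "\<And>t x. t \<in> {0..T} \<Longrightarrow> x \<in> D \<Longrightarrow> - A \<le> w t x"
    and b: "\<And>t x. t \<in> {0..T} \<Longrightarrow> x \<in> D \<Longrightarrow> \<bar>b t x\<bar> \<le> bb"
    and c: "0 \<le> c"
    and w1: "\<And>t x. t \<in> {0..T} \<Longrightarrow> (w t has_real_derivative w1 t x) (at x)"
    and w2: "\<And>t x. t \<in> {0..T} \<Longrightarrow> (w1 t has_real_derivative w2 t x) (at x)"
    and super: "\<And>t x. 0 < t \<Longrightarrow> t \<le> T \<Longrightarrow> x \<in> D \<Longrightarrow> w t x < 0 \<Longrightarrow> x \<in> interior D \<and>
        (\<exists>g g'. g t = w t x \<and> (\<forall>s\<in>{0..t}. w s x \<le> g s) \<and>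
          (g has_real_derivative g') (at t within {0..t}) \<and>
          1 / 2 * w2 t x + b t x * w1 t x + c * w t x \<le> g')"
    and t: "t \<in> {0..T}" and x: "x \<in> D"
  shows "0 \<le> w t x"
proof (rule ccontr)
  assume neg: "\<not> 0 \<le> w t x"
  have bb: "0 \<le> bb" using b[OF t x] by simp
  \<comment> \<open>In \<open>l\<close>, \<open>c\<close> cancels the zero-order term,
    \<open>bb\<close> pays for the drift acting on the barrier gradient 2 \<epsilon> x via 2 |x|
    \<le> 1 + x^2, and 2 leaves a positive rest after the second derivative of the barrier.\<close>
  define l where "l = c + bb + 2"
  have l: "0 < l" using bb c by (simp add: l_def)
  \<comment> \<open>With this size the barrier \<epsilon> (1 + y^2) eats only half of the weighted
    negative value at (t, x), so \<open>v t x\<close> stays negative.\<close>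
  define \<epsilon> where "\<epsilon> = - exp (- l * t) * w t x / (2 * (1 + x\<^sup>2))"
  have \<epsilon>: "0 < \<epsilon>" using neg unfolding \<epsilon>_def
    by (intro divide_pos_pos) (auto simp: mult_pos_neg add_pos_nonneg)
  define v where "v = (\<lambda>s y. exp (- l * s) * w s y + \<epsilon> * (1 + y\<^sup>2))"
  have "1 + x\<^sup>2 > 0" by (simp add: add_pos_nonneg)
  then have "\<epsilon> * (1 + x\<^sup>2) = - (exp (- l * t) * w t x) / 2" by (simp add: \<epsilon>_def field_simps)
  then have v0: "v t x < 0" using neg by (simp add: v_def mult_neg_pos)
  \<comment> \<open>Beyond \<open>R\<close> the barrier outweighs the lower bound
    \<open>- A\<close>, as the exponential weight is at most 1; the minimum can thus be sought over
    a compact set.\<close>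
  define R where "R = \<bar>x\<bar> + \<bar>A\<bar> / \<epsilon> + 1"
  have R: "1 \<le> R" "\<bar>x\<bar> \<le> R" "\<bar>A\<bar> \<le> \<epsilon> * R"
    using \<epsilon> by (auto simp: R_def field_simps)
  have far: "0 \<le> v s y" if s: "s \<in> {0..T}" and y: "y \<in> D" "R \<le> \<bar>y\<bar>" for s y
  proof -
    have "R * 1 \<le> \<bar>y\<bar> * \<bar>y\<bar>" using y R by (intro mult_mono) auto
    then have "\<epsilon> * R \<le> \<epsilon> * (1 + y\<^sup>2)" using \<epsilon> by (simp add: power2_eq_square)
    moreover have "- \<bar>A\<bar> \<le> exp (- l * s) * w s y"
    proof (cases "0 \<le> w s y")
      case False
      have "exp (- l * s) * (- w s y) \<le> 1 * \<bar>A\<bar>"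
        using False s l lower[OF s y(1)] by (intro mult_mono) auto
      then show ?thesis by simp
    qed (simp add: order_trans[of _ 0])
    ultimately show ?thesis using R unfolding v_def by linarith
  qed
  define S where "S = {0..T} \<times> (D \<inter> {-R..R})"
  have tx: "(t, x) \<in> S" using t x R by (auto simp: S_def)
  have "\<exists>p\<in>S. \<forall>q\<in>S. v (fst p) (snd p) \<le> v (fst q) (snd q)"
  proof (rule lsc_attains_min)
    show "compact S" unfolding S_def
      by (intro compact_Times closed_Int_compact D) auto
    show "S \<noteq> {}" using tx by blast
    fix p a assume p: "p \<in> S" and a: "a < v (fst p) (snd p)"
    \<comment> \<open>\<open>h\<close> is the continuous threshold that \<open>w\<close> must exceed
      for \<open>v\<close> to exceed \<open>a\<close>; a value \<open>a'\<close> strictly in between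
      separates the continuity of \<open>h\<close> from the semicontinuity of
      \<open>w\<close>.\<close>
    define h where "h = (\<lambda>q :: real \<times> real. (a - \<epsilon> * (1 + (snd q)\<^sup>2)) / exp (- l * fst q))"
    have hi: "h q < r \<longleftrightarrow> a < exp (- l * fst q) * r + \<epsilon> * (1 + (snd q)\<^sup>2)" for q r
      unfolding h_def by (subst pos_divide_less_eq) (auto simp: algebra_simps)
    have "h p < w (fst p) (snd p)" using a by (simp add: hi v_def)
    then obtain a' where a': "h p < a'" "a' < w (fst p) (snd p)" using dense by blast
    have "isCont h p" unfolding h_def by (intro continuous_intros) auto
    then have "(h \<longlongrightarrow> h p) (at p within S)"
      by (meson at_le isCont_def subset_UNIV tendsto_mono)
    then have 1: "\<forall>\<^sub>F q in at p within S. h q < a'" using a'(1) by (rule order_tendstoD)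
    have "\<forall>\<^sub>F q in at p within {0..T} \<times> D. a' < w (fst q) (snd q)"
      using lsc[of "fst p" "snd p" a'] p a' by (auto simp: S_def)
    moreover have "at p within S \<le> at p within {0..T} \<times> D"
      by (rule at_le) (auto simp: S_def)
    ultimately have 2: "\<forall>\<^sub>F q in at p within S. a' < w (fst q) (snd q)"
      using filter_leD by blast
    from 1 2 show "\<forall>\<^sub>F q in at p within S. a < v (fst q) (snd q)"
    proof eventually_elim
      case (elim q)
      then have "h q < w (fst q) (snd q)" by simp
      then show ?case by (simp add: hi v_def)
    qed
  qed
  then obtain t1 x1 where "(t1, x1) \<in> S"
    and min0: "\<And>s y. (s, y) \<in> S \<Longrightarrow> v t1 x1 \<le> v s y" by force
  then have t1: "t1 \<in> {0..T}" and x1: "x1 \<in> D" by (auto simp: S_def)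
  have v1: "v t1 x1 < 0" using min0[OF tx] v0 by simp
  have min: "v t1 x1 \<le> v s y" if "s \<in> {0..T}" "y \<in> D" for s y
  proof (cases "\<bar>y\<bar> \<le> R")
    case True
    then have "(s, y) \<in> S" using that by (simp add: S_def abs_le_iff minus_le_iff)
    then show ?thesis by (rule min0)
  qed (use far[of s y] v1 that in auto)
  have w_neg: "w t1 x1 < 0"
  proof (rule ccontr)
    assume "\<not> w t1 x1 < 0"
    then have "0 \<le> v t1 x1" using \<epsilon> by (auto simp: v_def intro!: add_nonneg_nonneg)
    then show False using v1 by simp
  qed
  have "t1 \<noteq> 0" using init[OF x1] w_neg by auto
  then have t1': "0 < t1" "t1 \<le> T" using t1 by auto
  from super[OF t1' x1 w_neg] obtain g g' where
    int: "x1 \<in> interior D" and g: "g t1 = w t1 x1" "\<And>s. s \<in> {0..t1} \<Longrightarrow> w s x1 \<le> g s"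
    and g': "(g has_real_derivative g') (at t1 within {0..t1})"
    and ineq: "1 / 2 * w2 t1 x1 + b t1 x1 * w1 t1 x1 + c * w t1 x1 \<le> g'"
    by blast
  define E where "E = exp (- l * t1)"
  have E: "0 < E" by (simp add: E_def)
  from int obtain e where e: "0 < e" "ball x1 e \<subseteq> D" by (auto simp: mem_interior)
  have dv: "(v t1 has_real_derivative E * w1 t1 y + 2 * \<epsilon> * y) (at y)" for y
    unfolding v_def E_def
    by (rule derivative_eq_intros refl w1[OF t1])+ (simp add: algebra_simps)
  have dv2: "((\<lambda>y. E * w1 t1 y + 2 * \<epsilon> * y) has_real_derivative E * w2 t1 x1 + 2 * \<epsilon>) (at x1)"
    by (rule derivative_eq_intros refl w2[OF t1])+ (simp add: algebra_simps)
  have loc: "v t1 x1 \<le> v t1 y" if "\<bar>y - x1\<bar> < e" for y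
    using e(2) that by (intro min t1) (auto simp: dist_real_def abs_minus_commute)
  have fst0: "E * w1 t1 x1 + 2 * \<epsilon> * x1 = 0" and snd0: "0 \<le> E * w2 t1 x1 + 2 * \<epsilon>"
    using second_derivative_nonneg_at_min[OF dv dv2 e(1) loc] by auto
  \<comment> \<open>At fixed x1 the barrier is constant in time, so exp (- l s) w is minimal at
    \<open>t1\<close> among s \<le> t1. The majorant exp (- l s) g agrees with it at
    \<open>t1\<close> and is therefore minimal there too, so its left derivative is not
    positive.\<close>
  have "E * (g' - l * w t1 x1) \<le> 0"
  proof (rule left_derivative_nonpos_at_min[of "\<lambda>s. exp (- l * s) * g s"])
    show "((\<lambda>s. exp (- l * s) * g s) has_real_derivative E * (g' - l * w t1 x1))
        (at t1 within {0..t1})"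
      unfolding E_def by (rule derivative_eq_intros refl g')+ (simp add: g algebra_simps)
    fix s assume s: "s \<in> {0..t1}"
    have "exp (- l * t1) * w t1 x1 \<le> exp (- l * s) * w s x1"
      using min[of s x1] s t1 x1 by (auto simp: v_def)
    also have "\<dots> \<le> exp (- l * s) * g s" using g(2)[OF s] by simp
    finally show "exp (- l * t1) * g t1 \<le> exp (- l * s) * g s" using g(1) by simp
  qed fact
  moreover have "E * (1 / 2 * w2 t1 x1 + b t1 x1 * w1 t1 x1 + c * w t1 x1) \<le> E * g'"
    using ineq E by simp
  ultimately have "E * w2 t1 x1 / 2 + b t1 x1 * (E * w1 t1 x1) + (c - l) * (E * w t1 x1) \<le> 0"
    by (simp add: algebra_simps)
  moreover have "E * w1 t1 x1 = - 2 * \<epsilon> * x1" using fst0 by simp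
  ultimately have A: "- \<epsilon> - 2 * \<epsilon> * (b t1 x1 * x1) - (bb + 2) * (E * w t1 x1) \<le> 0"
    using snd0 by (simp add: l_def algebra_simps)
  define Q where "Q = \<epsilon> * (1 + x1\<^sup>2)"
  define W where "W = E * w t1 x1"
  have "Q \<le> - W" using v1 by (simp add: v_def E_def Q_def W_def)
  then have "(bb + 2) * Q \<le> (bb + 2) * - W" using bb by (intro mult_left_mono) auto
  then have f1: "bb * Q + 2 * Q \<le> - (bb * W) - 2 * W" by (simp add: algebra_simps)
  have "b t1 x1 * x1 \<le> bb * \<bar>x1\<bar>"
    using mult_right_mono[OF b[OF t1 x1], of "\<bar>x1\<bar>"] abs_ge_self[of "b t1 x1 * x1"]
    by (simp add: abs_mult)
  then have f2: "\<epsilon> * (b t1 x1 * x1) \<le> \<epsilon> * (bb * \<bar>x1\<bar>)" using \<epsilon> by (intro mult_left_mono) auto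
  have "\<epsilon> * bb * (2 * \<bar>x1\<bar>) \<le> \<epsilon> * bb * (1 + x1\<^sup>2)"
    using \<epsilon> bb zero_le_power2[of "\<bar>x1\<bar> - 1"]
    by (intro mult_left_mono) (auto simp: power2_diff)
  then have f3: "2 * (\<epsilon> * (bb * \<bar>x1\<bar>)) \<le> bb * Q" by (simp add: Q_def mult_ac)
  have f4: "\<epsilon> \<le> Q" using \<epsilon> by (simp add: Q_def)
  have "- \<epsilon> - 2 * (\<epsilon> * (b t1 x1 * x1)) - (bb * W + 2 * W) \<le> 0"
    using A by (simp add: W_def algebra_simps)
  then show False using f1 f2 f3 f4 \<epsilon> by linarith
qed

section \<open>Flows of the Parisi equation\<close>

text \<open>\<open>d k t\<close> is the \<open>k\<close>-th spatial derivative of a solution of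
  \<open>\<partial>\<^sub>t\<phi> = (\<partial>\<^sub>x\<^sub>x\<phi> + \<alpha> (\<partial>\<^sub>x\<phi>)\<^sup>2) / 2\<close>, and \<open>S k\<close> is the \<open>k\<close>-th spatial derivative of \<open>(\<partial>\<^sub>x\<phi>)\<^sup>2\<close>. Time runs
  backwards compared with the Parisi equation, so \<open>\<alpha>\<close> decreases and is continuous from the left.\<close>

locale parisi_flow =
  fixes d S :: "nat \<Rightarrow> real \<Rightarrow> real \<Rightarrow> real" and \<alpha> :: "real \<Rightarrow> real" and T :: real
  assumes T_nonneg: "0 \<le> T"
    and d_x: "\<And>k t x. 1 \<le> k \<Longrightarrow> t \<in> {0..T} \<Longrightarrow> (d k t has_real_derivative d (Suc k) t x) (at x)"
    and d_bdd: "\<And>k. 1 \<le> k \<Longrightarrow> \<exists>M. \<forall>t\<in>{0..T}. \<forall>x. \<bar>d k t x\<bar> \<le> M"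
    and d_cont: "\<And>k. 1 \<le> k \<Longrightarrow> continuous_on ({0..T} \<times> UNIV) (\<lambda>(t, x). d k t x)"
    and \<alpha>_range: "\<And>t. t \<in> {0..T} \<Longrightarrow> 0 \<le> \<alpha> t \<and> \<alpha> t \<le> 1"
    and \<alpha>_mono: "\<And>s t. 0 \<le> s \<Longrightarrow> s \<le> t \<Longrightarrow> t \<le> T \<Longrightarrow> \<alpha> t \<le> \<alpha> s"
    and \<alpha>_left: "\<And>t. t \<in> {0..T} \<Longrightarrow> (\<alpha> \<longlongrightarrow> \<alpha> t) (at t within {0..t})"
    and S_0: "\<And>t x. t \<in> {0..T} \<Longrightarrow> S 0 t x = (d 1 t x)\<^sup>2"
    and S_x: "\<And>k t x. t \<in> {0..T} \<Longrightarrow> (S k t has_real_derivative S (Suc k) t x) (at x)"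
    and d_t: "\<And>k t x. 1 \<le> k \<Longrightarrow> 0 < t \<Longrightarrow> t \<le> T \<Longrightarrow>
        ((\<lambda>s. d k s x) has_real_derivative 1 / 2 * (d (k + 2) t x + \<alpha> t * S k t x)) (at t within {0..t})"
begin

text \<open>A decreasing left-continuous \<alpha> is upper semicontinuous: near t it stays below
  \<alpha> t + \<eta>, on the left by continuity and on the right by monotonicity. As q \<ge> 0,
  \<alpha> may be replaced by this constant, which leaves a continuous function; \<eta> is chosen to
  use up at most half of the margin above \<open>a\<close>.\<close>

lemma lsc_diff:
  fixes p q :: "real \<Rightarrow> real \<Rightarrow> real"
  assumes p: "continuous_on ({0..T} \<times> D) (\<lambda>(t, x). p t x)"
    and q: "continuous_on ({0..T} \<times> D) (\<lambda>(t, x). q t x)"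
    and q_nonneg: "\<And>t x. t \<in> {0..T} \<Longrightarrow> x \<in> D \<Longrightarrow> 0 \<le> q t x"
    and t: "t \<in> {0..T}" and x: "x \<in> D" and a: "a < p t x - \<alpha> t * q t x"
  shows "\<forall>\<^sub>F r in at (t, x) within {0..T} \<times> D. a < p (fst r) (snd r) - \<alpha> (fst r) * q (fst r) (snd r)"
proof -
  define \<eta> where "\<eta> = (p t x - \<alpha> t * q t x - a) / (2 * (1 + q t x))"
  have q0: "0 \<le> q t x" using q_nonneg t x by auto
  have \<eta>: "0 < \<eta>" using a q0 unfolding \<eta>_def by (intro divide_pos_pos) auto
  have "\<eta> * q t x \<le> \<eta> * (1 + q t x)" using \<eta> by simp
  also have "\<dots> = (p t x - \<alpha> t * q t x - a) / 2" using q0 by (simp add: \<eta>_def field_simps)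
  also have "\<dots> < p t x - \<alpha> t * q t x - a" using a by simp
  finally have a': "a < p t x - (\<alpha> t + \<eta>) * q t x" by (simp add: algebra_simps)
  have "continuous_on ({0..T} \<times> D) (\<lambda>r. p (fst r) (snd r) - (\<alpha> t + \<eta>) * q (fst r) (snd r))"
    using p q by (intro continuous_intros) (auto simp: split_def)
  from this[unfolded continuous_on_def, rule_format, of "(t, x)"] t x
  have "((\<lambda>r. p (fst r) (snd r) - (\<alpha> t + \<eta>) * q (fst r) (snd r)) \<longlongrightarrow>
      p t x - (\<alpha> t + \<eta>) * q t x) (at (t, x) within {0..T} \<times> D)" by simp
  then have 1: "\<forall>\<^sub>F r in at (t, x) within {0..T} \<times> D.
      a < p (fst r) (snd r) - (\<alpha> t + \<eta>) * q (fst r) (snd r)"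
    using a' by (rule order_tendstoD)
  have "\<forall>\<^sub>F s in at t within {0..t}. \<alpha> s < \<alpha> t + \<eta>"
    using \<alpha>_left[OF t] \<eta> by (intro order_tendstoD) auto
  then obtain \<delta> where \<delta>: "0 < \<delta>" "\<And>s. s \<in> {0..t} \<Longrightarrow> s \<noteq> t \<Longrightarrow> dist s t < \<delta> \<Longrightarrow> \<alpha> s < \<alpha> t + \<eta>"
    unfolding eventually_at by blast
  have \<alpha>_le: "\<alpha> s \<le> \<alpha> t + \<eta>" if "s \<in> {0..T}" "dist s t < \<delta>" for s
  proof (cases "s < t")
    case True
    then show ?thesis using \<delta>(2)[of s] that by auto
  next
    case False
    then show ?thesis using \<alpha>_mono[of t s] t that \<eta> by auto
  qed
  have 2: "\<forall>\<^sub>F r in at (t, x) within {0..T} \<times> D. r \<in> {0..T} \<times> D \<and> \<alpha> (fst r) \<le> \<alpha> t + \<eta>"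
    unfolding eventually_at
  proof (intro exI conjI ballI impI)
    fix r assume "r \<in> {0..T} \<times> D" "r \<noteq> (t, x) \<and> dist r (t, x) < \<delta>"
    then show "\<alpha> (fst r) \<le> \<alpha> t + \<eta>"
      using dist_fst_le[of r "(t, x)"] by (intro \<alpha>_le) (auto simp: mem_Times_iff)
  qed (use \<delta> in auto)
  from 1 2 show ?thesis
  proof eventually_elim
    case (elim r)
    then have "\<alpha> (fst r) * q (fst r) (snd r) \<le> (\<alpha> t + \<eta>) * q (fst r) (snd r)"
      using q_nonneg by (intro mult_right_mono) (auto simp: mem_Times_iff)
    then show ?case using elim by linarith
  qed
qed

text \<open>\<alpha> is frozen at its value at the time t in question: for s \<le> t one has
  \<alpha> s \<ge> \<alpha> t, so with q \<ge> 0 the function p - (\<alpha> t) q majorises p -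
  \<alpha> q, agrees with it at t, and has a left time derivative there.\<close>

lemma flow_maximum_principle:
  fixes p q w1 w2 b :: "real \<Rightarrow> real \<Rightarrow> real"
  assumes D: "closed D"
    and p: "continuous_on ({0..T} \<times> D) (\<lambda>(t, x). p t x)"
    and q: "continuous_on ({0..T} \<times> D) (\<lambda>(t, x). q t x)"
    and q_nonneg: "\<And>t x. t \<in> {0..T} \<Longrightarrow> x \<in> D \<Longrightarrow> 0 \<le> q t x"
    and init: "\<And>x. x \<in> D \<Longrightarrow> 0 \<le> p 0 x - \<alpha> 0 * q 0 x"
    and lower: "\<And>t x. t \<in> {0..T} \<Longrightarrow> x \<in> D \<Longrightarrow> - A \<le> p t x - \<alpha> t * q t x"
    and b: "\<And>t x. t \<in> {0..T} \<Longrightarrow> x \<in> D \<Longrightarrow> \<bar>b t x\<bar> \<le> bb"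
    and c: "0 \<le> c"
    and w1: "\<And>t x. t \<in> {0..T} \<Longrightarrow> ((\<lambda>y. p t y - \<alpha> t * q t y) has_real_derivative w1 t x) (at x)"
    and w2: "\<And>t x. t \<in> {0..T} \<Longrightarrow> (w1 t has_real_derivative w2 t x) (at x)"
    and super: "\<And>t x. 0 < t \<Longrightarrow> t \<le> T \<Longrightarrow> x \<in> D \<Longrightarrow> p t x - \<alpha> t * q t x < 0 \<Longrightarrow> x \<in> interior D \<and>
        (\<exists>p' q'. ((\<lambda>s. p s x) has_real_derivative p') (at t within {0..t}) \<and>
          ((\<lambda>s. q s x) has_real_derivative q') (at t within {0..t}) \<and>
          1 / 2 * w2 t x + b t x * w1 t x + c * (p t x - \<alpha> t * q t x) \<le> p' - \<alpha> t * q')"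
    and t: "t \<in> {0..T}" and x: "x \<in> D"
  shows "0 \<le> p t x - \<alpha> t * q t x"
proof (rule maximum_principle[where w = "\<lambda>t x. p t x - \<alpha> t * q t x" and D = D and T = T
      and ?w1.0 = w1 and ?w2.0 = w2 and b = b and A = A and c = c and bb = bb])
  fix t x :: real assume t: "0 < t" "t \<le> T" and x: "x \<in> D" and neg: "p t x - \<alpha> t * q t x < 0"
  from super[OF t x neg] obtain p' q' where int: "x \<in> interior D"
    and p': "((\<lambda>s. p s x) has_real_derivative p') (at t within {0..t})"
    and q': "((\<lambda>s. q s x) has_real_derivative q') (at t within {0..t})"
    and ineq: "1 / 2 * w2 t x + b t x * w1 t x + c * (p t x - \<alpha> t * q t x) \<le> p' - \<alpha> t * q'"
    by blast
  show "x \<in> interior D \<and> (\<exists>g g'. g t = p t x - \<alpha> t * q t x \<and>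
      (\<forall>s\<in>{0..t}. p s x - \<alpha> s * q s x \<le> g s) \<and> (g has_real_derivative g') (at t within {0..t}) \<and>
      1 / 2 * w2 t x + b t x * w1 t x + c * (p t x - \<alpha> t * q t x) \<le> g')"
  proof (intro conjI exI[of _ "\<lambda>s. p s x - \<alpha> t * q s x"] exI[of _ "p' - \<alpha> t * q'"] ballI int ineq refl)
    show "((\<lambda>s. p s x - \<alpha> t * q s x) has_real_derivative p' - \<alpha> t * q') (at t within {0..t})"
      by (rule derivative_eq_intros p' q' refl)+ simp
    fix s assume s: "s \<in> {0..t}"
    then have "\<alpha> t * q s x \<le> \<alpha> s * q s x"
      using \<alpha>_mono[of s t] q_nonneg[of s x] t x by (intro mult_right_mono) auto
    then show "p s x - \<alpha> s * q s x \<le> p s x - \<alpha> t * q s x" by simp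
  qed
qed (use assms lsc_diff[OF p q q_nonneg] in auto)

section \<open>Low-order derivatives of the flow in explicit form\<close>

lemma S_simps:
  assumes t: "t \<in> {0..T}"
  shows "S 1 t x = 2 * d 1 t x * d 2 t x" (is ?S1)
    and "S 2 t x = 2 * (d 2 t x)\<^sup>2 + 2 * d 1 t x * d 3 t x" (is ?S2)
    and "S 3 t x = 6 * d 2 t x * d 3 t x + 2 * d 1 t x * d 4 t x" (is ?S3)
    and "S 4 t x = 6 * (d 3 t x)\<^sup>2 + 8 * d 2 t x * d 4 t x + 2 * d 1 t x * d 5 t x" (is ?S4)
    and "S 5 t x = 20 * d 3 t x * d 4 t x + 10 * d 2 t x * d 5 t x + 2 * d 1 t x * d 6 t x" (is ?S5)
proof -
  have dx: "(d 1 t has_real_derivative d 2 t x) (at x)" "(d 2 t has_real_derivative d 3 t x) (at x)"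
    "(d 3 t has_real_derivative d 4 t x) (at x)" "(d 4 t has_real_derivative d 5 t x) (at x)"
    "(d 5 t has_real_derivative d 6 t x) (at x)" for x
    using d_x[of 1 t] d_x[of 2 t] d_x[of 3 t] d_x[of 4 t] d_x[of 5 t] t
    by (simp_all add: eval_nat_numeral)
  have Sx: "(S 0 t has_real_derivative S 1 t x) (at x)" "(S 1 t has_real_derivative S 2 t x) (at x)"
    "(S 2 t has_real_derivative S 3 t x) (at x)" "(S 3 t has_real_derivative S 4 t x) (at x)"
    "(S 4 t has_real_derivative S 5 t x) (at x)" for x
    using S_x[of t 0] S_x[of t 1] S_x[of t 2] S_x[of t 3] S_x[of t 4] t
    by (simp_all add: eval_nat_numeral)
  have S0: "S 0 t = (\<lambda>x. (d 1 t x)\<^sup>2)" using S_0[OF t] by auto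
  have S1: "S 1 t x = 2 * d 1 t x * d 2 t x" for x
    by (rule DERIV_unique[OF Sx(1)], unfold S0) (rule derivative_eq_intros dx refl | simp)+
  then have S1': "S 1 t = (\<lambda>x. 2 * d 1 t x * d 2 t x)" by auto
  have S2: "S 2 t x = 2 * (d 2 t x)\<^sup>2 + 2 * d 1 t x * d 3 t x" for x
    by (rule DERIV_unique[OF Sx(2)], unfold S1')
      (rule derivative_eq_intros dx refl | simp add: power2_eq_square)+
  then have S2': "S 2 t = (\<lambda>x. 2 * (d 2 t x)\<^sup>2 + 2 * d 1 t x * d 3 t x)" by auto
  have S3: "S 3 t x = 6 * d 2 t x * d 3 t x + 2 * d 1 t x * d 4 t x" for x
    by (rule DERIV_unique[OF Sx(3)], unfold S2')
      (rule derivative_eq_intros dx refl | simp add: power2_eq_square)+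
  then have S3': "S 3 t = (\<lambda>x. 6 * d 2 t x * d 3 t x + 2 * d 1 t x * d 4 t x)" by auto
  have S4: "S 4 t x = 6 * (d 3 t x)\<^sup>2 + 8 * d 2 t x * d 4 t x + 2 * d 1 t x * d 5 t x" for x
    by (rule DERIV_unique[OF Sx(4)], unfold S3')
      (rule derivative_eq_intros dx refl | simp add: power2_eq_square)+
  then have S4': "S 4 t = (\<lambda>x. 6 * (d 3 t x)\<^sup>2 + 8 * d 2 t x * d 4 t x + 2 * d 1 t x * d 5 t x)" by auto
  have S5: "S 5 t x = 20 * d 3 t x * d 4 t x + 10 * d 2 t x * d 5 t x + 2 * d 1 t x * d 6 t x" for x
    by (rule DERIV_unique[OF Sx(5)], unfold S4')
      (rule derivative_eq_intros dx refl | simp add: power2_eq_square)+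
  show ?S1 ?S2 ?S3 ?S4 ?S5 by (rule S1 S2 S3 S4 S5)+
qed

lemma d_x':
  assumes "t \<in> {0..T}"
  shows "(d 1 t has_real_derivative d 2 t x) (at x)" "(d 2 t has_real_derivative d 3 t x) (at x)"
    "(d 3 t has_real_derivative d 4 t x) (at x)" "(d 4 t has_real_derivative d 5 t x) (at x)"
    "(d 5 t has_real_derivative d 6 t x) (at x)" "(d 6 t has_real_derivative d 7 t x) (at x)"
  using d_x[of 1 t] d_x[of 2 t] d_x[of 3 t] d_x[of 4 t] d_x[of 5 t] d_x[of 6 t] assms
  by (simp_all add: eval_nat_numeral)

lemma d_t':
  assumes "0 < t" "t \<le> T"
  shows "((\<lambda>s. d 1 s x) has_real_derivative 1 / 2 * (d 3 t x + \<alpha> t * S 1 t x)) (at t within {0..t})"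
    "((\<lambda>s. d 2 s x) has_real_derivative 1 / 2 * (d 4 t x + \<alpha> t * S 2 t x)) (at t within {0..t})"
    "((\<lambda>s. d 3 s x) has_real_derivative 1 / 2 * (d 5 t x + \<alpha> t * S 3 t x)) (at t within {0..t})"
    "((\<lambda>s. d 4 s x) has_real_derivative 1 / 2 * (d 6 t x + \<alpha> t * S 4 t x)) (at t within {0..t})"
    "((\<lambda>s. d 5 s x) has_real_derivative 1 / 2 * (d 7 t x + \<alpha> t * S 5 t x)) (at t within {0..t})"
  using d_t[of 1 t x] d_t[of 2 t x] d_t[of 3 t x] d_t[of 4 t x] d_t[of 5 t x] assms
  by (simp_all add: eval_nat_numeral)

lemma d_bdd_pos:
  assumes "1 \<le> k"
  obtains M where "0 \<le> M" "\<And>t x. t \<in> {0..T} \<Longrightarrow> \<bar>d k t x\<bar> \<le> M"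
proof -
  from d_bdd[OF assms] obtain M where M: "\<forall>t\<in>{0..T}. \<forall>x. \<bar>d k t x\<bar> \<le> M" by blast
  then have "\<bar>d k 0 0\<bar> \<le> M" using T_nonneg by auto
  then show ?thesis using M that[of M] by fastforce
qed

lemma d_cont': "1 \<le> k \<Longrightarrow> continuous_on ({0..T} \<times> D) (\<lambda>r. d k (fst r) (snd r))"
  using continuous_on_subset[OF d_cont[of k], of "{0..T} \<times> D"] by (auto simp: split_def)

lemma \<alpha>_mult_bound:
  assumes "t \<in> {0..T}" "\<bar>X\<bar> \<le> M"
  shows "\<bar>\<alpha> t * X\<bar> \<le> M"
  using mult_mono[of "\<bar>\<alpha> t\<bar>" 1 "\<bar>X\<bar>" M] \<alpha>_range[OF assms(1)] assms(2)
  by (simp add: abs_mult)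

section \<open>Oddness, positivity and bounded ratios along a flow\<close>

lemma odd_preserved:
  assumes odd: "\<And>x. d 1 0 (- x) = - d 1 0 x" and t: "t \<in> {0..T}"
  shows "d 1 t (- x) = - d 1 t x"
proof -
  obtain M1 where M1: "0 \<le> M1" "\<And>t x. t \<in> {0..T} \<Longrightarrow> \<bar>d 1 t x\<bar> \<le> M1"
    by (rule d_bdd_pos[of 1]) auto
  obtain M2 where M2: "0 \<le> M2" "\<And>t x. t \<in> {0..T} \<Longrightarrow> \<bar>d 2 t x\<bar> \<le> M2"
    by (rule d_bdd_pos[of 2]) auto
  note M = M1 M2
  have refl_x: "((\<lambda>x. f (- x)) has_real_derivative - f' (- x)) (at x)"
    if "\<And>x. (f has_real_derivative f' x) (at x)" for f f' :: "real \<Rightarrow> real" and x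
  proof -
    have "(uminus has_real_derivative - 1) (at x)" by (auto intro!: derivative_eq_intros)
    from DERIV_chain2[OF that this] show ?thesis by simp
  qed
  let ?v = "\<lambda>\<sigma> t x. \<sigma> * (d 1 t x + d 1 t (- x))"
  let ?v1 = "\<lambda>\<sigma> t x. \<sigma> * (d 2 t x - d 2 t (- x))"
  let ?v2 = "\<lambda>\<sigma> t x. \<sigma> * (d 3 t x + d 3 t (- x))"
  let ?v_t = "\<lambda>\<sigma> t x. \<sigma> * (1 / 2 * (d 3 t x + \<alpha> t * S 1 t x) + 1 / 2 * (d 3 t (- x) + \<alpha> t * S 1 t (- x)))"
  \<comment> \<open>The defect d 1 t x + d 1 t (- x) solves a linear equation with drift
    \<open>\<alpha> t * d 1 t x\<close> and zero-order coefficient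
    \<open>\<alpha> t * d 2 t (- x)\<close>, bounded by \<open>M2\<close>; using both signs \<sigma>
    squeezes it to 0.\<close>
  have key: "0 \<le> ?v \<sigma> t x - \<alpha> t * 0" if \<sigma>: "\<sigma> \<in> {-1, 1}" for \<sigma> :: real
  proof (rule flow_maximum_principle[where p = "\<lambda>t x. ?v \<sigma> t x" and q = "\<lambda>_ _. 0"
        and D = UNIV and A = "2 * M1" and b = "\<lambda>t x. \<alpha> t * d 1 t x" and bb = M1 and c = M2
        and ?w1.0 = "\<lambda>t x. ?v1 \<sigma> t x"
        and ?w2.0 = "\<lambda>t x. ?v2 \<sigma> t x"])
    have "continuous_on ({0..T} \<times> UNIV) (\<lambda>r. d 1 (fst r) (- snd r))"
      using continuous_on_compose2[OF d_cont'[of 1 UNIV], of "{0..T} \<times> UNIV" "\<lambda>r. (fst r, - snd r)"]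
      by (force intro!: continuous_intros)
    then show "continuous_on ({0..T} \<times> UNIV) (\<lambda>(t, x). ?v \<sigma> t x)"
      unfolding split_def by (intro continuous_intros d_cont') auto
    show "- (2 * M1) \<le> ?v \<sigma> t x - \<alpha> t * 0" if "t \<in> {0..T}" for t x
      using M(2)[OF that, of x] M(2)[OF that, of "- x"] \<sigma> by auto
    show "\<bar>\<alpha> t * d 1 t x\<bar> \<le> M1" if "t \<in> {0..T}" for t x
      by (rule \<alpha>_mult_bound[OF that M(2)[OF that]])
    fix t x :: real assume t: "t \<in> {0..T}"
    note dx = d_x'[OF t] refl_x[OF d_x'(1)[OF t]] refl_x[OF d_x'(2)[OF t]]
    show "((\<lambda>y. ?v \<sigma> t y - \<alpha> t * 0) has_real_derivative ?v1 \<sigma> t x) (at x)"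
      by (rule derivative_eq_intros dx refl)+ simp
    show "((\<lambda>x. ?v1 \<sigma> t x) has_real_derivative ?v2 \<sigma> t x) (at x)"
      by (rule derivative_eq_intros dx refl)+ simp
  next
    fix t x :: real assume t: "0 < t" "t \<le> T" and neg: "?v \<sigma> t x - \<alpha> t * 0 < 0"
    then have tT: "t \<in> {0..T}" by auto
    have "\<alpha> t * d 2 t (- x) \<le> M2"
      using \<alpha>_mult_bound[OF tT M(4)[OF tT, of "- x"]] by simp
    then have "M2 * (?v \<sigma> t x) \<le>
        \<alpha> t * d 2 t (- x) * (?v \<sigma> t x)"
      using neg by (intro mult_right_mono_neg) auto
    then have ineq: "1 / 2 * ?v2 \<sigma> t x + \<alpha> t * d 1 t x * ?v1 \<sigma> t x +
        M2 * (?v \<sigma> t x - \<alpha> t * 0) \<le>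
        ?v_t \<sigma> t x - \<alpha> t * 0"
      by (simp add: S_simps[OF tT] algebra_simps del: One_nat_def)
    have der: "((\<lambda>s. ?v \<sigma> s x) has_real_derivative
        ?v_t \<sigma> t x) (at t within {0..t})"
      by (rule derivative_eq_intros d_t'[OF t] refl)+ simp
    show "x \<in> interior UNIV \<and> (\<exists>p' q'.
        ((\<lambda>s. ?v \<sigma> s x) has_real_derivative p') (at t within {0..t}) \<and>
        ((\<lambda>s. 0) has_real_derivative q') (at t within {0..t}) \<and>
        1 / 2 * ?v2 \<sigma> t x + \<alpha> t * d 1 t x * ?v1 \<sigma> t x +
        M2 * (?v \<sigma> t x - \<alpha> t * 0) \<le> p' - \<alpha> t * q')"
      using der ineq by (intro conjI exI[of _ 0] exI) auto
  qed (use M t odd in auto)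
  show ?thesis using key[of 1] key[of "-1"] by simp
qed

text \<open>Positivity of d 2 has no uniform margin at infinity, so an explicit subsolution is
  propagated: \<open>c * exp (- l * t)\<close> times sech^2. The logarithmic derivative - 2 tanh x
  of sech^2 is bounded, hence the drift costs only a finite decay rate, and the source \<alpha> (d
  2)^2 has the good sign.\<close>

lemma sech_lower_bound_preserved:
  assumes c: "0 < c" and init: "\<And>x. c * (1 - (tanh x)\<^sup>2) \<le> d 2 0 x"
  shows "\<exists>c'>0. \<forall>t\<in>{0..T}. \<forall>x. c' * (1 - (tanh x)\<^sup>2) \<le> d 2 t x"
proof -
  obtain M1 where M1: "0 \<le> M1" "\<And>t x. t \<in> {0..T} \<Longrightarrow> \<bar>d 1 t x\<bar> \<le> M1"
    by (rule d_bdd_pos[of 1]) auto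
  obtain M2 where M2: "0 \<le> M2" "\<And>t x. t \<in> {0..T} \<Longrightarrow> \<bar>d 2 t x\<bar> \<le> M2"
    by (rule d_bdd_pos[of 2]) auto
  note M = M1 M2
  \<comment> \<open>\<open>2 * M1\<close> absorbs the drift term 2 \<alpha> (d 1) tanh, and 1 bounds
    1 - 3 tanh^2, which comes from the second derivative of sech^2.\<close>
  define l where "l = 1 + 2 * M1"
  have sech: "0 \<le> 1 - (tanh x)\<^sup>2" "1 - (tanh x)\<^sup>2 \<le> 1" "\<bar>tanh x\<bar> \<le> 1" for x :: real
    using tanh_real_bounds[of x] by (auto simp: abs_square_le_1)
  let ?v = "\<lambda>t x. d 2 t x - c * exp (- l * t) * (1 - (tanh x)\<^sup>2)"
  let ?v1 = "\<lambda>t x. d 3 t x + 2 * c * exp (- l * t) * (tanh x * (1 - (tanh x)\<^sup>2))"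
  let ?v2 = "\<lambda>t x. d 4 t x + 2 * c * exp (- l * t) * ((1 - (tanh x)\<^sup>2) * (1 - 3 * (tanh x)\<^sup>2))"
  have key: "0 \<le> ?v t x - \<alpha> t * 0" if "t \<in> {0..T}" for t x
  proof (rule flow_maximum_principle[where p = "?v"
        and q = "\<lambda>_ _. 0" and D = UNIV and A = "M2 + c" and b = "\<lambda>t x. \<alpha> t * d 1 t x" and bb = M1 and c = 0
        and ?w1.0 = ?v1
        and ?w2.0 = ?v2])
    show "continuous_on ({0..T} \<times> UNIV) (\<lambda>(t, x). ?v t x)"
      unfolding split_def by (intro continuous_intros d_cont') auto
    show "- (M2 + c) \<le> ?v t x - \<alpha> t * 0" if "t \<in> {0..T}" for t x
    proof -
      have "0 \<le> l * t" using that M by (simp add: l_def)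
      then have "exp (- l * t) * (1 - (tanh x)\<^sup>2) \<le> 1 * 1"
        using sech[of x] by (intro mult_mono) auto
      then have "c * (exp (- l * t) * (1 - (tanh x)\<^sup>2)) \<le> c * 1" using c by (intro mult_left_mono) auto
      then show ?thesis using M(4)[OF that, of x] by (simp add: mult.assoc)
    qed
    show "\<bar>\<alpha> t * d 1 t x\<bar> \<le> M1" if "t \<in> {0..T}" for t x
      by (rule \<alpha>_mult_bound[OF that M(2)[OF that]])
    fix t x :: real assume t: "t \<in> {0..T}"
    note dx = d_x'[OF t]
    show "((\<lambda>y. ?v t y - \<alpha> t * 0) has_real_derivative
        ?v1 t x) (at x)"
      by (rule derivative_eq_intros dx refl | simp)+
    show "((\<lambda>x. ?v1 t x) has_real_derivative
        ?v2 t x) (at x)"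
      by (rule derivative_eq_intros dx refl | simp)+ (simp add: algebra_simps power2_eq_square)
  next
    fix t x :: real assume t: "0 < t" "t \<le> T"
    then have tT: "t \<in> {0..T}" by auto
    define E where "E = c * exp (- l * t)"
    define s where "s = 1 - (tanh x)\<^sup>2"
    have Es: "0 \<le> E * s" using c sech[of x] by (simp add: E_def s_def)
    have "\<alpha> t * d 1 t x * tanh x \<le> \<bar>\<alpha> t\<bar> * \<bar>d 1 t x\<bar> * \<bar>tanh x\<bar>"
      by (metis abs_ge_self abs_mult)
    also have "\<dots> \<le> 1 * M1 * 1"
      using \<alpha>_range[OF tT] M(2)[OF tT, of x] sech(3)[of x] M(1) by (intro mult_mono) auto
    finally have "2 * (\<alpha> t * d 1 t x * tanh x) + (1 - 3 * (tanh x)\<^sup>2) \<le> l"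
      using zero_le_power2[of "tanh x"] unfolding l_def by linarith
    then have "E * s * (2 * (\<alpha> t * d 1 t x * tanh x) + (1 - 3 * (tanh x)\<^sup>2)) \<le> E * s * l"
      using Es by (intro mult_left_mono) auto
    moreover have "0 \<le> \<alpha> t * (d 2 t x)\<^sup>2" using \<alpha>_range[OF tT] by simp
    ultimately have ineq: "1 / 2 * (d 4 t x + 2 * E * (s * (1 - 3 * (tanh x)\<^sup>2))) +
        \<alpha> t * d 1 t x * (d 3 t x + 2 * E * (tanh x * s)) + 0 * (d 2 t x - E * s - \<alpha> t * 0)
        \<le> 1 / 2 * (d 4 t x + \<alpha> t * S 2 t x) + l * (E * s) - \<alpha> t * 0"
      by (simp add: S_simps[OF tT] algebra_simps)
    have der: "((\<lambda>t. ?v t x) has_real_derivative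
        1 / 2 * (d 4 t x + \<alpha> t * S 2 t x) + l * (E * s)) (at t within {0..t})"
      unfolding E_def s_def by (rule derivative_eq_intros d_t'[OF t] refl | simp)+
    show "x \<in> interior UNIV \<and> (\<exists>p' q'.
        ((\<lambda>t. ?v t x) has_real_derivative p') (at t within {0..t}) \<and>
        ((\<lambda>s. 0) has_real_derivative q') (at t within {0..t}) \<and>
        1 / 2 * ?v2 t x +
        \<alpha> t * d 1 t x * ?v1 t x +
        0 * (?v t x - \<alpha> t * 0) \<le> p' - \<alpha> t * q')"
      using der ineq unfolding E_def s_def
      by (intro conjI exI[of _ 0] exI) (auto simp: mult.assoc)
  qed (use M that init in auto)
  have "c * exp (- l * T) * (1 - (tanh x)\<^sup>2) \<le> d 2 t x" if "t \<in> {0..T}" for t x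
  proof -
    have "exp (- l * T) \<le> exp (- l * t)" using that M by (simp add: l_def mult_left_mono)
    then have "c * exp (- l * T) * (1 - (tanh x)\<^sup>2) \<le> c * exp (- l * t) * (1 - (tanh x)\<^sup>2)"
      using c sech[of x] by (intro mult_right_mono mult_left_mono) auto
    then show ?thesis using key[OF that, of x] by simp
  qed
  then show ?thesis using c by (intro exI[of _ "c * exp (- l * T)"]) auto
qed

text \<open>The comparison functions are \<open>A exp (l t) d 2 \<plusminus> d k\<close>.\<close>

lemma ratio_bound_preserved:
  assumes y: "\<And>t x. t \<in> {0..T} \<Longrightarrow> 0 < d 2 t x" and k: "1 \<le> k"
    and S: "\<And>t x. t \<in> {0..T} \<Longrightarrow> S k t x = 2 * d 1 t x * d (k + 1) t x + 2 * real k * d 2 t x * d k t x + R t x"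
    and R: "\<And>t x. t \<in> {0..T} \<Longrightarrow> \<bar>R t x\<bar> \<le> R0 * d 2 t x"
    and init: "\<And>x. \<bar>d k 0 x\<bar> \<le> A0 * d 2 0 x"
  shows "\<exists>A\<ge>0. \<forall>t\<in>{0..T}. \<forall>x. \<bar>d k t x\<bar> \<le> A * d 2 t x"
proof -
  obtain M1 where M1: "0 \<le> M1" "\<And>t x. t \<in> {0..T} \<Longrightarrow> \<bar>d 1 t x\<bar> \<le> M1"
    by (rule d_bdd_pos[of 1]) auto
  obtain M2 where M2: "0 \<le> M2" "\<And>t x. t \<in> {0..T} \<Longrightarrow> \<bar>d 2 t x\<bar> \<le> M2"
    by (rule d_bdd_pos[of 2]) auto
  obtain Mk where Mk: "0 \<le> Mk" "\<And>t x. t \<in> {0..T} \<Longrightarrow> \<bar>d k t x\<bar> \<le> Mk"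
    by (rule d_bdd_pos[OF k]) auto
  note M = M1 M2 Mk
  have "0 \<le> R0 * d 2 0 0" using R[of 0 0] T_nonneg by force
  then have R0: "0 \<le> R0" using y[of 0 0] T_nonneg by (simp add: zero_le_mult_iff)
  \<comment> \<open>\<open>real k * M2\<close> dominates the reaction term k \<alpha> (d 2) (d k)
    and \<open>R0\<close> the remainder \<open>R\<close>; the growth of the comparison function pays
    for both.\<close>
  define l where "l = real k * M2 + R0"
  have l: "0 \<le> l" using M R0 by (simp add: l_def)
  \<comment> \<open>Besides dominating \<open>A0\<close>, \<open>A\<close> is at least 1, so that
    the factor \<open>A * exp (l * t)\<close> covers one copy of \<open>R0 * d 2\<close>.\<close>
  define A where "A = \<bar>A0\<bar> + 1"
  have A: "1 \<le> A" "A0 \<le> A" by (auto simp: A_def)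
  have dkx: "(d (k + j) t has_real_derivative d (k + j + 1) t x) (at x)" if "t \<in> {0..T}" for t x j
    using d_x[of "k + j" t x] k that by simp
  let ?v = "\<lambda>\<sigma> t x. A * exp (l * t) * d 2 t x - \<sigma> * d k t x"
  let ?v1 = "\<lambda>\<sigma> t x. A * exp (l * t) * d 3 t x - \<sigma> * d (k + 1) t x"
  let ?v2 = "\<lambda>\<sigma> t x. A * exp (l * t) * d 4 t x - \<sigma> * d (k + 2) t x"
  have key: "0 \<le> ?v \<sigma> t x - \<alpha> t * 0"
    if \<sigma>: "\<sigma> \<in> {-1, 1}" and "t \<in> {0..T}" for \<sigma> :: real and t x
  proof (rule flow_maximum_principle[where p = "?v \<sigma>"
        and q = "\<lambda>_ _. 0" and D = UNIV and A = Mk and b = "\<lambda>t x. \<alpha> t * d 1 t x" and bb = M1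
        and c = "real k * M2"
        and ?w1.0 = "?v1 \<sigma>"
        and ?w2.0 = "?v2 \<sigma>"])
    show "continuous_on ({0..T} \<times> UNIV) (\<lambda>(t, x). ?v \<sigma> t x)"
      unfolding split_def by (intro continuous_intros d_cont' k) auto
    show "- Mk \<le> ?v \<sigma> t x - \<alpha> t * 0" if "t \<in> {0..T}" for t x
    proof -
      have "0 \<le> A * exp (l * t) * d 2 t x" using A y[OF that, of x] by simp
      then show ?thesis using M(6)[OF that, of x] \<sigma> by auto
    qed
    show "\<bar>\<alpha> t * d 1 t x\<bar> \<le> M1" if "t \<in> {0..T}" for t x
      by (rule \<alpha>_mult_bound[OF that M(2)[OF that]])
    show "0 \<le> ?v \<sigma> 0 x - \<alpha> 0 * 0" for x
    proof -
      have "A0 * d 2 0 x \<le> A * d 2 0 x" using A y[of 0 x] T_nonneg by (intro mult_right_mono) auto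
      then show ?thesis using init[of x] \<sigma> by auto
    qed
    fix t x :: real assume t: "t \<in> {0..T}"
    note dx = d_x'[OF t] dkx[OF t, of 0, simplified] dkx[OF t, of 1, simplified]
    show "((\<lambda>y. ?v \<sigma> t y - \<alpha> t * 0) has_real_derivative
        ?v1 \<sigma> t x) (at x)"
      by (rule derivative_eq_intros dx refl | simp)+
    show "((\<lambda>x. ?v1 \<sigma> t x) has_real_derivative
        ?v2 \<sigma> t x) (at x)"
      by (rule derivative_eq_intros dx refl | simp)+
  next
    fix t x :: real assume t: "0 < t" "t \<le> T" and neg: "?v \<sigma> t x - \<alpha> t * 0 < 0"
    then have tT: "t \<in> {0..T}" by auto
    define E where "E = A * exp (l * t)"
    define v where "v = E * d 2 t x - \<sigma> * d k t x"
    have v: "v < 0" using neg by (simp add: v_def E_def)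
    have "1 * 1 \<le> A * exp (l * t)" using A l t by (intro mult_mono) auto
    then have E: "1 \<le> E" by (simp add: E_def)
    have \<alpha>: "0 \<le> \<alpha> t" "\<alpha> t \<le> 1" using \<alpha>_range[OF tT] by auto
    have \<alpha>y: "\<alpha> t * d 2 t x \<le> M2" using \<alpha>_mult_bound[OF tT M(4)[OF tT, of x]] by simp
    then have h1: "real k * M2 * v \<le> real k * (\<alpha> t * d 2 t x) * v"
      using v by (intro mult_right_mono_neg mult_left_mono) auto
    have "\<sigma> * (\<alpha> t * R t x) \<le> \<bar>\<alpha> t\<bar> * \<bar>R t x\<bar>" using \<sigma> by (auto simp: abs_mult[symmetric])
    also have "\<dots> \<le> 1 * (R0 * d 2 t x)"
      using \<alpha> R[OF tT, of x] by (intro mult_mono) auto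
    finally have h2: "\<sigma> * (\<alpha> t * R t x) \<le> R0 * d 2 t x" by simp
    have h6: "0 \<le> R0 * d 2 t x" using R0 y[OF tT, of x] by simp
    then have h3: "R0 * d 2 t x \<le> E * (R0 * d 2 t x)"
      using E mult_right_mono[of 1 E "R0 * d 2 t x"] by simp
    have h4: "(E * d 2 t x) * (real k * (\<alpha> t * d 2 t x)) \<le> (E * d 2 t x) * (real k * M2)"
      using \<alpha>y E y[OF tT, of x] by (intro mult_left_mono) auto
    have h5: "0 \<le> E * (\<alpha> t * (d 2 t x)\<^sup>2)" using E \<alpha> by simp
    have h7: "\<sigma> * d k t x = E * d 2 t x - v" by (simp add: v_def)
    have h8: "real k * (\<alpha> t * d 2 t x) * (\<sigma> * d k t x) =
        (E * d 2 t x) * (real k * (\<alpha> t * d 2 t x)) - real k * (\<alpha> t * d 2 t x) * v"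
      unfolding h7 by (simp add: algebra_simps)
    have h9: "l * E * d 2 t x = (E * d 2 t x) * (real k * M2) + E * (R0 * d 2 t x)"
      by (simp add: l_def algebra_simps)
    have main: "real k * M2 * v \<le> l * E * d 2 t x + E * (\<alpha> t * (d 2 t x)\<^sup>2) -
        real k * (\<alpha> t * d 2 t x) * (\<sigma> * d k t x) - \<sigma> * (\<alpha> t * R t x) / 2"
      using h1 h2 h3 h4 h5 h6 h8 h9 by linarith
    have "l * E * d 2 t x + E * (1 / 2 * (d 4 t x + \<alpha> t * S 2 t x)) -
          \<sigma> * (1 / 2 * (d (k + 2) t x + \<alpha> t * S k t x)) -
        (1 / 2 * (E * d 4 t x - \<sigma> * d (k + 2) t x) +
        \<alpha> t * d 1 t x * (E * d 3 t x - \<sigma> * d (k + 1) t x)) =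
      l * E * d 2 t x + E * (\<alpha> t * (d 2 t x)\<^sup>2) -
        real k * (\<alpha> t * d 2 t x) * (\<sigma> * d k t x) - \<sigma> * (\<alpha> t * R t x) / 2"
      unfolding S_simps[OF tT] S[OF tT] by (simp add: field_simps power2_eq_square)
    with main have ineq: "1 / 2 * (E * d 4 t x - \<sigma> * d (k + 2) t x) +
        \<alpha> t * d 1 t x * (E * d 3 t x - \<sigma> * d (k + 1) t x) + real k * M2 * v \<le>
        l * E * d 2 t x + E * (1 / 2 * (d 4 t x + \<alpha> t * S 2 t x)) -
          \<sigma> * (1 / 2 * (d (k + 2) t x + \<alpha> t * S k t x))"
      by linarith
    have der: "((\<lambda>t. ?v \<sigma> t x) has_real_derivative
        l * E * d 2 t x + E * (1 / 2 * (d 4 t x + \<alpha> t * S 2 t x)) -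
          \<sigma> * (1 / 2 * (d (k + 2) t x + \<alpha> t * S k t x))) (at t within {0..t})"
      unfolding E_def by (rule derivative_eq_intros d_t'[OF t] d_t[OF k t] refl)+ (simp_all add: field_simps)
    show "x \<in> interior UNIV \<and> (\<exists>p' q'.
        ((\<lambda>t. ?v \<sigma> t x) has_real_derivative p') (at t within {0..t}) \<and>
        ((\<lambda>s. 0) has_real_derivative q') (at t within {0..t}) \<and>
        1 / 2 * ?v2 \<sigma> t x +
        \<alpha> t * d 1 t x * ?v1 \<sigma> t x +
        real k * M2 * (?v \<sigma> t x - \<alpha> t * 0) \<le> p' - \<alpha> t * q')"
      using der ineq unfolding E_def v_def by (intro conjI exI[of _ 0] exI) auto
  qed (use M that in auto)
  have "\<bar>d k t x\<bar> \<le> A * exp (l * T) * d 2 t x" if "t \<in> {0..T}" for t x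
  proof -
    have "exp (l * t) \<le> exp (l * T)" using that l by (simp add: mult_left_mono)
    then have "A * exp (l * t) * d 2 t x \<le> A * exp (l * T) * d 2 t x"
      using A y[OF that, of x] by (intro mult_right_mono mult_left_mono) auto
    then show ?thesis using key[of 1, OF _ that, of x] key[of "-1", OF _ that, of x] by auto
  qed
  then show ?thesis using A by (intro exI[of _ "A * exp (l * T)"]) auto
qed

end

section \<open>Profiles\<close>

text \<open>A profile is the sequence \<open>f 1 = B, f 2 = C, f 3, \<dots>\<close> of spatial derivatives of a solution at a
  fixed time. In terms of the spatial variable, \<open>- ratio f 3 / 2\<close>, \<open>N_prof\<close>, \<open>P_prof\<close> and \<open>W_prof\<close> are
  the quantities \<open>z\<close>, \<open>C J\<close>, \<open>C\<^sup>2 J\<^sub>B\<close> and \<open>C (3 z J - C J\<^sub>B)\<close> of the theorem, all of which are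
  polynomials in the bounded ratios \<open>f k / f 2\<close>.\<close>

definition ratio :: "(nat \<Rightarrow> real \<Rightarrow> real) \<Rightarrow> nat \<Rightarrow> real \<Rightarrow> real" where
  "ratio f k x = f k x / f 2 x"

definition N_prof :: "real \<Rightarrow> (nat \<Rightarrow> real \<Rightarrow> real) \<Rightarrow> real \<Rightarrow> real" where
  "N_prof a f x = - (ratio f 4 x - (ratio f 3 x)\<^sup>2) / 2 - a * f 2 x"

definition P_prof :: "(nat \<Rightarrow> real \<Rightarrow> real) \<Rightarrow> real \<Rightarrow> real" where
  "P_prof f x = - ratio f 5 x / 2 + 2 * ratio f 3 x * ratio f 4 x - 3 / 2 * (ratio f 3 x) ^ 3"

definition W_prof :: "real \<Rightarrow> (nat \<Rightarrow> real \<Rightarrow> real) \<Rightarrow> real \<Rightarrow> real" where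
  "W_prof a f x = (ratio f 5 x / 2 - 5 / 4 * ratio f 3 x * ratio f 4 x + 3 / 4 * (ratio f 3 x) ^ 3)
     - a * (- 3 / 2 * f 3 x)"

text \<open>The invariant handed from \<open>ln cosh\<close> through the Parisi phase to the
  Cole--Hopf phase. The sech^2 bound and the ratio bounds are carried along so that the maximum
  principle can start again in the second phase.\<close>

definition admissible :: "real \<Rightarrow> (nat \<Rightarrow> real \<Rightarrow> real) \<Rightarrow> bool" where
  "admissible a f \<longleftrightarrow> (\<forall>x. f 1 (- x) = - f 1 x) \<and>
     (\<exists>c>0. \<forall>x. c * (1 - (tanh x)\<^sup>2) \<le> f 2 x) \<and>
     (\<forall>k\<in>{3, 4, 5}. \<exists>A. \<forall>x. \<bar>f k x\<bar> \<le> A * f 2 x) \<and>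
     (\<forall>x. 0 \<le> N_prof a f x) \<and> (\<forall>x\<ge>0. 0 \<le> P_prof f x \<and> 0 \<le> W_prof a f x)"

locale profile =
  fixes f :: "nat \<Rightarrow> real \<Rightarrow> real"
  assumes f_x: "\<And>k x. 1 \<le> k \<Longrightarrow> (f k has_real_derivative f (Suc k) x) (at x)"
    and pos: "\<And>x. 0 < f 2 x"
    and odd1: "\<And>x. f 1 (- x) = - f 1 x"
begin

definition ratio_x :: "nat \<Rightarrow> real \<Rightarrow> real" where
  "ratio_x k x = ratio f (Suc k) x - ratio f k x * ratio f 3 x"

definition ratio_xx :: "nat \<Rightarrow> real \<Rightarrow> real" where
  "ratio_xx k x = ratio_x (Suc k) x - (ratio_x k x * ratio f 3 x + ratio f k x * ratio_x 3 x)"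

lemma f_eq: "f k x = f 2 x * ratio f k x"
  using pos[of x] by (simp add: ratio_def)

lemma ratio_has_derivative: "1 \<le> k \<Longrightarrow> (ratio f k has_real_derivative ratio_x k x) (at x)"
proof -
  assume k: "1 \<le> k"
  have "(f 2 has_real_derivative f 3 x) (at x)" using f_x[of 2 x] by (simp add: eval_nat_numeral)
  from DERIV_divide[OF f_x[OF k] this] pos[of x] show ?thesis
    by (simp add: ratio_def[abs_def] ratio_x_def field_simps)
qed

lemma ratio_x_has_derivative: "1 \<le> k \<Longrightarrow> (ratio_x k has_real_derivative ratio_xx k x) (at x)"
  unfolding ratio_x_def[abs_def]
  by (rule derivative_eq_intros ratio_has_derivative | simp add: ratio_xx_def ratio_x_def)+

lemma parity: "1 \<le> k \<Longrightarrow> f k (- x) = (- 1) ^ k * f k x"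
proof (induction k arbitrary: x rule: dec_induct)
  case base
  then show ?case by (simp add: odd1 del: One_nat_def)
next
  case (step k)
  have "(uminus has_real_derivative - 1) (at x)" by (auto intro!: derivative_eq_intros)
  from DERIV_chain2[OF f_x[OF step(1), of "- x"] this]
  have "((\<lambda>x. f k (- x)) has_real_derivative - f (Suc k) (- x)) (at x)" by simp
  moreover have "((\<lambda>x. f k (- x)) has_real_derivative (- 1) ^ k * f (Suc k) x) (at x)"
    unfolding step.IH by (rule DERIV_cmult f_x step)+
  ultimately have "- f (Suc k) (- x) = (- 1) ^ k * f (Suc k) x" by (rule DERIV_unique)
  then show ?case by simp
qed

lemma odd_ratio_0: "ratio f 3 0 = 0" "ratio f 5 0 = 0"
  using parity[of 3 0] parity[of 5 0] by (simp_all add: ratio_def)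

text \<open>The derivative of \<open>ratio f 3\<close> is - 2 (\<open>N_prof a f\<close> + a
  \<open>f 2\<close>), hence not positive, and \<open>ratio f 3\<close> vanishes at 0 because
  \<open>f 3\<close> is odd. In slope terms this is z \<ge> 0.\<close>

lemma ratio3_nonpos:
  assumes a: "0 \<le> a" and N: "\<And>x. 0 \<le> N_prof a f x" and x: "0 \<le> x"
  shows "ratio f 3 x \<le> 0"
proof -
  have "ratio f 3 x \<le> ratio f 3 0"
  proof (rule DERIV_nonpos_imp_nonincreasing[OF x])
    fix y
    have "0 \<le> a * f 2 y" using a pos[of y] by simp
    then have "ratio_x 3 y \<le> 0"
      using N[of y] by (simp add: ratio_x_def N_prof_def power2_eq_square)
    then show "\<exists>D. (ratio f 3 has_real_derivative D) (at y) \<and> D \<le> 0"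
      using ratio_has_derivative[of 3 y] by auto
  qed
  then show ?thesis by (simp add: odd_ratio_0)
qed

end

section \<open>Preservation of admissibility\<close>

text \<open>The evolution equations of \<open>N\<close>, \<open>P\<close> and \<open>W\<close>: here \<open>e\<^sub>k = d k / d 2\<close>, and \<open>t\<^sub>k\<close>, \<open>x\<^sub>k\<close>, \<open>xx\<^sub>k\<close> are its derivatives
  in time and (once, twice) in space.\<close>

lemma evolution_identities:
  fixes a B y e3 e4 e5 e6 e7 :: real
  assumes "x3 = e4 - e3 * e3" "x4 = e5 - e4 * e3" "x5 = e6 - e5 * e3" "x6 = e7 - e6 * e3"
    and "xx3 = x4 - (x3 * e3 + e3 * x3)" "xx4 = x5 - (x4 * e3 + e4 * x3)" "xx5 = x6 - (x5 * e3 + e5 * x3)"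
    and "t3 = (e5 + a * (6 * y * e3 + 2 * B * e4)) / 2 - e3 * (e4 + a * (2 * y + 2 * B * e3)) / 2"
    and "t4 = (e6 + a * (6 * y * e3\<^sup>2 + 8 * y * e4 + 2 * B * e5)) / 2 - e4 * (e4 + a * (2 * y + 2 * B * e3)) / 2"
    and "t5 = (e7 + a * (20 * y * e3 * e4 + 10 * y * e5 + 2 * B * e6)) / 2 - e5 * (e4 + a * (2 * y + 2 * B * e3)) / 2"
    and "n = - (e4 - e3\<^sup>2) / 2 - a * y"
  shows "- (t4 - 2 * e3 * t3) / 2 - a * (1 / 2 * (y * e4 + a * (2 * y\<^sup>2 + 2 * B * (y * e3)))) =
    1 / 2 * (- (xx4 - 2 * (x3\<^sup>2 + e3 * xx3)) / 2 - a * (y * e4))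
    + (a * B + e3) * (- (x4 - 2 * e3 * x3) / 2 - a * (y * e3)) - (a * y + 2 * n) * n"
    and "- t5 / 2 + 2 * (t3 * e4 + e3 * t4) - 9 / 2 * (e3\<^sup>2 * t3) =
    1 / 2 * (- xx5 / 2 + 2 * (xx3 * e4 + 2 * x3 * x4 + e3 * xx4) - 9 / 2 * (2 * e3 * x3\<^sup>2 + e3\<^sup>2 * xx3))
    + (a * B + e3) * (- x5 / 2 + 2 * (x3 * e4 + e3 * x4) - 9 / 2 * (e3\<^sup>2 * x3))
    - (4 * (a * y) + 8 * n) * (- e5 / 2 + 2 * e3 * e4 - 3 / 2 * e3 ^ 3)
    - e3 * (6 * (a * y * n) + 6 * n\<^sup>2)"
    and "t5 / 2 - 5 / 4 * (t3 * e4 + e3 * t4) + 9 / 4 * (e3\<^sup>2 * t3)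
      - a * (- 3 / 4 * (y * e5 + a * (6 * y * (y * e3) + 2 * B * (y * e4)))) =
    1 / 2 * (xx5 / 2 - 5 / 4 * (xx3 * e4 + 2 * x3 * x4 + e3 * xx4)
      + 9 / 4 * (2 * e3 * x3\<^sup>2 + e3\<^sup>2 * xx3) + 3 / 2 * a * (y * e5))
    + (a * B + e3) * (x5 / 2 - 5 / 4 * (x3 * e4 + e3 * x4) + 9 / 4 * (e3\<^sup>2 * x3) + 3 / 2 * a * (y * e4))
    - (a * y + 5 * n) * (e5 / 2 - 5 / 4 * e3 * e4 + 3 / 4 * e3 ^ 3 - a * (- 3 / 2 * (y * e3)))
    - e3 * (3 / 2 * n\<^sup>2)"
  unfolding assms by (simp_all add: algebra_simps power2_eq_square power3_eq_cube) (simp_all add: field_simps)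

locale parisi_flow_init = parisi_flow +
  assumes init: "admissible (\<alpha> 0) (\<lambda>k. d k 0)"
begin

lemma d2_pos: "t \<in> {0..T} \<Longrightarrow> 0 < d 2 t x"
proof -
  assume t: "t \<in> {0..T}"
  obtain c where "0 < c" "\<forall>x. c * (1 - (tanh x)\<^sup>2) \<le> d 2 0 x"
    using init by (auto simp: admissible_def)
  with sech_lower_bound_preserved[of c] obtain c' where
    "0 < c'" "c' * (1 - (tanh x)\<^sup>2) \<le> d 2 t x" using t by auto
  moreover have "0 < 1 - (tanh x)\<^sup>2"
    using tanh_real_bounds[of x] by (auto simp: abs_square_less_1)
  ultimately show ?thesis by (meson mult_pos_pos order_less_le_trans)
qed

lemma profile: "t \<in> {0..T} \<Longrightarrow> profile (\<lambda>k. d k t)"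
  using d_x d2_pos odd_preserved init
  by unfold_locales (auto simp: admissible_def)

text \<open>A bootstrap: order 3 has no remainder, and the remainders 6 (d 3)^2 of order 4 and 20 (d
  3) (d 4) of order 5 are at most a constant times d 2 by the ratio bounds already obtained.\<close>

lemma ratio_bounds:
  shows "\<exists>A\<ge>0. \<forall>t\<in>{0..T}. \<forall>x. \<bar>d 3 t x\<bar> \<le> A * d 2 t x" (is ?th3)
    and "\<exists>A\<ge>0. \<forall>t\<in>{0..T}. \<forall>x. \<bar>d 4 t x\<bar> \<le> A * d 2 t x" (is ?th4)
    and "\<exists>A\<ge>0. \<forall>t\<in>{0..T}. \<forall>x. \<bar>d 5 t x\<bar> \<le> A * d 2 t x" (is ?th5)
proof -
  obtain B3 B4 B5 where B: "\<And>x. \<bar>d 3 0 x\<bar> \<le> B3 * d 2 0 x" "\<And>x. \<bar>d 4 0 x\<bar> \<le> B4 * d 2 0 x"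
    "\<And>x. \<bar>d 5 0 x\<bar> \<le> B5 * d 2 0 x"
    using init unfolding admissible_def by auto
  obtain M3 where M3: "0 \<le> M3" "\<And>t x. t \<in> {0..T} \<Longrightarrow> \<bar>d 3 t x\<bar> \<le> M3"
    by (rule d_bdd_pos[of 3]) auto
  show th3: ?th3
    by (rule ratio_bound_preserved[where R = "\<lambda>_ _. 0" and ?R0.0 = 0 and ?A0.0 = B3])
      (auto simp: S_simps d2_pos B)
  then obtain A3 where A3: "\<And>t x. t \<in> {0..T} \<Longrightarrow> \<bar>d 3 t x\<bar> \<le> A3 * d 2 t x" by blast
  show th4: ?th4
  proof (rule ratio_bound_preserved[where R = "\<lambda>t x. 6 * (d 3 t x)\<^sup>2" and ?R0.0 = "6 * (M3 * A3)" and ?A0.0 = B4])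
    show "\<bar>6 * (d 3 t x)\<^sup>2\<bar> \<le> 6 * (M3 * A3) * d 2 t x" if t: "t \<in> {0..T}" for t x
      using mult_mono[OF M3(2)[OF t] A3[OF t] M3(1) abs_ge_zero, of x x] by (simp add: power2_eq_square mult.assoc)
  qed (auto simp: S_simps d2_pos B)
  then obtain A4 where A4: "\<And>t x. t \<in> {0..T} \<Longrightarrow> \<bar>d 4 t x\<bar> \<le> A4 * d 2 t x" by blast
  show ?th5
  proof (rule ratio_bound_preserved[where R = "\<lambda>t x. 20 * d 3 t x * d 4 t x" and ?R0.0 = "20 * (M3 * A4)" and ?A0.0 = B5])
    show "\<bar>20 * d 3 t x * d 4 t x\<bar> \<le> 20 * (M3 * A4) * d 2 t x" if t: "t \<in> {0..T}" for t x
      using mult_mono[OF M3(2)[OF t] A4[OF t] M3(1) abs_ge_zero, of x x] by (simp add: abs_mult mult.assoc)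
  qed (auto simp: S_simps d2_pos B)
qed

section \<open>Time and space derivatives of the ratios\<close>

definition e :: "nat \<Rightarrow> real \<Rightarrow> real \<Rightarrow> real" where
  "e k t x = ratio (\<lambda>k. d k t) k x"

lemma e_bounds:
  obtains A3 A4 A5 where "0 \<le> A3" "0 \<le> A4" "0 \<le> A5" "\<And>t x. t \<in> {0..T} \<Longrightarrow> \<bar>e 3 t x\<bar> \<le> A3"
    "\<And>t x. t \<in> {0..T} \<Longrightarrow> \<bar>e 4 t x\<bar> \<le> A4" "\<And>t x. t \<in> {0..T} \<Longrightarrow> \<bar>e 5 t x\<bar> \<le> A5"
proof -
  have *: "\<bar>e k t x\<bar> \<le> A" if "\<bar>d k t x\<bar> \<le> A * d 2 t x" "t \<in> {0..T}" for k t x A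
    using that d2_pos[of t x] by (simp add: e_def ratio_def abs_div_pos[symmetric] pos_divide_le_eq)
  obtain A3 where 3: "0 \<le> A3" "\<And>t x. t \<in> {0..T} \<Longrightarrow> \<bar>d 3 t x\<bar> \<le> A3 * d 2 t x"
    using ratio_bounds(1) by blast
  obtain A4 where 4: "0 \<le> A4" "\<And>t x. t \<in> {0..T} \<Longrightarrow> \<bar>d 4 t x\<bar> \<le> A4 * d 2 t x"
    using ratio_bounds(2) by blast
  obtain A5 where 5: "0 \<le> A5" "\<And>t x. t \<in> {0..T} \<Longrightarrow> \<bar>d 5 t x\<bar> \<le> A5 * d 2 t x"
    using ratio_bounds(3) by blast
  show ?thesis by (rule that[OF 3(1) 4(1) 5(1)]) (auto intro!: * 3 4 5)
qed

lemma e_cont: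
  assumes "1 \<le> k"
  shows "continuous_on ({0..T} \<times> D) (\<lambda>r. e k (fst r) (snd r))"
proof -
  have "d 2 (fst r) (snd r) \<noteq> 0" if "r \<in> {0..T} \<times> D" for r
    using d2_pos[of "fst r" "snd r"] that by (auto simp: mem_Times_iff)
  then show ?thesis unfolding e_def ratio_def using assms by (intro continuous_intros d_cont') auto
qed

text \<open>Here and for orders 4 and 5: the quotient rule applied to the equations of d k and d 2,
  divided through until only ratios, d 1, d 2 and \<alpha> remain, so that the evolution equations
  become polynomial identities.\<close>

definition e3_t :: "real \<Rightarrow> real \<Rightarrow> real" where
  "e3_t t x = (e 5 t x + \<alpha> t * (6 * d 2 t x * e 3 t x + 2 * d 1 t x * e 4 t x)) / 2
    - e 3 t x * (e 4 t x + \<alpha> t * (2 * d 2 t x + 2 * d 1 t x * e 3 t x)) / 2"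

definition e4_t :: "real \<Rightarrow> real \<Rightarrow> real" where
  "e4_t t x = (e 6 t x + \<alpha> t * (6 * d 2 t x * (e 3 t x)\<^sup>2 + 8 * d 2 t x * e 4 t x + 2 * d 1 t x * e 5 t x)) / 2
    - e 4 t x * (e 4 t x + \<alpha> t * (2 * d 2 t x + 2 * d 1 t x * e 3 t x)) / 2"

definition e5_t :: "real \<Rightarrow> real \<Rightarrow> real" where
  "e5_t t x = (e 7 t x + \<alpha> t * (20 * d 2 t x * e 3 t x * e 4 t x + 10 * d 2 t x * e 5 t x + 2 * d 1 t x * e 6 t x)) / 2
    - e 5 t x * (e 4 t x + \<alpha> t * (2 * d 2 t x + 2 * d 1 t x * e 3 t x)) / 2"

lemma e_t:
  assumes t: "0 < t" "t \<le> T"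
  shows "((\<lambda>s. e 3 s x) has_real_derivative e3_t t x) (at t within {0..t})"
    and "((\<lambda>s. e 4 s x) has_real_derivative e4_t t x) (at t within {0..t})"
    and "((\<lambda>s. e 5 s x) has_real_derivative e5_t t x) (at t within {0..t})"
proof -
  have tT: "t \<in> {0..T}" using t by auto
  have nz: "d 2 t x \<noteq> 0" using d2_pos[OF tT, of x] by simp
  have id: "(a * y - b * c) / (y * y) = a / y - b / y * (c / y)" if "y \<noteq> 0" for a b c y :: real
    using that by (simp add: field_simps)
  have y2: "1 / 2 * (d 4 t x + \<alpha> t * S 2 t x) / d 2 t x =
      (e 4 t x + \<alpha> t * (2 * d 2 t x + 2 * d 1 t x * e 3 t x)) / 2"
    using nz by (simp add: e_def ratio_def S_simps[OF tT] field_simps power2_eq_square del: One_nat_def)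
  have y3: "1 / 2 * (d 5 t x + \<alpha> t * S 3 t x) / d 2 t x =
      (e 5 t x + \<alpha> t * (6 * d 2 t x * e 3 t x + 2 * d 1 t x * e 4 t x)) / 2"
    using nz by (simp add: e_def ratio_def S_simps[OF tT] field_simps power2_eq_square del: One_nat_def)
  have y4: "1 / 2 * (d 6 t x + \<alpha> t * S 4 t x) / d 2 t x =
      (e 6 t x + \<alpha> t * (6 * d 2 t x * (e 3 t x)\<^sup>2 + 8 * d 2 t x * e 4 t x + 2 * d 1 t x * e 5 t x)) / 2"
    using nz by (simp add: e_def ratio_def S_simps[OF tT] field_simps power2_eq_square del: One_nat_def)
  have y5: "1 / 2 * (d 7 t x + \<alpha> t * S 5 t x) / d 2 t x =
      (e 7 t x + \<alpha> t * (20 * d 2 t x * e 3 t x * e 4 t x + 10 * d 2 t x * e 5 t x + 2 * d 1 t x * e 6 t x)) / 2"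
    using nz by (simp add: e_def ratio_def S_simps[OF tT] field_simps power2_eq_square del: One_nat_def)
  have q: "d k t x / d 2 t x = e k t x" for k by (simp add: e_def ratio_def)
  note div = DERIV_divide[OF _ d_t'(2)[OF t, of x] nz, unfolded id[OF nz] y2]
  have e_fun: "(\<lambda>s. e k s x) = (\<lambda>s. d k s x / d 2 s x)" for k by (simp add: e_def ratio_def)
  show "((\<lambda>s. e 3 s x) has_real_derivative e3_t t x) (at t within {0..t})"
    unfolding e_fun by (rule DERIV_cong[OF div[OF d_t'(3)[OF t, of x]]]) (unfold y3 q e3_t_def, simp)
  show "((\<lambda>s. e 4 s x) has_real_derivative e4_t t x) (at t within {0..t})"
    unfolding e_fun by (rule DERIV_cong[OF div[OF d_t'(4)[OF t, of x]]]) (unfold y4 q e4_t_def, simp)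
  show "((\<lambda>s. e 5 s x) has_real_derivative e5_t t x) (at t within {0..t})"
    unfolding e_fun by (rule DERIV_cong[OF div[OF d_t'(5)[OF t, of x]]]) (unfold y5 q e5_t_def, simp)
qed

definition e_x :: "nat \<Rightarrow> real \<Rightarrow> real \<Rightarrow> real" where
  "e_x k t x = e (Suc k) t x - e k t x * e 3 t x"

definition e_xx :: "nat \<Rightarrow> real \<Rightarrow> real \<Rightarrow> real" where
  "e_xx k t x = e_x (Suc k) t x - (e_x k t x * e 3 t x + e k t x * e_x 3 t x)"

lemma e_x_derivs:
  assumes "1 \<le> k" "t \<in> {0..T}"
  shows "(e k t has_real_derivative e_x k t x) (at x)" "(e_x k t has_real_derivative e_xx k t x) (at x)"
proof -
  interpret profile "\<lambda>k. d k t" by (rule profile[OF assms(2)])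
  have 1: "e k t = ratio (\<lambda>k. d k t) k" "e_x k t = ratio_x k" "e_xx k t = ratio_xx k" for k
    by (auto simp: e_def[abs_def] e_x_def ratio_x_def e_xx_def ratio_xx_def)
  show "(e k t has_real_derivative e_x k t x) (at x)" "(e_x k t has_real_derivative e_xx k t x) (at x)"
    using ratio_has_derivative[OF assms(1)] ratio_x_has_derivative[OF assms(1)] by (auto simp: 1)
qed

lemmas e_xs = e_x_derivs[of 3] e_x_derivs[of 4] e_x_derivs[of 5]

lemma d_eq_e: "t \<in> {0..T} \<Longrightarrow> d k t x = d 2 t x * e k t x"
  using d2_pos[of t x] by (simp add: e_def ratio_def)

text \<open>The equation of N has no source: its zero-order term - (\<alpha> C + 2 N) N has a
  bounded coefficient, so no sign beyond the initial one is required and the whole line can be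
  treated at once. Downward jumps of \<alpha> only raise N because \<open>q = d 2\<close> is
  positive.\<close>

lemma N_nonneg:
  assumes "t \<in> {0..T}"
  shows "0 \<le> N_prof (\<alpha> t) (\<lambda>k. d k t) x"
proof -
  obtain A3 A4 A5 where A: "0 \<le> A3" "0 \<le> A4" "0 \<le> A5" "\<And>t x. t \<in> {0..T} \<Longrightarrow> \<bar>e 3 t x\<bar> \<le> A3"
    "\<And>t x. t \<in> {0..T} \<Longrightarrow> \<bar>e 4 t x\<bar> \<le> A4" "\<And>t x. t \<in> {0..T} \<Longrightarrow> \<bar>e 5 t x\<bar> \<le> A5"
    by (rule e_bounds) blast
  obtain M1 where M1: "0 \<le> M1" "\<And>t x. t \<in> {0..T} \<Longrightarrow> \<bar>d 1 t x\<bar> \<le> M1"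
    by (rule d_bdd_pos[of 1]) auto
  obtain M2 where M2: "0 \<le> M2" "\<And>t x. t \<in> {0..T} \<Longrightarrow> \<bar>d 2 t x\<bar> \<le> M2"
    by (rule d_bdd_pos[of 2]) auto
  define n where "n = (\<lambda>t x. - (e 4 t x - (e 3 t x)\<^sup>2) / 2 - \<alpha> t * d 2 t x)"
  define Bn where "Bn = (A4 + A3\<^sup>2) / 2 + M2"
  have Bn: "\<bar>n t x\<bar> \<le> Bn" if t: "t \<in> {0..T}" for t x
  proof -
    have "\<bar>\<alpha> t * d 2 t x\<bar> \<le> M2" by (rule \<alpha>_mult_bound[OF t M2(2)[OF t]])
    moreover have "(e 3 t x)\<^sup>2 \<le> A3\<^sup>2" using A(4)[OF t, of x] by (simp add: abs_le_square_iff[symmetric] A)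
    moreover have "n t x = (e 3 t x)\<^sup>2 / 2 - e 4 t x / 2 - \<alpha> t * d 2 t x" "Bn = A4 / 2 + A3\<^sup>2 / 2 + M2"
      by (simp_all add: n_def Bn_def field_simps)
    ultimately show ?thesis
      using abs_le_D1[OF A(5)[OF t, of x]] abs_le_D2[OF A(5)[OF t, of x]] zero_le_power2[of "e 3 t x"]
        zero_le_power2[of A3] by (intro abs_leI) linarith+
  qed
  let ?p = "\<lambda>t x. - (e 4 t x - (e 3 t x)\<^sup>2) / 2"
  let ?w1 = "\<lambda>t x. - (e_x 4 t x - 2 * e 3 t x * e_x 3 t x) / 2 - \<alpha> t * d 3 t x"
  let ?w2 = "\<lambda>t x. - (e_xx 4 t x - 2 * ((e_x 3 t x)\<^sup>2 + e 3 t x * e_xx 3 t x)) / 2 - \<alpha> t * d 4 t x"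
  let ?p_t = "\<lambda>t x. - (e4_t t x - 2 * e 3 t x * e3_t t x) / 2"
  have "0 \<le> ?p t x - \<alpha> t * d 2 t x"
  proof (rule flow_maximum_principle[where p = ?p and q = "d 2"
        and D = UNIV and A = Bn and b = "\<lambda>t x. \<alpha> t * d 1 t x + e 3 t x" and bb = "M1 + A3"
        and c = "M2 + 2 * Bn"
        and ?w1.0 = ?w1
        and ?w2.0 = ?w2])
    show "continuous_on ({0..T} \<times> UNIV) (\<lambda>(t, x). ?p t x)"
      "continuous_on ({0..T} \<times> UNIV) (\<lambda>(t, x). d 2 t x)"
      unfolding split_def by (intro continuous_intros e_cont d_cont'; simp)+
    show "0 \<le> d 2 t x" if "t \<in> {0..T}" for t x using d2_pos[OF that, of x] by simp
    show "0 \<le> ?p 0 x - \<alpha> 0 * d 2 0 x" for x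
      using init by (simp add: admissible_def N_prof_def e_def)
    show "- Bn \<le> ?p t x - \<alpha> t * d 2 t x" if "t \<in> {0..T}" for t x
      using Bn[OF that, of x] by (simp add: n_def)
    show "\<bar>\<alpha> t * d 1 t x + e 3 t x\<bar> \<le> M1 + A3" if "t \<in> {0..T}" for t x
      using \<alpha>_mult_bound[OF that M1(2)[OF that, of x]] A(4)[OF that, of x] by linarith
    have "0 \<le> Bn" using Bn[OF assms, of 0] by linarith
    then show "0 \<le> M2 + 2 * Bn" using M2 by simp
    fix t x :: real assume t: "t \<in> {0..T}"
    show "((\<lambda>y. ?p t y - \<alpha> t * d 2 t y) has_real_derivative
        ?w1 t x) (at x)"
      by (rule derivative_eq_intros e_xs[OF _ t] d_x'[OF t] refl | simp)+
    show "((\<lambda>x. ?w1 t x) has_real_derivative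
        ?w2 t x) (at x)"
      by (rule derivative_eq_intros e_xs[OF _ t] d_x'[OF t] refl | simp)+ (simp add: power2_eq_square)
  next
    fix t x :: real assume t: "0 < t" "t \<le> T" and neg: "?p t x - \<alpha> t * d 2 t x < 0"
    then have tT: "t \<in> {0..T}" by auto
    have "- (\<alpha> t * d 2 t x + 2 * n t x) \<le> M2 + 2 * Bn"
      using \<alpha>_mult_bound[OF tT M2(2)[OF tT, of x]] Bn[OF tT, of x] by linarith
    then have "(M2 + 2 * Bn) * n t x \<le> - (\<alpha> t * d 2 t x + 2 * n t x) * n t x"
      using neg by (intro mult_right_mono_neg) (auto simp: n_def)
    moreover have "?p_t t x - \<alpha> t * (1 / 2 * (d 4 t x + \<alpha> t * S 2 t x)) =
        1 / 2 * ?w2 t x +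
        (\<alpha> t * d 1 t x + e 3 t x) * ?w1 t x
         - (\<alpha> t * d 2 t x + 2 * n t x) * n t x"
      unfolding S_simps[OF tT] d_eq_e[OF tT, of 3] d_eq_e[OF tT, of 4]
      by (rule evolution_identities(1)) (simp_all add: e4_t_def e3_t_def e_xx_def e_x_def n_def del: One_nat_def)
    ultimately have ineq: "1 / 2 * ?w2 t x +
        (\<alpha> t * d 1 t x + e 3 t x) * ?w1 t x +
        (M2 + 2 * Bn) * (?p t x - \<alpha> t * d 2 t x)
        \<le> ?p_t t x - \<alpha> t * (1 / 2 * (d 4 t x + \<alpha> t * S 2 t x))"
      unfolding n_def by linarith
    have der: "((\<lambda>s. ?p s x) has_real_derivative ?p_t t x)
        (at t within {0..t})"
      by (rule derivative_eq_intros e_t[OF t] refl | simp)+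
    show "x \<in> interior UNIV \<and> (\<exists>p' q'.
        ((\<lambda>s. ?p s x) has_real_derivative p') (at t within {0..t}) \<and>
        ((\<lambda>s. d 2 s x) has_real_derivative q') (at t within {0..t}) \<and>
        1 / 2 * ?w2 t x +
        (\<alpha> t * d 1 t x + e 3 t x) * ?w1 t x +
        (M2 + 2 * Bn) * (?p t x - \<alpha> t * d 2 t x) \<le> p' - \<alpha> t * q')"
      using der d_t'(2)[OF t] ineq by (intro conjI exI) auto
  qed (use assms in auto)
  then show ?thesis by (simp add: N_prof_def e_def)
qed

lemma e3_nonpos:
  assumes t: "t \<in> {0..T}" and x: "0 \<le> x"
  shows "e 3 t x \<le> 0"
proof -
  interpret profile "\<lambda>k. d k t" by (rule profile[OF t])
  show ?thesis unfolding e_def using \<alpha>_range[OF t] N_nonneg[OF t] x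
    by (intro ratio3_nonpos[of "\<alpha> t"]) auto
qed

lemma e_odd_0: "t \<in> {0..T} \<Longrightarrow> e 3 t 0 = 0" "t \<in> {0..T} \<Longrightarrow> e 5 t 0 = 0"
  using profile.odd_ratio_0[OF profile] by (auto simp: e_def)

lemma N_prof_e: "N_prof (\<alpha> t) (\<lambda>k. d k t) x = - (e 4 t x - (e 3 t x)\<^sup>2) / 2 - \<alpha> t * d 2 t x"
  by (simp add: N_prof_def e_def)

text \<open>P vanishes at x = 0 by oddness, so a negative value sits in the interior of the half
  line. There - (4 \<alpha> C + 8 N) P is nonnegative, and the source - e 3 (6 \<alpha> C N + 6 N^2)
  is nonnegative since N \<ge> 0 and e 3 \<le> 0; hence c = 0 works. \<alpha> does not occur in P,
  so q = 0.\<close>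

lemma P_nonneg:
  assumes "t \<in> {0..T}" and "0 \<le> x"
  shows "0 \<le> P_prof (\<lambda>k. d k t) x"
proof -
  obtain A3 A4 A5 where A: "0 \<le> A3" "0 \<le> A4" "0 \<le> A5" "\<And>t x. t \<in> {0..T} \<Longrightarrow> \<bar>e 3 t x\<bar> \<le> A3"
    "\<And>t x. t \<in> {0..T} \<Longrightarrow> \<bar>e 4 t x\<bar> \<le> A4" "\<And>t x. t \<in> {0..T} \<Longrightarrow> \<bar>e 5 t x\<bar> \<le> A5"
    by (rule e_bounds) blast
  obtain M1 where M1: "0 \<le> M1" "\<And>t x. t \<in> {0..T} \<Longrightarrow> \<bar>d 1 t x\<bar> \<le> M1"
    by (rule d_bdd_pos[of 1]) auto
  let ?p = "\<lambda>t x. - e 5 t x / 2 + 2 * e 3 t x * e 4 t x - 3 / 2 * e 3 t x ^ 3"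
  let ?w1 = "\<lambda>t x. - e_x 5 t x / 2 + 2 * (e_x 3 t x * e 4 t x + e 3 t x * e_x 4 t x)
    - 9 / 2 * ((e 3 t x)\<^sup>2 * e_x 3 t x)"
  let ?w2 = "\<lambda>t x. - e_xx 5 t x / 2 + 2 * (e_xx 3 t x * e 4 t x + 2 * e_x 3 t x * e_x 4 t x + e 3 t x * e_xx 4 t x)
    - 9 / 2 * (2 * e 3 t x * (e_x 3 t x)\<^sup>2 + (e 3 t x)\<^sup>2 * e_xx 3 t x)"
  let ?p_t = "\<lambda>t x. - e5_t t x / 2 + 2 * (e3_t t x * e 4 t x + e 3 t x * e4_t t x)
    - 9 / 2 * ((e 3 t x)\<^sup>2 * e3_t t x)"
  have "0 \<le> ?p t x - \<alpha> t * 0"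
  proof (rule flow_maximum_principle[where p = ?p and q = "\<lambda>_ _. 0"
        and D = "{0..}" and A = "A5 / 2 + 2 * (A3 * A4) + 3 / 2 * A3 ^ 3"
        and b = "\<lambda>t x. \<alpha> t * d 1 t x + e 3 t x" and bb = "M1 + A3" and c = 0
        and ?w1.0 = ?w1 and ?w2.0 = ?w2])
    show "continuous_on ({0..T} \<times> {0..}) (\<lambda>(t, x). ?p t x)"
      unfolding split_def by (intro continuous_intros e_cont; simp)
    show "0 \<le> ?p 0 x - \<alpha> 0 * 0" if "x \<in> {0..}" for x
      using init that by (simp add: admissible_def P_prof_def e_def)
    show "- (A5 / 2 + 2 * (A3 * A4) + 3 / 2 * A3 ^ 3) \<le> ?p t x - \<alpha> t * 0" if t: "t \<in> {0..T}" for t x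
    proof -
      have "\<bar>e 3 t x * e 4 t x\<bar> \<le> A3 * A4"
        unfolding abs_mult using A t by (intro mult_mono) auto
      moreover have "\<bar>e 3 t x ^ 3\<bar> \<le> A3 ^ 3"
        unfolding power_abs using A(4)[OF t] by (intro power_mono) auto
      ultimately show ?thesis using A(6)[OF t, of x] unfolding mult.assoc by linarith
    qed
    show "\<bar>\<alpha> t * d 1 t x + e 3 t x\<bar> \<le> M1 + A3" if "t \<in> {0..T}" for t x
      using \<alpha>_mult_bound[OF that M1(2)[OF that, of x]] A(4)[OF that, of x] by linarith
    fix t x :: real assume t: "t \<in> {0..T}"
    show "((\<lambda>y. ?p t y - \<alpha> t * 0) has_real_derivative ?w1 t x) (at x)"
      by (rule derivative_eq_intros e_xs[OF _ t] refl | simp)+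
    show "(?w1 t has_real_derivative ?w2 t x) (at x)"
      by (rule derivative_eq_intros e_xs[OF _ t] refl | simp add: field_simps power2_eq_square)+
  next
    fix t x :: real assume t: "0 < t" "t \<le> T" and x: "x \<in> {0..}" and neg: "?p t x - \<alpha> t * 0 < 0"
    then have tT: "t \<in> {0..T}" by auto
    define n where "n = - (e 4 t x - (e 3 t x)\<^sup>2) / 2 - \<alpha> t * d 2 t x"
    have n: "0 \<le> n" using N_nonneg[OF tT, of x] by (simp add: n_def N_prof_e)
    have e3: "e 3 t x \<le> 0" using e3_nonpos[OF tT, of x] x by simp
    have \<alpha>y: "0 \<le> \<alpha> t * d 2 t x" using \<alpha>_range[OF tT] d2_pos[OF tT, of x] by simp
    have "x \<noteq> 0" using neg e_odd_0[OF tT] by auto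
    then have int: "x \<in> interior {0..}" using x by simp
    have "0 \<le> - (4 * (\<alpha> t * d 2 t x) + 8 * n) * ?p t x"
      using n \<alpha>y neg by (intro mult_nonpos_nonpos) auto
    moreover have "0 \<le> - e 3 t x * (6 * (\<alpha> t * d 2 t x * n) + 6 * n\<^sup>2)"
      using n \<alpha>y e3 by (intro mult_nonneg_nonneg) auto
    moreover have "?p_t t x = 1 / 2 * ?w2 t x + (\<alpha> t * d 1 t x + e 3 t x) * ?w1 t x
        - (4 * (\<alpha> t * d 2 t x) + 8 * n) * ?p t x - e 3 t x * (6 * (\<alpha> t * d 2 t x * n) + 6 * n\<^sup>2)"
      by (rule evolution_identities(2)) (simp_all add: e5_t_def e4_t_def e3_t_def e_xx_def e_x_def n_def del: One_nat_def)
    ultimately have ineq: "1 / 2 * ?w2 t x + (\<alpha> t * d 1 t x + e 3 t x) * ?w1 t x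
        + 0 * (?p t x - \<alpha> t * 0) \<le> ?p_t t x - \<alpha> t * 0" by linarith
    have der: "((\<lambda>s. ?p s x) has_real_derivative ?p_t t x) (at t within {0..t})"
      by (rule derivative_eq_intros e_t[OF t] refl | simp)+
    show "x \<in> interior {0..} \<and> (\<exists>p' q'. ((\<lambda>s. ?p s x) has_real_derivative p') (at t within {0..t}) \<and>
        ((\<lambda>s. 0) has_real_derivative q') (at t within {0..t}) \<and>
        1 / 2 * ?w2 t x + (\<alpha> t * d 1 t x + e 3 t x) * ?w1 t x + 0 * (?p t x - \<alpha> t * 0) \<le> p' - \<alpha> t * q')"
      by (intro conjI exI[of _ "?p_t t x"] exI[of _ 0] int der ineq) simp
  qed (use assms in auto)
  then show ?thesis by (simp add: P_prof_def e_def)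
qed

text \<open>The half-line argument for P again, but now \<alpha> enters with the weight
  \<open>- 3 / 2 * d 3\<close>; this is nonnegative for x \<ge> 0 because e 3 \<le> 0, which makes
  jumps of \<alpha> harmless. The source is - 3/2 (e 3) N^2.\<close>

lemma W_nonneg:
  assumes "t \<in> {0..T}" and "0 \<le> x"
  shows "0 \<le> W_prof (\<alpha> t) (\<lambda>k. d k t) x"
proof -
  obtain A3 A4 A5 where A: "0 \<le> A3" "0 \<le> A4" "0 \<le> A5" "\<And>t x. t \<in> {0..T} \<Longrightarrow> \<bar>e 3 t x\<bar> \<le> A3"
    "\<And>t x. t \<in> {0..T} \<Longrightarrow> \<bar>e 4 t x\<bar> \<le> A4" "\<And>t x. t \<in> {0..T} \<Longrightarrow> \<bar>e 5 t x\<bar> \<le> A5"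
    by (rule e_bounds) blast
  obtain M1 where M1: "0 \<le> M1" "\<And>t x. t \<in> {0..T} \<Longrightarrow> \<bar>d 1 t x\<bar> \<le> M1"
    by (rule d_bdd_pos[of 1]) auto
  obtain M3 where M3: "0 \<le> M3" "\<And>t x. t \<in> {0..T} \<Longrightarrow> \<bar>d 3 t x\<bar> \<le> M3"
    by (rule d_bdd_pos[of 3]) auto
  let ?p = "\<lambda>t x. e 5 t x / 2 - 5 / 4 * e 3 t x * e 4 t x + 3 / 4 * e 3 t x ^ 3"
  let ?q = "\<lambda>t x. - 3 / 2 * d 3 t x"
  let ?w1 = "\<lambda>t x. e_x 5 t x / 2 - 5 / 4 * (e_x 3 t x * e 4 t x + e 3 t x * e_x 4 t x)
    + 9 / 4 * ((e 3 t x)\<^sup>2 * e_x 3 t x) + 3 / 2 * \<alpha> t * d 4 t x"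
  let ?w2 = "\<lambda>t x. e_xx 5 t x / 2 - 5 / 4 * (e_xx 3 t x * e 4 t x + 2 * e_x 3 t x * e_x 4 t x + e 3 t x * e_xx 4 t x)
    + 9 / 4 * (2 * e 3 t x * (e_x 3 t x)\<^sup>2 + (e 3 t x)\<^sup>2 * e_xx 3 t x) + 3 / 2 * \<alpha> t * d 5 t x"
  let ?p_t = "\<lambda>t x. e5_t t x / 2 - 5 / 4 * (e3_t t x * e 4 t x + e 3 t x * e4_t t x)
    + 9 / 4 * ((e 3 t x)\<^sup>2 * e3_t t x)"
  let ?q_t = "\<lambda>t x. - 3 / 4 * (d 5 t x + \<alpha> t * S 3 t x)"
  have "0 \<le> ?p t x - \<alpha> t * ?q t x"
  proof (rule flow_maximum_principle[where p = ?p and q = ?q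
        and D = "{0..}" and A = "A5 / 2 + 5 / 4 * (A3 * A4) + 3 / 4 * A3 ^ 3 + 3 / 2 * M3"
        and b = "\<lambda>t x. \<alpha> t * d 1 t x + e 3 t x" and bb = "M1 + A3" and c = 0
        and ?w1.0 = ?w1 and ?w2.0 = ?w2])
    show "continuous_on ({0..T} \<times> {0..}) (\<lambda>(t, x). ?p t x)"
      "continuous_on ({0..T} \<times> {0..}) (\<lambda>(t, x). ?q t x)"
      unfolding split_def by (intro continuous_intros e_cont d_cont'; simp)+
    show "0 \<le> ?q t x" if "t \<in> {0..T}" "x \<in> {0..}" for t x
      using e3_nonpos[OF that(1), of x] d2_pos[OF that(1), of x] that
      by (simp add: d_eq_e[OF that(1), of 3] mult_le_0_iff)
    show "0 \<le> ?p 0 x - \<alpha> 0 * ?q 0 x" if "x \<in> {0..}" for x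
      using init that by (simp add: admissible_def W_prof_def e_def)
    show "- (A5 / 2 + 5 / 4 * (A3 * A4) + 3 / 4 * A3 ^ 3 + 3 / 2 * M3) \<le> ?p t x - \<alpha> t * ?q t x"
      if t: "t \<in> {0..T}" for t x
    proof -
      have "\<bar>e 3 t x * e 4 t x\<bar> \<le> A3 * A4"
        unfolding abs_mult using A t by (intro mult_mono) auto
      moreover have "\<bar>e 3 t x ^ 3\<bar> \<le> A3 ^ 3"
        unfolding power_abs using A(4)[OF t] by (intro power_mono) auto
      moreover have "\<bar>\<alpha> t * d 3 t x\<bar> \<le> M3" by (rule \<alpha>_mult_bound[OF t M3(2)[OF t]])
      moreover have "\<alpha> t * ?q t x = - 3 / 2 * (\<alpha> t * d 3 t x)" by simp
      ultimately show ?thesis using A(6)[OF t, of x] unfolding mult.assoc by linarith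
    qed
    show "\<bar>\<alpha> t * d 1 t x + e 3 t x\<bar> \<le> M1 + A3" if "t \<in> {0..T}" for t x
      using \<alpha>_mult_bound[OF that M1(2)[OF that, of x]] A(4)[OF that, of x] by linarith
    fix t x :: real assume t: "t \<in> {0..T}"
    show "((\<lambda>y. ?p t y - \<alpha> t * ?q t y) has_real_derivative ?w1 t x) (at x)"
      by (rule derivative_eq_intros e_xs[OF _ t] d_x'[OF t] refl | simp)+ (simp add: field_simps)
    show "(?w1 t has_real_derivative ?w2 t x) (at x)"
      by (rule derivative_eq_intros e_xs[OF _ t] d_x'[OF t] refl | simp)+ (simp add: field_simps power2_eq_square)
  next
    fix t x :: real assume t: "0 < t" "t \<le> T" and x: "x \<in> {0..}" and neg: "?p t x - \<alpha> t * ?q t x < 0"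
    then have tT: "t \<in> {0..T}" by auto
    define n where "n = - (e 4 t x - (e 3 t x)\<^sup>2) / 2 - \<alpha> t * d 2 t x"
    have n: "0 \<le> n" using N_nonneg[OF tT, of x] by (simp add: n_def N_prof_e)
    have e3: "e 3 t x \<le> 0" using e3_nonpos[OF tT, of x] x by simp
    have \<alpha>y: "0 \<le> \<alpha> t * d 2 t x" using \<alpha>_range[OF tT] d2_pos[OF tT, of x] by simp
    have "x \<noteq> 0" using neg e_odd_0[OF tT] d_eq_e[OF tT, of 3 0] by auto
    then have int: "x \<in> interior {0..}" using x by simp
    have "0 \<le> - (\<alpha> t * d 2 t x + 5 * n) * (?p t x - \<alpha> t * ?q t x)"
      using n \<alpha>y neg by (intro mult_nonpos_nonpos) auto
    moreover have "0 \<le> - e 3 t x * (3 / 2 * n\<^sup>2)"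
      using n e3 by (intro mult_nonneg_nonneg) auto
    moreover have "?p_t t x - \<alpha> t * ?q_t t x = 1 / 2 * ?w2 t x + (\<alpha> t * d 1 t x + e 3 t x) * ?w1 t x
        - (\<alpha> t * d 2 t x + 5 * n) * (?p t x - \<alpha> t * ?q t x) - e 3 t x * (3 / 2 * n\<^sup>2)"
      unfolding S_simps[OF tT] d_eq_e[OF tT, of 3] d_eq_e[OF tT, of 4] d_eq_e[OF tT, of 5]
      by (rule evolution_identities(3)) (simp_all add: e5_t_def e4_t_def e3_t_def e_xx_def e_x_def n_def del: One_nat_def)
    ultimately have ineq: "1 / 2 * ?w2 t x + (\<alpha> t * d 1 t x + e 3 t x) * ?w1 t x
        + 0 * (?p t x - \<alpha> t * ?q t x) \<le> ?p_t t x - \<alpha> t * ?q_t t x" by linarith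
    have der: "((\<lambda>s. ?p s x) has_real_derivative ?p_t t x) (at t within {0..t})"
      by (rule derivative_eq_intros e_t[OF t] refl | simp)+ (simp add: field_simps)
    have der_q: "((\<lambda>s. ?q s x) has_real_derivative ?q_t t x) (at t within {0..t})"
      by (rule derivative_eq_intros d_t'[OF t] refl | simp)+
    show "x \<in> interior {0..} \<and> (\<exists>p' q'. ((\<lambda>s. ?p s x) has_real_derivative p') (at t within {0..t}) \<and>
        ((\<lambda>s. ?q s x) has_real_derivative q') (at t within {0..t}) \<and>
        1 / 2 * ?w2 t x + (\<alpha> t * d 1 t x + e 3 t x) * ?w1 t x + 0 * (?p t x - \<alpha> t * ?q t x) \<le> p' - \<alpha> t * q')"
      by (intro conjI exI[of _ "?p_t t x"] exI[of _ "?q_t t x"] int der der_q ineq)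
  qed (use assms in auto)
  then show ?thesis by (simp add: W_prof_def e_def)
qed

lemma admissible_preserved:
  assumes t: "t \<in> {0..T}"
  shows "admissible (\<alpha> t) (\<lambda>k. d k t)"
proof -
  obtain c where "0 < c" "\<forall>x. c * (1 - (tanh x)\<^sup>2) \<le> d 2 0 x"
    using init by (auto simp: admissible_def)
  with sech_lower_bound_preserved[of c] have "\<exists>c>0. \<forall>x. c * (1 - (tanh x)\<^sup>2) \<le> d 2 t x"
    using t by blast
  moreover have "\<exists>A. \<forall>x. \<bar>d k t x\<bar> \<le> A * d 2 t x" if "k \<in> {3, 4, 5}" for k
    using that ratio_bounds t by (elim insertE emptyE) blast+
  ultimately show ?thesis
    unfolding admissible_def
    using odd_preserved[OF _ t] init N_nonneg[OF t] P_nonneg[OF t] W_nonneg[OF t]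
    by (simp add: admissible_def)
qed

end

text \<open>Handles the drops of \<alpha> between phases. Lowering a raises N since
  \<open>f 2\<close> > 0 and raises W on x \<ge> 0 since \<open>f 3\<close> \<le> 0 there; P does
  not involve a.\<close>

lemma admissible_mono:
  assumes "admissible a f" and "a' \<le> a" and "0 \<le> a'" and f_x: "\<And>k x. 1 \<le> k \<Longrightarrow> (f k has_real_derivative f (Suc k) x) (at x)"
  shows "admissible a' f"
proof -
  from assms(1) obtain c where c: "0 < c" "\<And>x. c * (1 - (tanh x)\<^sup>2) \<le> f 2 x"
    by (auto simp: admissible_def)
  have pos: "0 < f 2 x" for x
  proof -
    have "0 < c * (1 - (tanh x)\<^sup>2)"
      using c(1) tanh_real_bounds[of x] by (auto simp: abs_square_less_1)
    then show ?thesis using c(2)[of x] by linarith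
  qed
  interpret profile f using assms pos by unfold_locales (auto simp: admissible_def)
  have N: "0 \<le> N_prof a f x" "N_prof a f x \<le> N_prof a' f x" for x
    using assms pos[of x] by (auto simp: admissible_def N_prof_def mult_right_mono)
  have "W_prof a f x \<le> W_prof a' f x" if "0 \<le> x" for x
  proof -
    have "ratio f 3 x \<le> 0" by (rule ratio3_nonpos[of a]) (use assms N that in auto)
    then have "f 3 x \<le> 0" using pos[of x] f_eq[of 3 x] by (simp add: mult_le_0_iff)
    then have "a' * (- 3 / 2 * f 3 x) \<le> a * (- 3 / 2 * f 3 x)"
      using assms by (intro mult_right_mono) auto
    then show ?thesis by (simp add: W_prof_def)
  qed
  then show ?thesis using assms(1) N unfolding admissible_def by (meson order_trans)
qed

section \<open>Function algebras closed under differentiation\<close>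

text \<open>Polynomials with real coefficients in the generators. If the derivatives of the
  generators stay in the algebra, boundedness and joint continuity of all iterated derivatives
  follow from those of the generators, without explicit formulas. The time t is a parameter that is
  never differentiated.\<close>

inductive_set deriv_alg :: "('i \<Rightarrow> real \<Rightarrow> real \<Rightarrow> real) \<Rightarrow> (real \<Rightarrow> real \<Rightarrow> real) set"
  for e :: "'i \<Rightarrow> real \<Rightarrow> real \<Rightarrow> real" where
  gen: "e i \<in> deriv_alg e"
| const: "(\<lambda>t x. a) \<in> deriv_alg e"
| add: "f \<in> deriv_alg e \<Longrightarrow> g \<in> deriv_alg e \<Longrightarrow> (\<lambda>t x. f t x + g t x) \<in> deriv_alg e"
| mult: "f \<in> deriv_alg e \<Longrightarrow> g \<in> deriv_alg e \<Longrightarrow> (\<lambda>t x. f t x * g t x) \<in> deriv_alg e"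

lemma deriv_alg_sum:
  assumes "\<And>i. f i \<in> deriv_alg e"
  shows "(\<lambda>t x. \<Sum>i\<le>(n::nat). f i t x) \<in> deriv_alg e"
  by (induction n) (use assms in \<open>auto intro: deriv_alg.add\<close>)

lemma deriv_alg_derivative:
  assumes e: "\<And>i. \<exists>f'\<in>deriv_alg e. \<forall>t\<in>S. \<forall>x. (e i t has_real_derivative f' t x) (at x)"
    and f: "f \<in> deriv_alg e"
  shows "\<exists>f'\<in>deriv_alg e. \<forall>t\<in>S. \<forall>x. (f t has_real_derivative f' t x) (at x)"
  using f
proof induction
  case (const a)
  show ?case by (rule bexI[of _ "\<lambda>t x. 0"]) (auto intro: deriv_alg.const)
next
  case (add f g)
  then obtain f' g' where "f' \<in> deriv_alg e" "g' \<in> deriv_alg e"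
    "\<forall>t\<in>S. \<forall>x. (f t has_real_derivative f' t x) (at x)" "\<forall>t\<in>S. \<forall>x. (g t has_real_derivative g' t x) (at x)"
    by blast
  then show ?case
    by (intro bexI[of _ "\<lambda>t x. f' t x + g' t x"] ballI allI DERIV_add deriv_alg.add) auto
next
  case (mult f g)
  then obtain f' g' where "f' \<in> deriv_alg e" "g' \<in> deriv_alg e"
    "\<forall>t\<in>S. \<forall>x. (f t has_real_derivative f' t x) (at x)" "\<forall>t\<in>S. \<forall>x. (g t has_real_derivative g' t x) (at x)"
    by blast
  then show ?case
    by (intro bexI[of _ "\<lambda>t x. f t x * g' t x + f' t x * g t x"] ballI allI DERIV_mult' deriv_alg.add
        deriv_alg.mult mult.hyps) auto
qed (rule e)

lemma deriv_alg_bounded: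
  assumes e: "\<And>i. \<exists>M. \<forall>t\<in>S. \<forall>x. \<bar>e i t x\<bar> \<le> M" and f: "f \<in> deriv_alg e"
  shows "\<exists>M. \<forall>t\<in>S. \<forall>x. \<bar>f t x\<bar> \<le> M"
  using f
proof induction
  case (add f g)
  then obtain M N where M: "\<forall>t\<in>S. \<forall>x. \<bar>f t x\<bar> \<le> M" "\<forall>t\<in>S. \<forall>x. \<bar>g t x\<bar> \<le> N" by blast
  have "\<bar>f t x + g t x\<bar> \<le> M + N" if "t \<in> S" for t x
  proof -
    have "\<bar>f t x\<bar> \<le> M" "\<bar>g t x\<bar> \<le> N" using M that by auto
    then show ?thesis by linarith
  qed
  then show ?case by blast
next
  case (mult f g)
  then obtain M N where M: "\<forall>t\<in>S. \<forall>x. \<bar>f t x\<bar> \<le> M" "\<forall>t\<in>S. \<forall>x. \<bar>g t x\<bar> \<le> N" by blast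
  have "\<bar>f t x * g t x\<bar> \<le> M * N" if "t \<in> S" for t x
  proof -
    have "\<bar>f t x\<bar> \<le> M" "\<bar>g t x\<bar> \<le> N" using M that by auto
    then show ?thesis unfolding abs_mult by (intro mult_mono) auto
  qed
  then show ?case by blast
qed (use e in auto)

lemma deriv_alg_continuous:
  assumes e: "\<And>i. continuous_on (S \<times> UNIV) (\<lambda>(t, x). e i t x)" and f: "f \<in> deriv_alg e"
  shows "continuous_on (S \<times> UNIV) (\<lambda>(t, x). f t x)"
  using f by induction (use e in \<open>auto simp: split_def intro!: continuous_intros\<close>)

lemma deriv_alg_iterate:
  assumes e: "\<And>i. \<exists>f'\<in>deriv_alg e. \<forall>t\<in>S. \<forall>x. (e i t has_real_derivative f' t x) (at x)"
    and f: "f \<in> deriv_alg e"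
  shows "\<exists>g\<in>deriv_alg e. \<forall>t\<in>S. (deriv ^^ k) (f t) = g t"
proof (induction k)
  case (Suc k)
  then obtain g where g: "g \<in> deriv_alg e" "\<forall>t\<in>S. (deriv ^^ k) (f t) = g t" by blast
  obtain g' where g': "g' \<in> deriv_alg e" "\<forall>t\<in>S. \<forall>x. (g t has_real_derivative g' t x) (at x)"
    using deriv_alg_derivative[OF e g(1)] by blast
  have "deriv (g t) = g' t" if "t \<in> S" for t using g'(2) that by (auto intro!: DERIV_imp_deriv)
  then show ?case using g g' by (intro bexI[of _ g']) auto
qed (use f in auto)

section \<open>From the integrated equation to a flow\<close>

text \<open>The mean value inequality is applied twice, first to \<open>f1\<close> and then to f
  minus its linear part; this gives M in place of M / 2, which is all that the quadratic estimates
  ask for.\<close>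

lemma second_order_bound:
  fixes f f1 f2 :: "real \<Rightarrow> real"
  assumes f: "\<And>y. \<bar>y - x\<bar> \<le> \<bar>h\<bar> \<Longrightarrow> (f has_real_derivative f1 y) (at y)"
    and f1: "\<And>y. \<bar>y - x\<bar> \<le> \<bar>h\<bar> \<Longrightarrow> (f1 has_real_derivative f2 y) (at y)"
    and M: "\<And>y. \<bar>y - x\<bar> \<le> \<bar>h\<bar> \<Longrightarrow> \<bar>f2 y\<bar> \<le> M"
  shows "\<bar>f (x + h) - f x - h * f1 x\<bar> \<le> M * h\<^sup>2"
proof -
  let ?S = "cball x \<bar>h\<bar>"
  have S: "\<bar>y - x\<bar> \<le> \<bar>h\<bar>" if "y \<in> ?S" for y using that by (simp add: dist_real_def abs_minus_commute)
  have M0: "0 \<le> M" using M[of x] by simp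
  have 1: "\<bar>f1 y - f1 x\<bar> \<le> M * \<bar>h\<bar>" if y: "y \<in> ?S" for y
  proof -
    have "norm (f1 y - f1 x) \<le> M * norm (y - x)"
      by (rule field_differentiable_bound[of ?S f1 f2])
        (use y S f1 M in \<open>auto intro!: DERIV_subset[OF f1]\<close>)
    also have "\<dots> \<le> M * \<bar>h\<bar>" using S[OF y] M0 by (auto intro!: mult_left_mono)
    finally show ?thesis by simp
  qed
  have "norm ((f (x + h) - (x + h) * f1 x) - (f x - x * f1 x)) \<le> (M * \<bar>h\<bar>) * norm ((x + h) - x)"
  proof (rule field_differentiable_bound[of ?S "\<lambda>y. f y - y * f1 x" "\<lambda>y. f1 y - f1 x"])
    fix y assume y: "y \<in> ?S"
    show "((\<lambda>y. f y - y * f1 x) has_real_derivative f1 y - f1 x) (at y within ?S)"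
      by (rule derivative_eq_intros DERIV_subset[OF f[OF S[OF y]]] refl | simp)+
    show "norm (f1 y - f1 x) \<le> M * \<bar>h\<bar>" using 1[OF y] by simp
  qed (auto simp: dist_real_def)
  then show ?thesis by (simp add: algebra_simps power2_eq_square abs_mult_self_eq)
qed

lemma has_real_derivative_of_quadratic_bound:
  fixes G :: "real \<Rightarrow> real"
  assumes K: "\<And>h. \<bar>h\<bar> \<le> 1 \<Longrightarrow> \<bar>G (x + h) - G x - h * D\<bar> \<le> K * h\<^sup>2"
  shows "(G has_real_derivative D) (at x)"
proof -
  have "((\<lambda>h. (G (x + h) - G x) / h - D) \<longlongrightarrow> 0) (at 0)"
  proof (rule Lim_null_comparison[where g = "\<lambda>h. \<bar>K\<bar> * \<bar>h\<bar>"])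
    have "\<forall>\<^sub>F h in at (0::real). \<bar>h\<bar> \<le> 1 \<and> h \<noteq> 0"
      unfolding eventually_at by (intro exI[of _ 1]) (auto simp: dist_real_def)
    then show "\<forall>\<^sub>F h in at 0. norm ((G (x + h) - G x) / h - D) \<le> \<bar>K\<bar> * \<bar>h\<bar>"
    proof eventually_elim
      case (elim h)
      then have "(G (x + h) - G x) / h - D = (G (x + h) - G x - h * D) / h" by (simp add: field_simps)
      moreover have "\<bar>G (x + h) - G x - h * D\<bar> \<le> \<bar>K\<bar> * (\<bar>h\<bar> * \<bar>h\<bar>)"
        using K[of h] elim mult_right_mono[OF abs_ge_self[of K], of "h\<^sup>2"] by (simp add: power2_eq_square)
      ultimately show ?case using elim by (simp add: abs_divide pos_divide_le_eq mult.assoc)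
    qed
    have "((\<lambda>h. \<bar>K\<bar> * \<bar>h\<bar>) \<longlongrightarrow> \<bar>K\<bar> * \<bar>0\<bar>) (at (0::real))" by (intro tendsto_intros)
    then show "((\<lambda>h. \<bar>K\<bar> * \<bar>h\<bar>) \<longlongrightarrow> 0) (at (0::real))" by simp
  qed
  then have "((\<lambda>h. (G (x + h) - G x) / h) \<longlongrightarrow> D) (at 0)" by (simp add: LIM_zero_iff)
  then show ?thesis by (simp add: DERIV_def)
qed

text \<open>A bound M on the second x-derivative makes the remainder quadratic in h uniformly in
  \<tau>, and this survives integration. In \<tau> only integrability is asked for, which suits
  integrands containing \<alpha>.\<close>

lemma has_integral_parameter_derivative:
  fixes F F1 F2 :: "real \<Rightarrow> real \<Rightarrow> real"
  assumes st: "s \<le> t"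
    and F: "\<And>x. ((\<lambda>\<tau>. F \<tau> x) has_integral G x) {s..t}"
    and F1: "((\<lambda>\<tau>. F1 \<tau> x) has_integral G1) {s..t}"
    and dF: "\<And>\<tau> y. \<tau> \<in> {s..t} \<Longrightarrow> (F \<tau> has_real_derivative F1 \<tau> y) (at y)"
    and dF1: "\<And>\<tau> y. \<tau> \<in> {s..t} \<Longrightarrow> (F1 \<tau> has_real_derivative F2 \<tau> y) (at y)"
    and M: "\<And>\<tau> y. \<tau> \<in> {s..t} \<Longrightarrow> \<bar>F2 \<tau> y\<bar> \<le> M"
  shows "(G has_real_derivative G1) (at x)"
proof (rule has_real_derivative_of_quadratic_bound[where K = "M * (t - s)"])
  fix h :: real
  have "((\<lambda>\<tau>. F \<tau> (x + h) - F \<tau> x - h * F1 \<tau> x) has_integral G (x + h) - G x - h * G1) {s..t}"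
    by (intro has_integral_diff F has_integral_mult_right F1)
  moreover have "norm (F \<tau> (x + h) - F \<tau> x - h * F1 \<tau> x) \<le> M * h\<^sup>2" if "\<tau> \<in> {s..t}" for \<tau>
    unfolding real_norm_def by (rule second_order_bound) (use dF dF1 M that in auto)
  moreover have "0 \<le> M * h\<^sup>2" using M[of s x] st by simp
  ultimately have "norm (G (x + h) - G x - h * G1) \<le> M * h\<^sup>2 * measure lborel {s..t}"
    by (intro has_integral_bound_real) auto
  then show "\<bar>G (x + h) - G x - h * G1\<bar> \<le> M * (t - s) * h\<^sup>2" using st by (simp add: mult_ac)
qed

text \<open>The second mean value theorem for the increasing weight - \<alpha> delivers
  integrability of the product as part of its conclusion, whatever the jumps of \<alpha>.\<close>

lemma monotone_times_continuous_integrable: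
  fixes \<alpha> f :: "real \<Rightarrow> real"
  assumes "\<And>s t. a \<le> s \<Longrightarrow> s \<le> t \<Longrightarrow> t \<le> b \<Longrightarrow> \<alpha> t \<le> \<alpha> s" and "continuous_on {a..b} f" and "a \<le> b"
  shows "(\<lambda>t. \<alpha> t * f t) integrable_on {a..b}"
proof -
  have f: "f integrable_on {a..b}" using assms(2) by (rule integrable_continuous_interval)
  have mono: "- \<alpha> s \<le> - \<alpha> t" if "a \<le> s" "s \<le> t" "t \<le> b" for s t using assms(1) that by simp
  obtain c where "((\<lambda>t. - \<alpha> t * f t) has_integral
      (- \<alpha> a * integral {a..c} f + - \<alpha> b * integral {c..b} f)) {a..b}"
    by (rule second_mean_value_theorem_full[OF f assms(3) mono])
  from has_integral_neg[OF this] show ?thesis by (auto simp: integrable_on_def)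
qed

section \<open>Differentiating the integrated equation\<close>

definition square_deriv :: "(nat \<Rightarrow> real \<Rightarrow> real \<Rightarrow> real) \<Rightarrow> nat \<Rightarrow> real \<Rightarrow> real \<Rightarrow> real" where
  "square_deriv d k t x = (\<Sum>i\<le>k. real (k choose i) * (d (Suc i) t x * d (Suc (k - i)) t x))"

text \<open>\<open>square_deriv\<close> is the Leibniz expansion of the k-th derivative of (d 1)^2,
  so this is Pascal's rule, applied after index 0 has been split off.\<close>

lemma square_deriv_has_derivative:
  assumes d_x: "\<And>k x. (d k t has_real_derivative d (Suc k) t x) (at x)"
  shows "(square_deriv d k t has_real_derivative square_deriv d (Suc k) t x) (at x)"
proof -
  have "(square_deriv d k t has_real_derivative
      (\<Sum>i\<le>k. real (k choose i) * (d (Suc i) t x * d (Suc (Suc (k - i))) t x + d (Suc (Suc i)) t x * d (Suc (k - i)) t x))) (at x)"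
    unfolding square_deriv_def[abs_def]
    by (rule DERIV_sum DERIV_cmult DERIV_mult' d_x)+
  moreover have "(\<Sum>i\<le>k. real (k choose i) * (d (Suc i) t x * d (Suc (Suc (k - i))) t x + d (Suc (Suc i)) t x * d (Suc (k - i)) t x))
      = square_deriv d (Suc k) t x"
  proof -
    let ?a = "\<lambda>i. d (Suc i) t x"
    have "square_deriv d (Suc k) t x = ?a 0 * ?a (Suc k) +
        (\<Sum>i\<le>k. real (Suc k choose Suc i) * (?a (Suc i) * ?a (k - i)))"
      by (simp add: square_deriv_def sum.atMost_Suc_shift del: binomial_Suc_Suc sum.atMost_Suc)
    also have "(\<Sum>i\<le>k. real (Suc k choose Suc i) * (?a (Suc i) * ?a (k - i))) =
        (\<Sum>i\<le>k. real (k choose i) * (?a (Suc i) * ?a (k - i))) +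
        (\<Sum>i\<le>k. real (k choose Suc i) * (?a (Suc i) * ?a (k - i)))"
      by (simp add: algebra_simps sum.distrib)
    also have "?a 0 * ?a (Suc k) + (\<dots>) = (\<Sum>i\<le>k. real (k choose i) * (?a (Suc i) * ?a (k - i))) +
        (\<Sum>i\<le>Suc k. real (k choose i) * (?a i * ?a (Suc k - i)))"
      by (simp add: sum.atMost_Suc_shift del: sum.atMost_Suc)
    \<comment> \<open>The top index \<open>Suc k\<close> drops out because
      \<open>k choose Suc k\<close> is 0.\<close>
    also have "(\<Sum>i\<le>Suc k. real (k choose i) * (?a i * ?a (Suc k - i))) =
        (\<Sum>i\<le>k. real (k choose i) * (?a i * ?a (Suc (k - i))))"
      by (simp add: Suc_diff_le)
    finally show ?thesis by (simp add: sum.distrib algebra_simps)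
  qed
  ultimately show ?thesis by simp
qed

text \<open>Only the identity of order 0 is given, integrated in time. Spatial derivatives are taken
  under the integral one order at a time, and each integrated identity is then differentiated in
  time from the left.\<close>

lemma parisi_flow_of_integral_equation:
  fixes d :: "nat \<Rightarrow> real \<Rightarrow> real \<Rightarrow> real" and \<alpha> :: "real \<Rightarrow> real"
  assumes T: "0 \<le> T"
    and d_x: "\<And>k t x. t \<in> {0..T} \<Longrightarrow> (d k t has_real_derivative d (Suc k) t x) (at x)"
    and d_bdd: "\<And>k. 1 \<le> k \<Longrightarrow> \<exists>M. \<forall>t\<in>{0..T}. \<forall>x. \<bar>d k t x\<bar> \<le> M"
    and d_cont: "\<And>k. 1 \<le> k \<Longrightarrow> continuous_on ({0..T} \<times> UNIV) (\<lambda>(t, x). d k t x)"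
    and \<alpha>_range: "\<And>t. t \<in> {0..T} \<Longrightarrow> 0 \<le> \<alpha> t \<and> \<alpha> t \<le> 1"
    and \<alpha>_mono: "\<And>s t. 0 \<le> s \<Longrightarrow> s \<le> t \<Longrightarrow> t \<le> T \<Longrightarrow> \<alpha> t \<le> \<alpha> s"
    and \<alpha>_left: "\<And>t. t \<in> {0..T} \<Longrightarrow> (\<alpha> \<longlongrightarrow> \<alpha> t) (at t within {0..t})"
    and eq: "\<And>s t x. 0 \<le> s \<Longrightarrow> s \<le> t \<Longrightarrow> t \<le> T \<Longrightarrow>
      ((\<lambda>\<tau>. 1 / 2 * (d 2 \<tau> x + \<alpha> \<tau> * (d 1 \<tau> x)\<^sup>2)) has_integral (d 0 t x - d 0 s x)) {s..t}"
  shows "parisi_flow d (square_deriv d) \<alpha> T"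
proof -
  let ?S = "square_deriv d"
  define F where "F = (\<lambda>k t x. 1 / 2 * (d (k + 2) t x + \<alpha> t * ?S k t x))"
  have S_x: "(?S k t has_real_derivative ?S (Suc k) t x) (at x)" if "t \<in> {0..T}" for k t x
    by (rule square_deriv_has_derivative) (rule d_x[OF that])
  have F_x: "(F k t has_real_derivative F (Suc k) t x) (at x)" if "t \<in> {0..T}" for k t x
    unfolding F_def using d_x[OF that, of "k + 2"]
    by (intro DERIV_cmult DERIV_add S_x that) simp
  \<comment> \<open>\<open>d 0\<close> is not assumed bounded and does not enter the expressions
    \<open>F k\<close>, so index 0 is free to carry \<alpha>; the algebra is used here for
    boundedness alone.\<close>
  define e where "e = (\<lambda>i. if i = 0 then (\<lambda>t x. \<alpha> t) else d i)"
  have e_bdd: "\<exists>M. \<forall>t\<in>{0..T}. \<forall>x. \<bar>e i t x\<bar> \<le> M" for i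
    using d_bdd[of i] \<alpha>_range by (cases "i = 0") (force simp: e_def)+
  have "(\<lambda>t x. \<alpha> t) \<in> deriv_alg e" using deriv_alg.gen[of e 0] by (simp add: e_def)
  moreover have d_alg: "(\<lambda>t x. d i t x) \<in> deriv_alg e" if "1 \<le> i" for i
    using deriv_alg.gen[of e i] that by (simp add: e_def)
  ultimately have "F k \<in> deriv_alg e" for k
    unfolding F_def square_deriv_def
    by (intro deriv_alg.intros deriv_alg_sum) (auto intro: deriv_alg.intros)
  then have F_bdd: "\<exists>M. \<forall>t\<in>{0..T}. \<forall>x. \<bar>F k t x\<bar> \<le> M" for k
    by (rule deriv_alg_bounded[OF e_bdd])
  have d_cont1: "continuous_on {0..T} (\<lambda>t. d k t x)" if "1 \<le> k" for k x
    using continuous_on_compose2[OF d_cont[OF that], of "{0..T}" "\<lambda>t. (t, x)"]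
    by (force intro!: continuous_intros)
  have S_cont1: "continuous_on {0..T} (\<lambda>t. ?S k t x)" for k x
    unfolding square_deriv_def by (intro continuous_intros d_cont1) auto
  have F_int: "(\<lambda>\<tau>. F k \<tau> x) integrable_on {s..t}" if st: "0 \<le> s" "s \<le> t" "t \<le> T" for k x s t
  proof -
    have sub: "{s..t} \<subseteq> {0..T}" using st by auto
    have "(\<lambda>\<tau>. d (k + 2) \<tau> x) integrable_on {s..t}"
      by (intro integrable_continuous_interval continuous_on_subset[OF d_cont1 sub]) simp
    moreover have "(\<lambda>\<tau>. \<alpha> \<tau> * ?S k \<tau> x) integrable_on {s..t}"
      by (intro monotone_times_continuous_integrable continuous_on_subset[OF S_cont1 sub])
        (use \<alpha>_mono st in auto)
    ultimately show ?thesis unfolding F_def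
      by (intro integrable_on_mult_right integrable_add)
  qed
  have F_integral: "((\<lambda>\<tau>. F k \<tau> x) has_integral (d k t x - d k s x)) {s..t}"
    if st: "0 \<le> s" "s \<le> t" "t \<le> T" for k x s t
  proof (induction k arbitrary: x)
    case 0
    have "(\<lambda>\<tau>. F 0 \<tau> x) = (\<lambda>\<tau>. 1 / 2 * (d 2 \<tau> x + \<alpha> \<tau> * (d 1 \<tau> x)\<^sup>2))"
      by (simp add: F_def square_deriv_def power2_eq_square numeral_2_eq_2)
    then show ?case using eq[OF st, of x] by (simp only:)
  next
    case (Suc k)
    obtain M where M: "\<forall>t\<in>{0..T}. \<forall>x. \<bar>F (Suc (Suc k)) t x\<bar> \<le> M" using F_bdd by blast
    \<comment> \<open>The same increment is differentiated twice over, under the integral and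
      directly; uniqueness of the derivative is the identity of the next order.\<close>
    have "((\<lambda>x. d k t x - d k s x) has_real_derivative integral {s..t} (\<lambda>\<tau>. F (Suc k) \<tau> x)) (at x)"
      by (rule has_integral_parameter_derivative[OF st(2) Suc.IH integrable_integral[OF F_int[OF st]], where M = M and ?F2.0 = "F (Suc (Suc k))"])
        (use F_x st M in auto)
    moreover have "((\<lambda>x. d k t x - d k s x) has_real_derivative d (Suc k) t x - d (Suc k) s x) (at x)"
      by (intro DERIV_diff d_x) (use st in auto)
    ultimately have "integral {s..t} (\<lambda>\<tau>. F (Suc k) \<tau> x) = d (Suc k) t x - d (Suc k) s x"
      by (rule DERIV_unique)
    then show ?case using integrable_integral[OF F_int[OF st, of "Suc k" x]] by simp
  qed
  show ?thesis
  proof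
    show "?S 0 t x = (d 1 t x)\<^sup>2" for t x by (simp add: square_deriv_def power2_eq_square)
    fix k :: nat and t x assume k: "1 \<le> k" and t: "0 < t" "t \<le> T"
    \<comment> \<open>Through \<alpha> the integrand is only left-continuous in time; that suffices
      for the left derivative of its integral at every t.\<close>
    have cont: "continuous (at t within {0..t}) (\<lambda>\<tau>. F k \<tau> x)"
    proof -
      have "((\<lambda>\<tau>. d (k + 2) \<tau> x) \<longlongrightarrow> d (k + 2) t x) (at t within {0..t})"
        "((\<lambda>\<tau>. ?S k \<tau> x) \<longlongrightarrow> ?S k t x) (at t within {0..t})"
        using continuous_on_subset[OF d_cont1[of "k + 2" x], of "{0..t}"]
          continuous_on_subset[OF S_cont1[of k x], of "{0..t}"] t
        by (auto simp: continuous_on_def)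
      then show ?thesis unfolding F_def continuous_within using t
        by (intro tendsto_intros \<alpha>_left) auto
    qed
    have "((\<lambda>u. integral {0..u} (\<lambda>\<tau>. F k \<tau> x)) has_vector_derivative F k t x) (at t within ({0..t} - {}))"
      by (rule integral_has_vector_derivative_continuous_at)
        (use F_int[of 0 t k x] t cont in auto)
    then have der: "((\<lambda>u. d k 0 x + integral {0..u} (\<lambda>\<tau>. F k \<tau> x)) has_real_derivative F k t x) (at t within {0..t})"
      by (auto simp: has_real_derivative_iff_has_vector_derivative intro!: derivative_eq_intros)
    have "d k 0 x + integral {0..u} (\<lambda>\<tau>. F k \<tau> x) = d k u x" if "u \<in> {0..t}" for u
      using integral_unique[OF F_integral[of 0 u k x]] that t by simp
    then have "((\<lambda>u. d k u x) has_real_derivative F k t x) (at t within {0..t})"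
      using t by (intro has_field_derivative_transform_within[OF der zero_less_one]) auto
    then show "((\<lambda>s. d k s x) has_real_derivative 1 / 2 * (d (k + 2) t x + \<alpha> t * ?S k t x)) (at t within {0..t})"
      by (simp add: F_def)
  qed (use assms S_x in auto)
qed

section \<open>The Parisi equation\<close>

text \<open>Lebesgue's fundamental theorem at the level of gauges. Off N, differentiability gives a
  straddle estimate; tags in N lie in intervals of small total length, over which absolute
  continuity makes the increments of f small.\<close>

lemma absolutely_continuous_has_integral:
  fixes f g :: "real \<Rightarrow> real"
  assumes ac: "absolutely_continuous_fun_on S f" and ab: "{a..b} \<subseteq> S" "a \<le> b"
    and N: "negligible N"
    and der: "\<And>x. x \<in> {a..b} - N \<Longrightarrow> (f has_real_derivative g x) (at x within {a..b})"
  shows "(g has_integral (f b - f a)) {a..b}"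
proof -
  \<comment> \<open>With the integrand set to 0 on N, tags in N contribute nothing to the Riemann
    sum and only the increments of f remain there.\<close>
  define g' where "g' = (\<lambda>x. if x \<in> N then 0 else g x)"
  have "(g' has_integral (f b - f a)) {a..b}"
    unfolding has_integral_real
  proof (intro allI impI)
    fix e :: real assume e: "0 < e"
    define \<epsilon> where "\<epsilon> = e / (2 * (b - a + 1))"
    have \<epsilon>: "0 < \<epsilon>" using e ab by (simp add: \<epsilon>_def)
    have "\<epsilon> * (b - a) \<le> \<epsilon> * (b - a + 1)" using \<epsilon> by simp
    also have "\<dots> = e / 2" using ab by (simp add: \<epsilon>_def field_simps)
    finally have \<epsilon>_le: "\<epsilon> * (b - a) \<le> e / 2" .
    have "\<exists>d>0. \<forall>y\<in>{a..b}. \<bar>y - x\<bar> < d \<longrightarrow> \<bar>f y - f x - g x * (y - x)\<bar> \<le> \<epsilon> * \<bar>y - x\<bar>"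
      if "x \<in> {a..b} - N" for x
    proof -
      from der[OF that] have "((\<lambda>y. (f y - f x) / (y - x)) \<longlongrightarrow> g x) (at x within {a..b})"
        by (simp add: has_field_derivative_iff)
      from tendstoD[OF this \<epsilon>] obtain d where d: "0 < d"
        "\<And>y. y \<in> {a..b} \<Longrightarrow> y \<noteq> x \<Longrightarrow> dist y x < d \<Longrightarrow> dist ((f y - f x) / (y - x)) (g x) < \<epsilon>"
        unfolding eventually_at by blast
      have "\<bar>f y - f x - g x * (y - x)\<bar> \<le> \<epsilon> * \<bar>y - x\<bar>" if "y \<in> {a..b}" "\<bar>y - x\<bar> < d" for y
      proof (cases "y = x")
        case False
        have "f y - f x - g x * (y - x) = ((f y - f x) / (y - x) - g x) * (y - x)"
          using False by (simp add: field_simps)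
        moreover have "\<bar>(f y - f x) / (y - x) - g x\<bar> \<le> \<epsilon>"
          using d(2)[of y] that False by (simp add: dist_real_def)
        ultimately show ?thesis by (simp add: abs_mult mult_right_mono)
      qed simp
      then show ?thesis using d by blast
    qed
    then have "\<forall>x\<in>{a..b} - N. \<exists>d>0. \<forall>y\<in>{a..b}. \<bar>y - x\<bar> < d \<longrightarrow> \<bar>f y - f x - g x * (y - x)\<bar> \<le> \<epsilon> * \<bar>y - x\<bar>"
      by blast
    from bchoice[OF this] obtain \<delta> where \<delta>: "\<And>x. x \<in> {a..b} - N \<Longrightarrow> 0 < \<delta> x"
      "\<And>x y. x \<in> {a..b} - N \<Longrightarrow> y \<in> {a..b} \<Longrightarrow> \<bar>y - x\<bar> < \<delta> x \<Longrightarrow> \<bar>f y - f x - g x * (y - x)\<bar> \<le> \<epsilon> * \<bar>y - x\<bar>"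
      by blast
    have "0 < e / 2" using e by simp
    then obtain \<eta> where \<eta>: "0 < \<eta>" "\<And>I :: (real \<times> real) set. finite I \<Longrightarrow> \<forall>(a, b)\<in>I. a \<le> b \<and> {a..b} \<subseteq> S \<Longrightarrow>
        disjoint_family_on (\<lambda>(a, b). {a<..<b}) I \<Longrightarrow>
        (\<Sum>(a, b)\<in>I. b - a) < \<eta> \<Longrightarrow> (\<Sum>(a, b)\<in>I. \<bar>f b - f a\<bar>) < e / 2"
      using ac[unfolded absolutely_continuous_fun_on_def, rule_format, of "e / 2"] by blast
    have N_null: "N \<in> null_sets lebesgue" using N by (simp add: negligible_iff_null_sets)
    obtain V where V: "open V" "N \<subseteq> V" "V - N \<in> lmeasurable" "emeasure lebesgue (V - N) < ennreal \<eta>"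
      using sets_lebesgue_outer_open[of N \<eta>] N_null \<eta>(1) by blast
    have V_em: "emeasure lebesgue V < ennreal \<eta>"
    proof -
      have "emeasure lebesgue V = emeasure lebesgue (V - N)"
        using emeasure_Diff_null_set[OF N_null, of V] V(1) by simp
      then show ?thesis using V(4) by simp
    qed
    then have "V \<in> lmeasurable"
      using V(1) by (intro fmeasurableI) (auto intro: less_trans ennreal_less_top)
    have V_m: "measure lebesgue V < \<eta>"
      using V_em \<eta>(1) \<open>V \<in> lmeasurable\<close> by (simp add: emeasure_eq_measure2 ennreal_less_iff)
    \<comment> \<open>A tag in N forces its interval into V, whose measure is below \<eta>; any
      other tag in [a, b] keeps its interval where the straddle estimate with \<epsilon>
      holds.\<close>
    define \<gamma> where "\<gamma> = (\<lambda>x. if x \<in> N then V else if x \<in> {a..b} then ball x (\<delta> x) else UNIV)"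
    show "\<exists>\<gamma>. gauge \<gamma> \<and> (\<forall>\<D>. \<D> tagged_division_of {a..b} \<and> \<gamma> fine \<D> \<longrightarrow>
        norm ((\<Sum>(x, k)\<in>\<D>. measure lborel k *\<^sub>R g' x) - (f b - f a)) < e)"
    proof (intro exI[of _ \<gamma>] conjI allI impI)
      show "gauge \<gamma>" using V \<delta>(1) by (auto simp: gauge_def \<gamma>_def)
      fix p assume "p tagged_division_of {a..b} \<and> \<gamma> fine p"
      then have p: "p tagged_division_of {a..b}" and fine: "\<gamma> fine p" by auto
      note pD = tagged_division_ofD[OF p]
      have pI: "\<exists>u v. u \<le> v \<and> k = {u..v} \<and> x \<in> {u..v} \<and> {u..v} \<subseteq> {a..b} \<and> {u..v} \<subseteq> \<gamma> x" if xk: "(x, k) \<in> p" for x k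
      proof -
        obtain u v where "k = {u..v}" using pD(4)[OF xk] by auto
        then show ?thesis using pD(2,3)[OF xk] fine xk by (auto simp: fine_def)
      qed
      define pN where "pN = {q \<in> p. fst q \<in> N}"
      have fin: "finite p" "finite pN" using pD(1) by (auto simp: pN_def)
      define D where "D = (\<lambda>(x, k). measure lborel k *\<^sub>R g' x - (f (Sup k) - f (Inf k)))"
      have "(\<Sum>(x, k)\<in>p. measure lborel k *\<^sub>R g' x) - (f b - f a) = sum D p"
        using additive_tagged_division_1[OF ab(2) p, of f] unfolding D_def
        by (simp add: sum_subtractf split_def)
      also have "\<dots> = sum D (p - pN) + sum D pN"
        using fin by (subst sum.subset_diff[of pN p]) (auto simp: pN_def)
      finally have split: "(\<Sum>(x, k)\<in>p. measure lborel k *\<^sub>R g' x) - (f b - f a) = sum D (p - pN) + sum D pN" .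
      have "norm (sum D (p - pN)) \<le> (\<Sum>q\<in>p - pN. \<epsilon> * measure lborel (snd q))"
      proof (rule sum_norm_le)
        fix q assume q: "q \<in> p - pN"
        obtain x k where q_eq: "q = (x, k)" by force
        with q have xk: "(x, k) \<in> p" and xN: "x \<notin> N" by (auto simp: pN_def)
        obtain u v where uv: "u \<le> v" "k = {u..v}" "x \<in> {u..v}" "{u..v} \<subseteq> {a..b}" "{u..v} \<subseteq> \<gamma> x"
          using pI[OF xk] by blast
        have x: "x \<in> {a..b} - N" using uv xN by auto
        then have sub: "{u..v} \<subseteq> ball x (\<delta> x)" using uv(5) by (simp add: \<gamma>_def)
        have "u \<in> {u..v}" "v \<in> {u..v}" using uv by auto
        then have u': "u \<in> {a..b}" "v \<in> {a..b}" "\<bar>u - x\<bar> < \<delta> x" "\<bar>v - x\<bar> < \<delta> x"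
          using uv(4) sub by (auto simp: subset_iff dist_real_def abs_minus_commute)
        have "\<bar>f u - f x - g x * (u - x)\<bar> \<le> \<epsilon> * \<bar>u - x\<bar>"
          by (rule \<delta>(2)[OF x]) (use u' in auto)
        moreover have "\<bar>f v - f x - g x * (v - x)\<bar> \<le> \<epsilon> * \<bar>v - x\<bar>"
          by (rule \<delta>(2)[OF x]) (use u' in auto)
        moreover have "\<epsilon> * \<bar>u - x\<bar> + \<epsilon> * \<bar>v - x\<bar> = \<epsilon> * (v - u)"
          using uv by (simp add: algebra_simps)
        moreover have "D q = (f u - f x - g x * (u - x)) - (f v - f x - g x * (v - x))"
          using uv xN by (simp add: D_def q_eq g'_def algebra_simps)
        ultimately show "norm (D q) \<le> \<epsilon> * measure lborel (snd q)"
          using uv by (simp add: q_eq)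
      qed
      also have "\<dots> \<le> (\<Sum>q\<in>p. \<epsilon> * measure lborel (snd q))"
        using fin \<epsilon> by (intro sum_mono2) auto
      also have "\<dots> = \<epsilon> * (b - a)"
        using additive_content_tagged_division[of p a b] p ab
        by (simp add: sum_distrib_left[symmetric] split_def)
      finally have part1: "norm (sum D (p - pN)) \<le> e / 2" using \<epsilon>_le by simp
      define h where "h = (\<lambda>q :: real \<times> real set. (Inf (snd q), Sup (snd q)))"
      define I where "I = h ` pN"
      have pN_I: "\<exists>u v. u \<le> v \<and> q = (fst q, {u..v}) \<and> h q = (u, v) \<and> {u..v} \<subseteq> {a..b} \<and> {u..v} \<subseteq> V" if "q \<in> pN" for q
      proof -
        have "(fst q, snd q) \<in> p" "fst q \<in> N" using that by (auto simp: pN_def)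
        from pI[OF this(1)] this(2) obtain u v where
          "u \<le> v" "snd q = {u..v}" "{u..v} \<subseteq> {a..b}" "{u..v} \<subseteq> V" by (auto simp: \<gamma>_def)
        then show ?thesis by (intro exI[of _ u] exI[of _ v]) (auto simp: h_def prod_eq_iff)
      qed
      have disj: "{fst (h q)<..<snd (h q)} \<inter> {fst (h r)<..<snd (h r)} = {}" if qr: "q \<in> pN" "r \<in> pN" "q \<noteq> r" for q r
      proof -
        obtain u v where uv: "u \<le> v" "q = (fst q, {u..v})" "h q = (u, v)" using pN_I[OF qr(1)] by blast
        obtain u' v' where uv': "u' \<le> v'" "r = (fst r, {u'..v'})" "h r = (u', v')" using pN_I[OF qr(2)] by blast
        have "interior {u..v} \<inter> interior {u'..v'} = {}"
          using pD(5)[of "fst q" "{u..v}" "fst r" "{u'..v'}"] qr uv(2) uv'(2) by (auto simp: pN_def)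
        then show ?thesis using uv uv' by simp
      qed
      \<comment> \<open>Absolute continuity speaks of a set of endpoint pairs, so passing from
        tagged intervals to pairs may identify two of them; this happens only for intervals of
        length 0, whose increments vanish.\<close>
      have degenerate: "snd (h q) = fst (h q)" if qr: "q \<in> pN" "r \<in> pN" "q \<noteq> r" "h q = h r" for q r
      proof -
        have "{fst (h q)<..<snd (h q)} = {}" using disj[OF qr(1-3)] qr(4) by simp
        moreover have "fst (h q) \<le> snd (h q)" using pN_I[OF qr(1)] by force
        ultimately show ?thesis by simp
      qed
      have "finite I" using fin by (simp add: I_def)
      moreover have "\<forall>(u, v)\<in>I. u \<le> v \<and> {u..v} \<subseteq> S"
      proof -
        have "fst i \<le> snd i \<and> {fst i..snd i} \<subseteq> S" if "i \<in> I" for i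
          using that pN_I ab(1) unfolding I_def by force
        then show ?thesis by (simp only: split_def) blast
      qed
      moreover have disjI: "disjoint_family_on (\<lambda>(u, v). {u<..<v}) I"
        using disj unfolding disjoint_family_on_def I_def split_def by blast
      moreover have "(\<Sum>(u, v)\<in>I. v - u) < \<eta>"
      proof -
        have "(\<Sum>(u, v)\<in>I. v - u) = (\<Sum>i\<in>I. measure lebesgue ((\<lambda>(u, v). {u<..<v}) i))"
          using \<open>\<forall>(u, v)\<in>I. u \<le> v \<and> {u..v} \<subseteq> S\<close> by (intro sum.cong) auto
        also have "\<dots> = measure lebesgue (\<Union>i\<in>I. (\<lambda>(u, v). {u<..<v}) i)"
          using \<open>finite I\<close> disjI \<open>\<forall>(u, v)\<in>I. u \<le> v \<and> {u..v} \<subseteq> S\<close>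
          by (intro measure_finite_Union[symmetric]) (auto simp: emeasure_lborel_Ioo)
        also have "\<dots> \<le> measure lebesgue V"
        proof (rule measure_mono_fmeasurable)
          show "(\<Union>i\<in>I. (\<lambda>(u, v). {u<..<v}) i) \<subseteq> V"
            using pN_I unfolding I_def by fastforce
        qed (use \<open>finite I\<close> \<open>V \<in> lmeasurable\<close> in auto)
        finally show ?thesis using V_m by simp
      qed
      ultimately have "(\<Sum>(u, v)\<in>I. \<bar>f v - f u\<bar>) < e / 2" by (rule \<eta>(2))
      also have "(\<Sum>(u, v)\<in>I. \<bar>f v - f u\<bar>) = (\<Sum>q\<in>pN. \<bar>f (snd (h q)) - f (fst (h q))\<bar>)"
        unfolding I_def split_def using fin degenerate
        by (subst sum.reindex_nontrivial) (auto simp: o_def)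
      finally have "(\<Sum>q\<in>pN. \<bar>f (snd (h q)) - f (fst (h q))\<bar>) < e / 2" .
      moreover have "norm (sum D pN) \<le> (\<Sum>q\<in>pN. \<bar>f (snd (h q)) - f (fst (h q))\<bar>)"
        by (rule sum_norm_le) (auto simp: D_def h_def g'_def pN_def)
      ultimately show "norm ((\<Sum>(x, k)\<in>p. measure lborel k *\<^sub>R g' x) - (f b - f a)) < e"
        using part1 norm_triangle_ineq[of "sum D (p - pN)" "sum D pN"] unfolding split by linarith
    qed
  qed
  then show ?thesis
    by (rule has_integral_spike[OF N, rotated]) (simp add: g'_def)
qed

text \<open>The function differs from the distribution function of \<nu> by the constant mass of the
  negative half line. After time reversal this is the left continuity that a flow requires of
  \<alpha>.\<close>

lemma borel_distribution_right_continuous: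
  fixes \<nu> :: "real measure"
  assumes \<nu>: "prob_space \<nu>" "sets \<nu> = sets borel" and s: "0 \<le> s"
  shows "((\<lambda>s. measure \<nu> {0..s}) \<longlongrightarrow> measure \<nu> {0..s}) (at_right s)"
proof -
  interpret prob_space \<nu> by fact
  interpret finite_borel_measure \<nu> by unfold_locales fact
  have eq: "measure \<nu> {0..r} = cdf \<nu> r - measure \<nu> {..<0}" if "0 \<le> r" for r :: real
  proof -
    have "measure \<nu> {0..r} = measure \<nu> ({..r} - {..<0})" by (rule arg_cong[where f = "measure \<nu>"]) auto
    also have "\<dots> = measure \<nu> {..r} - measure \<nu> {..<0}"
      using that \<nu>(2) by (intro finite_measure_Diff) auto
    finally show ?thesis by (simp add: cdf_def)
  qed
  have "((\<lambda>r. cdf \<nu> r - measure \<nu> {..<0}) \<longlongrightarrow> cdf \<nu> s - measure \<nu> {..<0}) (at_right s)"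
    using cdf_is_right_cont[of s] unfolding continuous_within by (intro tendsto_intros)
  moreover have "\<forall>\<^sub>F r in at_right s. cdf \<nu> r - measure \<nu> {..<0} = measure \<nu> {0..r}"
    using eventually_at_right_less[of s] by eventually_elim (use eq s in auto)
  ultimately show ?thesis using eq[OF s] by (simp add: filterlim_cong)
qed

text \<open>The substitution t = \<beta>^2 (1 - s) turns the factor \<beta>^2 / 2 into 1 / 2 and
  reverses time: the terminal datum becomes the initial one, and the increasing right-continuous
  mass of [0, s] becomes a decreasing left-continuous \<alpha>.\<close>

lemma parisi_solution_flow:
  fixes \<beta> q :: real
  assumes \<beta>: "0 < \<beta>" and q: "0 \<le> q" "q \<le> 1" and \<nu>: "prob_space \<nu>" "sets \<nu> = sets borel"
    and u: "parisi_solution \<beta> \<nu> u"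
    and d_def: "d = (\<lambda>k t. (deriv ^^ k) (u (1 - t / \<beta>\<^sup>2)))"
    and \<alpha>_def: "\<alpha> = (\<lambda>t. measure \<nu> {0..1 - t / \<beta>\<^sup>2})"
  shows "parisi_flow d (square_deriv d) \<alpha> (\<beta>\<^sup>2 * (1 - q))"
    and "0 \<le> t \<Longrightarrow> t \<le> \<beta>\<^sup>2 * (1 - q) \<Longrightarrow> ((\<lambda>\<tau>. 1 / 2 * (d 2 \<tau> x + \<alpha> \<tau> * (d 1 \<tau> x)\<^sup>2)) has_integral (d 0 t x - d 0 0 x)) {0..t}"
proof -
  interpret prob_space \<nu> by fact
  let ?T = "\<beta>\<^sup>2 * (1 - q)"
  have \<beta>2: "0 < \<beta>\<^sup>2" using \<beta> by simp
  have ran: "1 - t / \<beta>\<^sup>2 \<in> {0..1}" if "t \<in> {0..?T}" for t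
  proof -
    have "?T \<le> \<beta>\<^sup>2 * 1" using q \<beta>2 by (intro mult_left_mono) auto
    then have "t \<le> \<beta>\<^sup>2 * 1" using that by simp
    then show ?thesis using that \<beta>2 by simp
  qed
  note u' = u[unfolded parisi_solution_def]
  have ux: "((deriv ^^ k) (u s) has_real_derivative (deriv ^^ Suc k) (u s) x) (at x)" if "s \<in> {0..1}" for k s x
    using u' that by (simp add: DERIV_deriv_iff_real_differentiable)
  have eq: "((\<lambda>\<tau>. 1 / 2 * (d 2 \<tau> x + \<alpha> \<tau> * (d 1 \<tau> x)\<^sup>2)) has_integral (d 0 t x - d 0 s x)) {s..t}"
    if st: "0 \<le> s" "s \<le> t" "t \<le> ?T" for s t x
  proof -
    define a where "a = 1 - t / \<beta>\<^sup>2"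
    define b where "b = 1 - s / \<beta>\<^sup>2"
    have ab: "a \<le> b" "{a..b} \<subseteq> {0..1}"
      using ran[of t] ran[of s] st \<beta>2 by (auto simp: a_def b_def divide_right_mono)
    define g where "g = (\<lambda>\<sigma>. - (\<beta>\<^sup>2 / 2 * (deriv (deriv (u \<sigma>)) x + measure \<nu> {0..\<sigma>} * (deriv (u \<sigma>) x)\<^sup>2)))"
    have "AE \<sigma> in lebesgue. \<sigma> \<in> {0..1} \<longrightarrow>
        ((\<lambda>t. u t x) has_real_derivative g \<sigma>) (at \<sigma> within {0..1})"
    proof -
      have "AE \<sigma> in lebesgue. \<sigma> \<in> {0..1} \<longrightarrow>
        (\<exists>D. ((\<lambda>t. u t x) has_real_derivative D) (at \<sigma> within {0..1}) \<and>
             D + \<beta>\<^sup>2 / 2 * (deriv (deriv (u \<sigma>)) x + measure \<nu> {0..\<sigma>} * (deriv (u \<sigma>) x)\<^sup>2) = 0)"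
        using u' by blast
      then show ?thesis
      proof eventually_elim
        case (elim \<sigma>)
        show ?case
        proof
          assume "\<sigma> \<in> {0..1}"
          with elim obtain D where D: "((\<lambda>t. u t x) has_real_derivative D) (at \<sigma> within {0..1})"
            "D + \<beta>\<^sup>2 / 2 * (deriv (deriv (u \<sigma>)) x + measure \<nu> {0..\<sigma>} * (deriv (u \<sigma>) x)\<^sup>2) = 0" by blast
          from D(2) have "D = g \<sigma>" unfolding g_def by linarith
          then show "((\<lambda>t. u t x) has_real_derivative g \<sigma>) (at \<sigma> within {0..1})" using D(1) by simp
        qed
      qed
    qed
    then obtain N where N: "N \<in> null_sets lebesgue" "\<And>\<sigma>. \<sigma> \<notin> N \<Longrightarrow> \<sigma> \<in> {0..1} \<Longrightarrow>
        ((\<lambda>t. u t x) has_real_derivative g \<sigma>) (at \<sigma> within {0..1})"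
      unfolding eventually_ae_filter by auto
    have "(g has_integral u b x - u a x) {a..b}"
    proof (rule absolutely_continuous_has_integral[where S = "{0..1}" and N = N])
      show "absolutely_continuous_fun_on {0..1} (\<lambda>s. u s x)" using u' by blast
      show "negligible N" using N(1) by (simp add: negligible_iff_null_sets)
      show "((\<lambda>s. u s x) has_real_derivative g \<sigma>) (at \<sigma> within {a..b})" if "\<sigma> \<in> {a..b} - N" for \<sigma>
        using N(2)[of \<sigma>] that ab(2) by (auto intro: DERIV_subset)
    qed (use ab in auto)
    then have "(g has_integral u b x - u a x) (cbox a b)" by simp
    from has_integral_affinity[OF this, of "- 1 / \<beta>\<^sup>2" 1]
    have "((\<lambda>\<tau>. g (1 - \<tau> / \<beta>\<^sup>2)) has_integral \<beta>\<^sup>2 * (u b x - u a x)) ((\<lambda>\<sigma>. \<beta>\<^sup>2 * (1 - \<sigma>)) ` {a..b})"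
      using \<beta>2 by (simp add: field_simps)
    moreover have "(\<lambda>\<sigma>. \<beta>\<^sup>2 * (1 - \<sigma>)) ` {a..b} = {s..t}"
    proof (intro set_eqI iffI)
      fix \<tau> assume "\<tau> \<in> {s..t}"
      then have "1 - \<tau> / \<beta>\<^sup>2 \<in> {a..b}" using \<beta>2 by (auto simp: a_def b_def divide_right_mono)
      then show "\<tau> \<in> (\<lambda>\<sigma>. \<beta>\<^sup>2 * (1 - \<sigma>)) ` {a..b}" by (rule rev_image_eqI) (use \<beta>2 in simp)
    qed (use \<beta>2 in \<open>auto simp: a_def b_def field_simps\<close>)
    ultimately have "((\<lambda>\<tau>. g (1 - \<tau> / \<beta>\<^sup>2)) has_integral \<beta>\<^sup>2 * (u b x - u a x)) {s..t}" by simp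
    from has_integral_mult_right[OF this, of "- 1 / \<beta>\<^sup>2"]
    have "((\<lambda>\<tau>. - 1 / \<beta>\<^sup>2 * g (1 - \<tau> / \<beta>\<^sup>2)) has_integral - 1 / \<beta>\<^sup>2 * (\<beta>\<^sup>2 * (u b x - u a x))) {s..t}" .
    moreover have "- 1 / \<beta>\<^sup>2 * g (1 - \<tau> / \<beta>\<^sup>2) = 1 / 2 * (d 2 \<tau> x + \<alpha> \<tau> * (d 1 \<tau> x)\<^sup>2)" for \<tau>
    proof -
      have 1: "- 1 / \<beta>\<^sup>2 * - (\<beta>\<^sup>2 / 2 * X) = 1 / 2 * X" for X using \<beta>2 by simp
      have 2: "(deriv ^^ 2) f = deriv (deriv f)" "(deriv ^^ 1) f = deriv f" for f :: "real \<Rightarrow> real"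
        by (simp_all add: numeral_2_eq_2)
      show ?thesis unfolding g_def d_def \<alpha>_def 2 by (rule 1)
    qed
    moreover have "- 1 / \<beta>\<^sup>2 * (\<beta>\<^sup>2 * (u b x - u a x)) = d 0 t x - d 0 s x"
      using \<beta>2 by (simp add: d_def a_def b_def)
    ultimately show ?thesis by (simp only:)
  qed
  then show "((\<lambda>\<tau>. 1 / 2 * (d 2 \<tau> x + \<alpha> \<tau> * (d 1 \<tau> x)\<^sup>2)) has_integral (d 0 t x - d 0 0 x)) {0..t}"
    if "0 \<le> t" "t \<le> ?T" using that by auto
  show "parisi_flow d (square_deriv d) \<alpha> ?T"
  proof (rule parisi_flow_of_integral_equation[OF _ _ _ _ _ _ _ eq])
    show "0 \<le> ?T" using q by simp
    show "(d k t has_real_derivative d (Suc k) t x) (at x)" if "t \<in> {0..?T}" for k t x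
      unfolding d_def by (rule ux[OF ran[OF that]])
    fix k :: nat assume k: "1 \<le> k"
    then have "bounded ((\<lambda>(s, x). (deriv ^^ k) (u s) x) ` ({0..1} \<times> UNIV))" using u' by blast
    then obtain M where M: "\<And>s x. s \<in> {0..1} \<Longrightarrow> \<bar>(deriv ^^ k) (u s) x\<bar> \<le> M"
      by (fastforce simp: bounded_iff)
    then have "\<forall>t\<in>{0..?T}. \<forall>x. \<bar>d k t x\<bar> \<le> M" unfolding d_def using ran by blast
    then show "\<exists>M. \<forall>t\<in>{0..?T}. \<forall>x. \<bar>d k t x\<bar> \<le> M" by blast
    have c1: "continuous_on ({0..1} \<times> UNIV) (\<lambda>(s, x). (deriv ^^ k) (u s) x)" using u' k by blast
    have c2: "(\<lambda>r. (1 - fst r / \<beta>\<^sup>2, snd r)) ` ({0..?T} \<times> UNIV) \<subseteq> {0..1} \<times> UNIV"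
      using ran by (auto simp del: atLeastAtMost_iff)
    have c3: "continuous_on ({0..?T} \<times> UNIV) (\<lambda>r :: real \<times> real. (1 - fst r / \<beta>\<^sup>2, snd r))"
      using \<beta>2 by (intro continuous_intros) auto
    from continuous_on_compose2[OF c1 c3 c2] show "continuous_on ({0..?T} \<times> UNIV) (\<lambda>(t, x). d k t x)"
      by (simp add: d_def split_def)
  next
    show "0 \<le> \<alpha> t \<and> \<alpha> t \<le> 1" for t by (simp add: \<alpha>_def)
    show "\<alpha> t \<le> \<alpha> s" if "s \<le> t" for s t
    proof -
      have "s / \<beta>\<^sup>2 \<le> t / \<beta>\<^sup>2" using that \<beta>2 by (simp add: divide_right_mono)
      then show ?thesis unfolding \<alpha>_def using \<nu>(2) by (intro finite_measure_mono) auto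
    qed
    show "(\<alpha> \<longlongrightarrow> \<alpha> t) (at t within {0..t})" if t: "t \<in> {0..?T}" for t
      unfolding \<alpha>_def
    proof (rule filterlim_compose[OF borel_distribution_right_continuous[OF \<nu>]])
      show "0 \<le> 1 - t / \<beta>\<^sup>2" using ran[OF t] by simp
      have "((\<lambda>r. 1 - r / \<beta>\<^sup>2) \<longlongrightarrow> 1 - t / \<beta>\<^sup>2) (at t within {0..t})" by (intro tendsto_intros) (use \<beta>2 in auto)
      moreover have "\<forall>\<^sub>F r in at t within {0..t}. 1 - r / \<beta>\<^sup>2 \<in> {1 - t / \<beta>\<^sup>2<..} \<and> 1 - r / \<beta>\<^sup>2 \<noteq> 1 - t / \<beta>\<^sup>2"
        unfolding eventually_at_filter using \<beta>2 by (intro always_eventually) (auto simp: divide_strict_right_mono)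
      ultimately show "filterlim (\<lambda>r. 1 - r / \<beta>\<^sup>2) (at_right (1 - t / \<beta>\<^sup>2)) (at t within {0..t})"
        by (simp add: filterlim_at)
    qed
  qed auto
qed

text \<open>With B = tanh x every derivative from the second on is a polynomial in B times 1 - B^2.
  So C = 1 - B^2 and C_BB = - 2, which makes J vanish at a = 1, and with it N, P and W.\<close>

lemma admissible_ln_cosh: "admissible 1 (\<lambda>k. (deriv ^^ k) (\<lambda>x. ln (cosh x)))"
proof -
  let ?f = "\<lambda>k. (deriv ^^ k) (\<lambda>x::real. ln (cosh x))"
  let ?s = "\<lambda>x::real. 1 - (tanh x)\<^sup>2"
  have step: "?f (Suc k) = g" if "\<And>x. (?f k has_real_derivative g x) (at x)" for k g
    using that by (auto simp: DERIV_imp_deriv)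
  have cosh_nz: "cosh x \<noteq> 0" for x :: real using cosh_real_pos[of x] by simp
  have "(?f 0 has_real_derivative tanh x) (at x)" for x
    by (auto intro!: derivative_eq_intros simp: tanh_def)
  from step[OF this] have f1: "?f 1 = tanh" by simp
  have "(?f 1 has_real_derivative ?s x) (at x)" for x
    unfolding f1 by (auto intro!: derivative_eq_intros simp: cosh_nz)
  from step[OF this] have f2: "?f 2 = ?s" by (simp add: eval_nat_numeral)
  have "(?f 2 has_real_derivative - 2 * tanh x * ?s x) (at x)" for x
    unfolding f2 by (auto intro!: derivative_eq_intros simp: cosh_nz)
  from step[OF this] have f3: "?f 3 = (\<lambda>x. - 2 * tanh x * ?s x)" by (simp add: eval_nat_numeral)
  have "(?f 3 has_real_derivative (6 * (tanh x)\<^sup>2 - 2) * ?s x) (at x)" for x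
    unfolding f3 by (auto intro!: derivative_eq_intros simp: cosh_nz algebra_simps power2_eq_square)
  from step[OF this] have f4: "?f 4 = (\<lambda>x. (6 * (tanh x)\<^sup>2 - 2) * ?s x)" by (simp add: eval_nat_numeral)
  have "(?f 4 has_real_derivative (16 * tanh x - 24 * tanh x ^ 3) * ?s x) (at x)" for x
    unfolding f4 by (auto intro!: derivative_eq_intros simp: cosh_nz algebra_simps power2_eq_square power3_eq_cube)
  from step[OF this] have f5: "?f 5 = (\<lambda>x. (16 * tanh x - 24 * tanh x ^ 3) * ?s x)"
    by (simp add: eval_nat_numeral)
  have s_pos: "0 < ?s x" for x
    using tanh_real_bounds[of x] by (auto simp: abs_square_less_1)
  have t1: "\<bar>tanh x\<bar> \<le> 1" for x :: real using tanh_real_bounds[of x] by auto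
  have t2: "(tanh x)\<^sup>2 \<le> 1" for x :: real using t1[of x] by (simp add: abs_square_le_1)
  have t3: "\<bar>tanh x ^ 3\<bar> \<le> 1" for x :: real using t1[of x] by (simp add: power_abs power_le_one)
  have bound: "\<bar>c * ?s x\<bar> \<le> A * ?s x" if "\<bar>c\<bar> \<le> A" for A c x
    using that s_pos[of x] by (simp add: abs_mult mult_right_mono)
  have r: "ratio ?f 3 x = - 2 * tanh x" "ratio ?f 4 x = 6 * (tanh x)\<^sup>2 - 2"
    "ratio ?f 5 x = 16 * tanh x - 24 * tanh x ^ 3" for x
    unfolding ratio_def f2 f3 f4 f5 using s_pos[of x] by simp_all
  have "\<exists>A. \<forall>x. \<bar>?f k x\<bar> \<le> A * ?f 2 x" if "k \<in> {3, 4, 5}" for k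
  proof -
    \<comment> \<open>40 = 16 + 24 serves the largest of the three polynomials in tanh.\<close>
    have "\<bar>- 2 * tanh x\<bar> \<le> 40" "\<bar>6 * (tanh x)\<^sup>2 - 2\<bar> \<le> 40" "\<bar>16 * tanh x - 24 * tanh x ^ 3\<bar> \<le> 40" for x :: real
      using t1[of x] t2[of x] t3[of x] zero_le_power2[of "tanh x"] by linarith+
    then have "\<bar>?f 3 x\<bar> \<le> 40 * ?f 2 x" "\<bar>?f 4 x\<bar> \<le> 40 * ?f 2 x" "\<bar>?f 5 x\<bar> \<le> 40 * ?f 2 x" for x
      unfolding f2 f3 f4 f5 by (intro bound; simp)+
    then show ?thesis using that by blast
  qed
  moreover have "N_prof 1 ?f x = 0" "P_prof ?f x = 0" "W_prof 1 ?f x = 0" for x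
    unfolding N_prof_def P_prof_def W_prof_def r f2 f3
    by (simp_all add: power2_eq_square power3_eq_cube algebra_simps) (simp_all add: field_simps)
  moreover have "\<exists>c>0. \<forall>x. c * ?s x \<le> ?f 2 x" unfolding f2 by (intro exI[of _ 1]) simp
  ultimately show ?thesis unfolding admissible_def f1 by simp
qed

section \<open>The Cole--Hopf transform\<close>

abbreviation std_normal :: "real measure" where
  "std_normal \<equiv> density lborel std_normal_density"

lemma prob_space_std_normal: "prob_space std_normal"
  by (rule prob_space_normal_density) simp

lemma integrable_std_normal_exp: "integrable std_normal (\<lambda>z. exp (a * \<bar>z\<bar>))"
proof -
  have "integrable lborel (\<lambda>z. std_normal_density z * exp (a * \<bar>z\<bar>))"
  proof (rule Bochner_Integration.integrable_bound)
    show "integrable lborel (\<lambda>z. sqrt 2 * exp (a\<^sup>2) * normal_density 0 (sqrt 2) z)" by simp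
    have "std_normal_density z * exp (a * \<bar>z\<bar>) \<le> sqrt 2 * exp (a\<^sup>2) * normal_density 0 (sqrt 2) z" for z
    proof -
      \<comment> \<open>Half of the Gaussian exponent is spent on a |z|; what remains is
        proportional to the normal density of variance 2.\<close>
      have "a * \<bar>z\<bar> \<le> z\<^sup>2 / 4 + a\<^sup>2"
        using zero_le_power2[of "\<bar>z\<bar> / 2 - a"] by (simp add: power2_diff power_divide mult.commute)
      then have "- z\<^sup>2 / 2 + a * \<bar>z\<bar> \<le> a\<^sup>2 + - z\<^sup>2 / 4" by linarith
      then have "exp (- z\<^sup>2 / 2) * exp (a * \<bar>z\<bar>) \<le> exp (a\<^sup>2) * exp (- z\<^sup>2 / 4)"
        unfolding exp_add[symmetric] exp_le_cancel_iff .
      then have le: "1 / sqrt (2 * pi) * (exp (- z\<^sup>2 / 2) * exp (a * \<bar>z\<bar>)) \<le> 1 / sqrt (2 * pi) * (exp (a\<^sup>2) * exp (- z\<^sup>2 / 4))"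
        by (intro mult_left_mono) auto
      have n: "sqrt 2 * normal_density 0 (sqrt 2) z = 1 / sqrt (2 * pi) * exp (- z\<^sup>2 / 4)"
        by (simp add: normal_density_def real_sqrt_mult) (simp add: field_simps)
      have "sqrt 2 * exp (a\<^sup>2) * normal_density 0 (sqrt 2) z = exp (a\<^sup>2) * (sqrt 2 * normal_density 0 (sqrt 2) z)"
        by simp
      also have "\<dots> = 1 / sqrt (2 * pi) * (exp (a\<^sup>2) * exp (- z\<^sup>2 / 4))" unfolding n by simp
      finally have "sqrt 2 * exp (a\<^sup>2) * normal_density 0 (sqrt 2) z = 1 / sqrt (2 * pi) * (exp (a\<^sup>2) * exp (- z\<^sup>2 / 4))" .
      then show ?thesis using le by (simp only: std_normal_density_def mult.assoc)
    qed
    then show "AE z in lborel. norm (std_normal_density z * exp (a * \<bar>z\<bar>)) \<le> norm (sqrt 2 * exp (a\<^sup>2) * normal_density 0 (sqrt 2) z)"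
      by (intro always_eventually allI) (simp add: abs_mult)
  qed simp
  then show ?thesis by (subst integrable_real_density) auto
qed

text \<open>Integrate the derivative of \<open>f\<close> times the Gaussian density.\<close>

lemma std_normal_integration_by_parts:
  fixes f f' :: "real \<Rightarrow> real"
  assumes f: "\<And>z. (f has_real_derivative f' z) (at z)" and cont: "continuous_on UNIV f'"
    and fb: "\<And>z. \<bar>f z\<bar> \<le> A * exp (a * \<bar>z\<bar>)" and fb': "\<And>z. \<bar>f' z\<bar> \<le> A * exp (a * \<bar>z\<bar>)"
  shows "(\<integral>z. z * f z \<partial>std_normal) = (\<integral>z. f' z \<partial>std_normal)"
proof -
  let ?n = std_normal_density
  have A: "0 \<le> A" using fb[of 0] by simp
  have fc: "continuous_on UNIV f" using f by (auto intro: DERIV_isCont continuous_at_imp_continuous_on)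
  have [measurable]: "f \<in> borel_measurable borel" "f' \<in> borel_measurable borel"
    using fc cont by (auto intro: borel_measurable_continuous_onI)
  have int': "integrable std_normal f'"
    by (rule Bochner_Integration.integrable_bound[OF integrable_mult_right[OF integrable_std_normal_exp, of A a]])
      (use fb' A in auto)
  have int: "integrable std_normal (\<lambda>z. z * f z)"
  proof (rule Bochner_Integration.integrable_bound[OF integrable_mult_right[OF integrable_std_normal_exp, of A "a + 1"]])
    have "norm (z * f z) \<le> norm (A * exp ((a + 1) * \<bar>z\<bar>))" for z
    proof -
      have "\<bar>z\<bar> \<le> exp \<bar>z\<bar>" using exp_ge_add_one_self[of "\<bar>z\<bar>"] by linarith
      then have "\<bar>z\<bar> * \<bar>f z\<bar> \<le> exp \<bar>z\<bar> * (A * exp (a * \<bar>z\<bar>))"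
        using fb[of z] by (intro mult_mono) auto
      then show ?thesis using A by (simp add: abs_mult algebra_simps exp_add)
    qed
    then show "AE z in std_normal. norm (z * f z) \<le> norm (A * exp ((a + 1) * \<bar>z\<bar>))" by simp
  qed simp
  have intl: "integrable lborel (\<lambda>z. ?n z * f' z)" "integrable lborel (\<lambda>z. ?n z * (z * f z))"
    using int int' by (simp_all add: integrable_real_density)
  define F where "F = (\<lambda>z. f z * ?n z)"
  define F' where "F' = (\<lambda>z. ?n z * f' z - ?n z * (z * f z))"
  have n_der: "(?n has_real_derivative - z * ?n z) (at z)" for z
    unfolding std_normal_density_def by (rule derivative_eq_intros refl | simp)+
  have n_cont: "continuous_on UNIV ?n"
    using n_der by (auto intro: DERIV_isCont continuous_at_imp_continuous_on)
  have F_der: "(F has_real_derivative F' z) (at z)" for z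
    unfolding F_def F'_def by (rule derivative_eq_intros f n_der refl)+ (simp add: algebra_simps)
  have F'_cont: "continuous_on UNIV F'"
    unfolding F'_def by (intro continuous_intros n_cont fc cont)
  have F'_int: "integrable lborel F'" unfolding F'_def using intl by (rule Bochner_Integration.integrable_diff)
  \<comment> \<open>The integral of \<open>F'\<close> over [- k, k] is a boundary term, which tends
    to 0 because the Gaussian factor beats the exponential growth of f.\<close>
  have "(\<lambda>k. \<integral>z. indicator {- real k..real k} z * F' z \<partial>lborel) \<longlonglongrightarrow> (\<integral>z. F' z \<partial>lborel)"
  proof (rule integral_dominated_convergence[where w = "\<lambda>z. \<bar>F' z\<bar>"])
    have "(\<lambda>k. indicator {- real k..real k} z * F' z) \<longlonglongrightarrow> F' z" for z
    proof (rule tendsto_eventually)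
      obtain n where n: "\<bar>z\<bar> \<le> real n" using real_arch_simple by blast
      show "\<forall>\<^sub>F k in sequentially. indicator {- real k..real k} z * F' z = F' z"
        using eventually_ge_at_top[of n]
      proof eventually_elim
        case (elim k)
        then have "\<bar>z\<bar> \<le> real k" using n by linarith
        then show ?case by (auto simp: indicator_def)
      qed
    qed
    then show "AE z in lborel. (\<lambda>k. indicator {- real k..real k} z * F' z) \<longlonglongrightarrow> F' z" by simp
  qed (use F'_int in \<open>auto simp: indicator_def\<close>)
  moreover have "(\<integral>z. indicator {- real k..real k} z * F' z \<partial>lborel) = F (real k) - F (- real k)" for k
    using integral_FTC_Icc_real[of "- real k" "real k" F F'] F_der F'_cont
    by (simp add: continuous_on_eq_continuous_at mult.commute)
  moreover have "(\<lambda>k. F (real k) - F (- real k)) \<longlonglongrightarrow> 0"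
  proof (rule Lim_null_comparison)
    have Fb: "\<bar>F z\<bar> \<le> A * exp (a * \<bar>z\<bar>) * (1 / sqrt (2 * pi) * exp (- z\<^sup>2 / 2))" for z
      unfolding F_def abs_mult using fb[of z] A
      by (intro mult_mono) (auto simp: std_normal_density_def)
    have "\<bar>F (real k) - F (- real k)\<bar> \<le> 2 * (A * exp (a * real k) * (1 / sqrt (2 * pi) * exp (- (real k)\<^sup>2 / 2)))" for k
    proof -
      have "\<bar>F (real k)\<bar> \<le> A * exp (a * real k) * (1 / sqrt (2 * pi) * exp (- (real k)\<^sup>2 / 2))"
        "\<bar>F (- real k)\<bar> \<le> A * exp (a * real k) * (1 / sqrt (2 * pi) * exp (- (real k)\<^sup>2 / 2))"
        using Fb[of "real k"] Fb[of "- real k"] by simp_all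
      then show ?thesis by linarith
    qed
    then show "\<forall>\<^sub>F k in sequentially. norm (F (real k) - F (- real k)) \<le>
        2 * (A * exp (a * real k) * (1 / sqrt (2 * pi) * exp (- (real k)\<^sup>2 / 2)))" by simp
    have "(\<lambda>k. exp (a * real k + - (real k)\<^sup>2 / 2)) \<longlonglongrightarrow> 0"
      by real_asymp
    from tendsto_mult_left[OF this, of "2 * A / sqrt (2 * pi)"]
    have "(\<lambda>k. 2 * A / sqrt (2 * pi) * exp (a * real k + - (real k)\<^sup>2 / 2)) \<longlonglongrightarrow> 0" by simp
    moreover have "2 * (A * X * (1 / sqrt (2 * pi) * Y)) = 2 * A / sqrt (2 * pi) * (X * Y)" for X Y :: real by simp
    ultimately show "(\<lambda>k. 2 * (A * exp (a * real k) * (1 / sqrt (2 * pi) * exp (- (real k)\<^sup>2 / 2)))) \<longlonglongrightarrow> 0"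
      unfolding exp_add by (simp only:)
  qed
  ultimately have "(\<integral>z. F' z \<partial>lborel) = 0" by (simp add: LIMSEQ_unique)
  then have "(\<integral>z. ?n z * f' z \<partial>lborel) = (\<integral>z. ?n z * (z * f z) \<partial>lborel)"
    unfolding F'_def using intl by simp
  then show ?thesis by (simp add: integral_real_density)
qed

text \<open>A Taylor remainder with an integrable weight integrates to a quadratic bound, so
  differentiability reduces to a numerical estimate.\<close>

lemma has_derivative_under_integral:
  fixes F :: "real \<Rightarrow> 'a \<Rightarrow> real" and F1 W :: "'a \<Rightarrow> real"
  assumes F: "\<And>y. integrable M (F y)" and F1: "integrable M F1" and W: "integrable M W"
    and taylor: "\<And>h z. \<bar>h\<bar> \<le> 1 \<Longrightarrow> \<bar>F (x + h) z - F x z - h * F1 z\<bar> \<le> W z * h\<^sup>2"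
  shows "((\<lambda>y. \<integral>z. F y z \<partial>M) has_real_derivative (\<integral>z. F1 z \<partial>M)) (at x)"
proof (rule has_real_derivative_of_quadratic_bound[where K = "\<integral>z. W z \<partial>M"])
  fix h :: real assume h: "\<bar>h\<bar> \<le> 1"
  have "(\<integral>z. F (x + h) z \<partial>M) - (\<integral>z. F x z \<partial>M) - h * (\<integral>z. F1 z \<partial>M)
      = (\<integral>z. F (x + h) z - F x z - h * F1 z \<partial>M)"
    using F F1 by simp
  also have "\<bar>\<dots>\<bar> \<le> (\<integral>z. \<bar>F (x + h) z - F x z - h * F1 z\<bar> \<partial>M)"
    by (rule integral_abs_bound)
  also have "\<dots> \<le> (\<integral>z. W z * h\<^sup>2 \<partial>M)"
    using F F1 W taylor[OF h] by (intro integral_mono) auto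
  finally show "\<bar>(\<integral>z. F (x + h) z \<partial>M) - (\<integral>z. F x z \<partial>M) - h * (\<integral>z. F1 z \<partial>M)\<bar> \<le> (\<integral>z. W z \<partial>M) * h\<^sup>2"
    using W by simp
qed

text \<open>Models exp (m \<psi>) and its derivatives for a Lipschitz \<psi>. Bounding
  \<open>G k\<close> by \<open>G 0\<close> passes to the averages, so the ratios H k / H 0 stay
  below \<open>c k\<close> for every \<sigma>; \<open>G_shift\<close> is the Lipschitz bound in
  multiplicative form and dominates all integrands by exponentials.\<close>

locale gaussian_average =
  fixes G :: "nat \<Rightarrow> real \<Rightarrow> real" and c :: "nat \<Rightarrow> real" and L :: real
  assumes G_x: "\<And>k x. (G k has_real_derivative G (Suc k) x) (at x)"
    and G_pos: "\<And>x. 0 < G 0 x"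
    and G_bound: "\<And>k x. \<bar>G k x\<bar> \<le> c k * G 0 x"
    and L: "0 \<le> L"
    and G_shift: "\<And>x s. G 0 (x + s) \<le> exp (L * \<bar>s\<bar>) * G 0 x"
begin

sublocale prob_space std_normal by (rule prob_space_std_normal)

definition H :: "nat \<Rightarrow> real \<Rightarrow> real \<Rightarrow> real" where
  "H k \<sigma> x = (\<integral>z. G k (x + \<sigma> * z) \<partial>std_normal)"

lemma c_nonneg: "0 \<le> c k"
proof -
  have "0 \<le> c k * G 0 0" using G_bound[of k 0] by linarith
  then show ?thesis using G_pos[of 0] by (simp add: zero_le_mult_iff)
qed

lemma G_cont: "continuous_on A (G k)"
  using G_x by (auto intro: DERIV_isCont continuous_at_imp_continuous_on)

lemma G_measurable [measurable]: "G k \<in> borel_measurable borel"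
  using G_cont by (rule borel_measurable_continuous_onI)

lemma G_shift_bound:
  assumes "\<bar>s\<bar> \<le> b"
  shows "\<bar>G k (x + s)\<bar> \<le> c k * G 0 x * exp (L * b)"
proof -
  have "\<bar>G k (x + s)\<bar> \<le> c k * G 0 (x + s)" by (rule G_bound)
  also have "\<dots> \<le> c k * (exp (L * \<bar>s\<bar>) * G 0 x)" using G_shift c_nonneg by (intro mult_left_mono)
  also have "\<dots> \<le> c k * (exp (L * b) * G 0 x)"
    using assms L c_nonneg G_pos[of x] by (intro mult_left_mono mult_right_mono) (auto intro: mult_left_mono)
  finally show ?thesis by (simp add: mult_ac)
qed

lemma G_integrable: "integrable std_normal (\<lambda>z. G k (x + \<sigma> * z))"
proof (rule Bochner_Integration.integrable_bound[OF integrable_mult_right[OF integrable_std_normal_exp, of "c k * G 0 x" "L * \<bar>\<sigma>\<bar>"]])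
  have "norm (G k (x + \<sigma> * z)) \<le> norm (c k * G 0 x * exp (L * \<bar>\<sigma>\<bar> * \<bar>z\<bar>))" for z
    using G_shift_bound[of "\<sigma> * z" "\<bar>\<sigma>\<bar> * \<bar>z\<bar>" k x] c_nonneg[of k] G_pos[of x] by (simp add: abs_mult mult.assoc)
  then show "AE z in std_normal. norm (G k (x + \<sigma> * z)) \<le> norm (c k * G 0 x * exp (L * \<bar>\<sigma>\<bar> * \<bar>z\<bar>))" by simp
qed simp

lemma H_has_x_derivative: "(H k \<sigma> has_real_derivative H (Suc k) \<sigma> x) (at x)"
  unfolding H_def[abs_def]
proof (rule has_derivative_under_integral[where F = "\<lambda>x z. G k (x + \<sigma> * z)"
      and W = "\<lambda>z. c (Suc (Suc k)) * G 0 x * exp L * exp (L * \<bar>\<sigma>\<bar> * \<bar>z\<bar>)"])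
  show "integrable std_normal (\<lambda>z. c (Suc (Suc k)) * G 0 x * exp L * exp (L * \<bar>\<sigma>\<bar> * \<bar>z\<bar>))"
    by (intro integrable_mult_right integrable_std_normal_exp)
  fix h z :: real assume h: "\<bar>h\<bar> \<le> 1"
  have "\<bar>G k ((x + \<sigma> * z) + h) - G k (x + \<sigma> * z) - h * G (Suc k) (x + \<sigma> * z)\<bar>
      \<le> (c (Suc (Suc k)) * G 0 x * exp (L * (1 + \<bar>\<sigma>\<bar> * \<bar>z\<bar>))) * h\<^sup>2"
  proof (rule second_order_bound[OF G_x G_x])
    fix y assume y: "\<bar>y - (x + \<sigma> * z)\<bar> \<le> \<bar>h\<bar>"
    have "\<bar>y - x\<bar> \<le> 1 + \<bar>\<sigma>\<bar> * \<bar>z\<bar>" using y h abs_mult[of \<sigma> z] by linarith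
    from G_shift_bound[OF this, of "Suc (Suc k)" x]
    show "\<bar>G (Suc (Suc k)) y\<bar> \<le> c (Suc (Suc k)) * G 0 x * exp (L * (1 + \<bar>\<sigma>\<bar> * \<bar>z\<bar>))" by simp
  qed
  then show "\<bar>G k (x + h + \<sigma> * z) - G k (x + \<sigma> * z) - h * G (Suc k) (x + \<sigma> * z)\<bar>
      \<le> c (Suc (Suc k)) * G 0 x * exp L * exp (L * \<bar>\<sigma>\<bar> * \<bar>z\<bar>) * h\<^sup>2"
    by (simp add: exp_add algebra_simps)
qed (rule G_integrable)+

text \<open>Differentiation in \<sigma> brings down a factor z, which Gaussian integration by parts
  converts into \<sigma> times one more derivative. With \<sigma> = sqrt r the chain rule makes this
  the heat equation with factor 1 / 2.\<close>

lemma H_has_\<sigma>_derivative: "((\<lambda>\<sigma>. H k \<sigma> x) has_real_derivative \<sigma> * H (Suc (Suc k)) \<sigma> x) (at \<sigma>)"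
proof -
  have z2: "z\<^sup>2 \<le> 2 * exp \<bar>z\<bar>" for z :: real
    using exp_lower_Taylor_quadratic[of "\<bar>z\<bar>"] by simp
  have z1: "\<bar>z\<bar> \<le> exp \<bar>z\<bar>" for z :: real using exp_ge_add_one_self[of "\<bar>z\<bar>"] by linarith
  have "((\<lambda>\<sigma>. \<integral>z. G k (x + \<sigma> * z) \<partial>std_normal) has_real_derivative
      (\<integral>z. z * G (Suc k) (x + \<sigma> * z) \<partial>std_normal)) (at \<sigma>)"
  proof (rule has_derivative_under_integral[where F = "\<lambda>\<sigma> z. G k (x + \<sigma> * z)"
      and W = "\<lambda>z. 2 * c (Suc (Suc k)) * G 0 x * exp ((L * (\<bar>\<sigma>\<bar> + 1) + 1) * \<bar>z\<bar>)"])
    show "integrable std_normal (\<lambda>z. 2 * c (Suc (Suc k)) * G 0 x * exp ((L * (\<bar>\<sigma>\<bar> + 1) + 1) * \<bar>z\<bar>))"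
      by (intro integrable_mult_right integrable_std_normal_exp)
    show "integrable std_normal (\<lambda>z. z * G (Suc k) (x + \<sigma> * z))"
    proof (rule Bochner_Integration.integrable_bound[OF integrable_mult_right[OF integrable_std_normal_exp, of "c (Suc k) * G 0 x" "L * \<bar>\<sigma>\<bar> + 1"]])
      have "norm (z * G (Suc k) (x + \<sigma> * z)) \<le> norm (c (Suc k) * G 0 x * exp ((L * \<bar>\<sigma>\<bar> + 1) * \<bar>z\<bar>))" for z
      proof -
        have "\<bar>z\<bar> * \<bar>G (Suc k) (x + \<sigma> * z)\<bar> \<le> exp \<bar>z\<bar> * (c (Suc k) * G 0 x * exp (L * (\<bar>\<sigma>\<bar> * \<bar>z\<bar>)))"
          using z1 G_shift_bound[of "\<sigma> * z" "\<bar>\<sigma>\<bar> * \<bar>z\<bar>" "Suc k" x] by (intro mult_mono) (auto simp: abs_mult)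
        then show ?thesis using c_nonneg[of "Suc k"] G_pos[of x] by (simp add: abs_mult algebra_simps exp_add)
      qed
      then show "AE z in std_normal. norm (z * G (Suc k) (x + \<sigma> * z)) \<le> norm (c (Suc k) * G 0 x * exp ((L * \<bar>\<sigma>\<bar> + 1) * \<bar>z\<bar>))"
        by simp
    qed simp
    fix h z :: real assume h: "\<bar>h\<bar> \<le> 1"
    have "\<bar>G k ((x + \<sigma> * z) + h * z) - G k (x + \<sigma> * z) - (h * z) * G (Suc k) (x + \<sigma> * z)\<bar>
        \<le> (c (Suc (Suc k)) * G 0 x * exp (L * ((\<bar>\<sigma>\<bar> + 1) * \<bar>z\<bar>))) * (h * z)\<^sup>2"
    proof (rule second_order_bound[OF G_x G_x])
      fix y assume y: "\<bar>y - (x + \<sigma> * z)\<bar> \<le> \<bar>h * z\<bar>"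
      have "\<bar>h * z\<bar> \<le> \<bar>z\<bar>" using h by (simp add: abs_mult mult_left_le_one_le)
      moreover have "(\<bar>\<sigma>\<bar> + 1) * \<bar>z\<bar> = \<bar>\<sigma> * z\<bar> + \<bar>z\<bar>" by (simp add: abs_mult distrib_right)
      ultimately have "\<bar>y - x\<bar> \<le> (\<bar>\<sigma>\<bar> + 1) * \<bar>z\<bar>" using y by linarith
      from G_shift_bound[OF this, of "Suc (Suc k)" x]
      show "\<bar>G (Suc (Suc k)) y\<bar> \<le> c (Suc (Suc k)) * G 0 x * exp (L * ((\<bar>\<sigma>\<bar> + 1) * \<bar>z\<bar>))" by simp
    qed
    also have "\<dots> = (c (Suc (Suc k)) * G 0 x * exp (L * ((\<bar>\<sigma>\<bar> + 1) * \<bar>z\<bar>)) * h\<^sup>2) * z\<^sup>2"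
      by (simp add: power_mult_distrib)
    \<comment> \<open>Absorbing z^2 into 2 exp |z| is the origin of the factor 2 and of the + 1 in
      the exponent of the weight.\<close>
    also have "\<dots> \<le> (c (Suc (Suc k)) * G 0 x * exp (L * ((\<bar>\<sigma>\<bar> + 1) * \<bar>z\<bar>)) * h\<^sup>2) * (2 * exp \<bar>z\<bar>)"
      using c_nonneg[of "Suc (Suc k)"] G_pos[of x] z2[of z] by (intro mult_left_mono) auto
    finally show "\<bar>G k (x + (\<sigma> + h) * z) - G k (x + \<sigma> * z) - h * (z * G (Suc k) (x + \<sigma> * z))\<bar>
        \<le> 2 * c (Suc (Suc k)) * G 0 x * exp ((L * (\<bar>\<sigma>\<bar> + 1) + 1) * \<bar>z\<bar>) * h\<^sup>2"
      by (simp add: exp_add algebra_simps)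
  qed (rule G_integrable)
  also have "(\<integral>z. z * G (Suc k) (x + \<sigma> * z) \<partial>std_normal) = (\<integral>z. \<sigma> * G (Suc (Suc k)) (x + \<sigma> * z) \<partial>std_normal)"
  proof (rule std_normal_integration_by_parts)
    let ?A = "(c (Suc k) + \<bar>\<sigma>\<bar> * c (Suc (Suc k))) * G 0 x"
    fix z
    show "((\<lambda>z. G (Suc k) (x + \<sigma> * z)) has_real_derivative \<sigma> * G (Suc (Suc k)) (x + \<sigma> * z)) (at z)"
    proof -
      have "((\<lambda>z. x + \<sigma> * z) has_real_derivative \<sigma>) (at z)" by (auto intro!: derivative_eq_intros)
      from DERIV_chain2[OF G_x this] show ?thesis by (simp add: mult.commute)
    qed
    have 0: "0 \<le> c (Suc k) * G 0 x * exp (L * (\<bar>\<sigma>\<bar> * \<bar>z\<bar>))" "0 \<le> \<bar>\<sigma>\<bar> * (c (Suc (Suc k)) * G 0 x * exp (L * (\<bar>\<sigma>\<bar> * \<bar>z\<bar>)))"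
      using c_nonneg G_pos[of x] by simp_all
    have 1: "\<bar>\<sigma> * z\<bar> \<le> \<bar>\<sigma>\<bar> * \<bar>z\<bar>" by (simp add: abs_mult)
    show "\<bar>G (Suc k) (x + \<sigma> * z)\<bar> \<le> ?A * exp (L * \<bar>\<sigma>\<bar> * \<bar>z\<bar>)"
      using G_shift_bound[OF 1, of "Suc k" x] 0 by (simp add: algebra_simps)
    have "\<bar>\<sigma>\<bar> * \<bar>G (Suc (Suc k)) (x + \<sigma> * z)\<bar> \<le> \<bar>\<sigma>\<bar> * (c (Suc (Suc k)) * G 0 x * exp (L * (\<bar>\<sigma>\<bar> * \<bar>z\<bar>)))"
      by (intro mult_left_mono G_shift_bound[OF 1]) simp
    then show "\<bar>\<sigma> * G (Suc (Suc k)) (x + \<sigma> * z)\<bar> \<le> ?A * exp (L * \<bar>\<sigma>\<bar> * \<bar>z\<bar>)"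
      using 0 by (simp add: abs_mult algebra_simps)
  next
    show "continuous_on UNIV (\<lambda>z. \<sigma> * G (Suc (Suc k)) (x + \<sigma> * z))"
      by (intro continuous_intros continuous_on_compose2[OF G_cont[of UNIV]]) auto
  qed
  finally show ?thesis by (simp add: H_def)
qed

lemma H_pos: "0 < H 0 \<sigma> x"
proof -
  have "exp (- (L * \<bar>\<sigma>\<bar>) * \<bar>z\<bar>) * G 0 x \<le> G 0 (x + \<sigma> * z)" for z
  proof -
    have "G 0 x \<le> exp (L * \<bar>\<sigma>\<bar> * \<bar>z\<bar>) * G 0 (x + \<sigma> * z)"
      using G_shift[of "x + \<sigma> * z" "- (\<sigma> * z)"] by (simp add: abs_mult mult.assoc)
    then have "exp (- (L * \<bar>\<sigma>\<bar> * \<bar>z\<bar>)) * G 0 x \<le> exp (- (L * \<bar>\<sigma>\<bar> * \<bar>z\<bar>)) * (exp (L * \<bar>\<sigma>\<bar> * \<bar>z\<bar>) * G 0 (x + \<sigma> * z))"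
      by (intro mult_left_mono) auto
    then show ?thesis by (simp add: mult.assoc[symmetric] exp_add[symmetric])
  qed
  moreover have int: "integrable std_normal (\<lambda>z. exp (- (L * \<bar>\<sigma>\<bar>) * \<bar>z\<bar>) * G 0 x)"
    by (intro integrable_mult_left integrable_std_normal_exp)
  ultimately have "(\<integral>z. exp (- (L * \<bar>\<sigma>\<bar>) * \<bar>z\<bar>) * G 0 x \<partial>std_normal) \<le> H 0 \<sigma> x"
    unfolding H_def by (intro integral_mono G_integrable)
  moreover have "0 < (\<integral>z. exp (- (L * \<bar>\<sigma>\<bar>) * \<bar>z\<bar>) * G 0 x \<partial>std_normal)"
  proof (rule ccontr)
    let ?f = "\<lambda>z. exp (- (L * \<bar>\<sigma>\<bar>) * \<bar>z\<bar>) * G 0 x"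
    assume "\<not> 0 < (\<integral>z. ?f z \<partial>std_normal)"
    moreover have "0 \<le> (\<integral>z. ?f z \<partial>std_normal)" using G_pos[of x] by (intro integral_nonneg_AE) (auto simp: less_imp_le)
    ultimately have "(\<integral>z. ?f z \<partial>std_normal) = 0" by linarith
    then have "AE z in std_normal. ?f z = 0"
      using G_pos[of x] integral_nonneg_eq_0_iff_AE[OF int] by (simp add: less_imp_le)
    then have "AE z in std_normal. False" using G_pos[of x] by simp
    then show False by simp
  qed
  ultimately show ?thesis by linarith
qed

lemma H_bound: "\<bar>H k \<sigma> x\<bar> \<le> c k * H 0 \<sigma> x"
proof -
  have "\<bar>H k \<sigma> x\<bar> \<le> (\<integral>z. \<bar>G k (x + \<sigma> * z)\<bar> \<partial>std_normal)" unfolding H_def by (rule integral_abs_bound)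
  also have "\<dots> \<le> (\<integral>z. c k * G 0 (x + \<sigma> * z) \<partial>std_normal)"
    by (intro integral_mono integrable_abs G_integrable integrable_mult_right G_bound)
  finally show ?thesis by (simp add: H_def)
qed

lemma H_cont: "isCont (\<lambda>p. H k (fst p) (snd p)) (\<sigma>, x)"
  unfolding continuous_at_sequentially
proof (intro allI impI)
  fix p :: "nat \<Rightarrow> real \<times> real" assume p: "p \<longlonglongrightarrow> (\<sigma>, x)"
  have lim: "(\<lambda>n. fst (p n)) \<longlonglongrightarrow> \<sigma>" "(\<lambda>n. snd (p n)) \<longlonglongrightarrow> x"
    using tendsto_fst[OF p] tendsto_snd[OF p] by simp_all
  obtain B where B: "\<And>n. \<bar>fst (p n)\<bar> \<le> B"
    using convergent_imp_Bseq[OF convergentI[OF lim(1)]] by (auto simp: Bseq_def)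
  obtain R where R: "\<And>n. \<bar>snd (p n)\<bar> \<le> R"
    using convergent_imp_Bseq[OF convergentI[OF lim(2)]] by (auto simp: Bseq_def)
  have "(\<lambda>n. \<integral>z. G k (snd (p n) + fst (p n) * z) \<partial>std_normal) \<longlonglongrightarrow> (\<integral>z. G k (x + \<sigma> * z) \<partial>std_normal)"
  proof (rule integral_dominated_convergence[where w = "\<lambda>z. c k * G 0 0 * exp (L * R) * exp (L * B * \<bar>z\<bar>)"])
    show "integrable std_normal (\<lambda>z. c k * G 0 0 * exp (L * R) * exp (L * B * \<bar>z\<bar>))"
      by (intro integrable_mult_right integrable_std_normal_exp)
    have "isCont (G k) y" for y using G_x by (rule DERIV_isCont)
    then have "(\<lambda>n. G k (snd (p n) + fst (p n) * z)) \<longlonglongrightarrow> G k (x + \<sigma> * z)" for z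
      by (rule isCont_tendsto_compose) (intro tendsto_intros lim)
    then show "AE z in std_normal. (\<lambda>n. G k (snd (p n) + fst (p n) * z)) \<longlonglongrightarrow> G k (x + \<sigma> * z)" by simp
    fix n
    have "norm (G k (snd (p n) + fst (p n) * z)) \<le> c k * G 0 0 * exp (L * R) * exp (L * B * \<bar>z\<bar>)" for z
    proof -
      have "\<bar>fst (p n) * z\<bar> \<le> B * \<bar>z\<bar>" unfolding abs_mult using B by (intro mult_right_mono) auto
      then have "\<bar>snd (p n) + fst (p n) * z\<bar> \<le> R + B * \<bar>z\<bar>" using R[of n] by linarith
      from G_shift_bound[OF this, of k 0] show ?thesis by (simp add: exp_add algebra_simps)
    qed
    then show "AE z in std_normal. norm (G k (snd (p n) + fst (p n) * z)) \<le> c k * G 0 0 * exp (L * R) * exp (L * B * \<bar>z\<bar>)"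
      by simp
  qed measurable
  then show "((\<lambda>p. H k (fst p) (snd p)) \<circ> p) \<longlonglongrightarrow> H k (fst (\<sigma>, x)) (snd (\<sigma>, x))"
    by (simp add: H_def o_def)
qed

end

text \<open>Each derivative of exp (m \<psi>) is exp (m \<psi>) times a polynomial in derivatives of
  \<psi> of order at least 1, which are bounded; \<psi> itself enters only through the exponential,
  where its Lipschitz bound gives the shift estimate.\<close>

lemma gaussian_average_exp:
  fixes \<psi> :: "real \<Rightarrow> real" and m :: real
  assumes m: "0 \<le> m"
    and smooth: "\<And>k x. ((deriv ^^ k) \<psi> has_real_derivative (deriv ^^ Suc k) \<psi> x) (at x)"
    and bdd: "\<And>k. 1 \<le> k \<Longrightarrow> \<exists>M. \<forall>x. \<bar>(deriv ^^ k) \<psi> x\<bar> \<le> M"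
  shows "\<exists>c L. gaussian_average (\<lambda>k. (deriv ^^ k) (\<lambda>x. exp (m * \<psi> x))) c L"
proof -
  let ?g = "\<lambda>x. exp (m * \<psi> x)"
  \<comment> \<open>Generator i is the derivative of order i + 1, which keeps the possibly unbounded
    \<psi> out; time is a dummy, hence the set of times {0}.\<close>
  define e where "e = (\<lambda>i (t :: real). (deriv ^^ Suc i) \<psi>)"
  have e_x: "\<exists>f'\<in>deriv_alg e. \<forall>t\<in>{0}. \<forall>x. (e i t has_real_derivative f' t x) (at x)" for i
    using smooth[of "Suc i"] by (intro bexI[of _ "e (Suc i)"] deriv_alg.gen) (auto simp: e_def)
  have e_bdd: "\<exists>M. \<forall>t\<in>{0}. \<forall>x. \<bar>e i t x\<bar> \<le> M" for i
    using bdd[of "Suc i"] by (auto simp: e_def)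
  have iter: "\<exists>p\<in>deriv_alg e. (deriv ^^ k) ?g = (\<lambda>x. p 0 x * ?g x)" for k
  proof (induction k)
    case 0
    show ?case by (rule bexI[of _ "\<lambda>t x. 1"]) (auto intro: deriv_alg.const)
  next
    case (Suc k)
    then obtain p where p: "p \<in> deriv_alg e" "(deriv ^^ k) ?g = (\<lambda>x. p 0 x * ?g x)" by blast
    obtain p' where p': "p' \<in> deriv_alg e" "\<forall>t\<in>{0}. \<forall>x. (p t has_real_derivative p' t x) (at x)"
      using deriv_alg_derivative[OF e_x p(1)] by blast
    have "((\<lambda>x. p 0 x * ?g x) has_real_derivative (p' 0 x + p 0 x * (m * e 0 0 x)) * ?g x) (at x)" for x
    proof -
      have "(p 0 has_real_derivative p' 0 x) (at x)" "(\<psi> has_real_derivative e 0 0 x) (at x)"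
        using p'(2) smooth[of 0 x] by (auto simp: e_def)
      then show ?thesis by (auto intro!: derivative_eq_intros simp: algebra_simps)
    qed
    then have "(deriv ^^ Suc k) ?g = (\<lambda>x. (p' 0 x + p 0 x * (m * e 0 0 x)) * ?g x)"
      using p(2) by (auto intro!: DERIV_imp_deriv)
    moreover have "(\<lambda>t x. p' t x + p t x * (m * e 0 t x)) \<in> deriv_alg e"
      by (intro deriv_alg.intros p p')
    ultimately show ?case by (intro bexI[of _ "\<lambda>t x. p' t x + p t x * (m * e 0 t x)"])
  qed
  have "\<forall>k. \<exists>c. \<forall>x. \<bar>(deriv ^^ k) ?g x\<bar> \<le> c * ?g x"
  proof
    fix k
    obtain p where p: "p \<in> deriv_alg e" "(deriv ^^ k) ?g = (\<lambda>x. p 0 x * ?g x)" using iter by blast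
    obtain M where "\<And>x. \<bar>p 0 x\<bar> \<le> M" using deriv_alg_bounded[OF e_bdd p(1)] by auto
    then show "\<exists>c. \<forall>x. \<bar>(deriv ^^ k) ?g x\<bar> \<le> c * ?g x"
      unfolding p(2) by (intro exI[of _ M]) (auto simp: abs_mult mult_right_mono)
  qed
  then obtain c where c: "\<And>k x. \<bar>(deriv ^^ k) ?g x\<bar> \<le> c k * ?g x" by metis
  obtain M where M: "\<And>x. \<bar>deriv \<psi> x\<bar> \<le> M" using bdd[of 1] by auto
  have M0: "0 \<le> M" using M[of 0] by linarith
  have shift: "\<psi> (x + s) \<le> M * \<bar>s\<bar> + \<psi> x" for x s
  proof -
    have "norm (\<psi> (x + s) - \<psi> x) \<le> M * norm ((x + s) - x)"
      by (rule field_differentiable_bound[of UNIV \<psi> "deriv \<psi>"]) (use smooth[of 0] M in auto)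
    then show ?thesis by simp
  qed
  have "gaussian_average (\<lambda>k. (deriv ^^ k) ?g) c (m * M)"
  proof
    fix k x
    obtain p where p: "p \<in> deriv_alg e" "(deriv ^^ k) ?g = (\<lambda>x. p 0 x * ?g x)" using iter by blast
    obtain p' where "\<forall>t\<in>{0}. \<forall>x. (p t has_real_derivative p' t x) (at x)"
      using deriv_alg_derivative[OF e_x p(1)] by blast
    then have "(p 0 has_real_derivative p' 0 x) (at x)" "(\<psi> has_real_derivative deriv \<psi> x) (at x)"
      using smooth[of 0 x] by auto
    then have "((\<lambda>x. p 0 x * ?g x) has_real_derivative p' 0 x * ?g x + p 0 x * (m * deriv \<psi> x * ?g x)) (at x)"
      by (auto intro!: derivative_eq_intros simp: algebra_simps)
    then show "((deriv ^^ k) ?g has_real_derivative (deriv ^^ Suc k) ?g x) (at x)"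
      unfolding p(2)[symmetric] using DERIV_imp_deriv by fastforce
  next
    fix x s
    have "m * \<psi> (x + s) \<le> m * (M * \<bar>s\<bar> + \<psi> x)" using shift m by (intro mult_left_mono)
    then have "m * \<psi> (x + s) \<le> m * M * \<bar>s\<bar> + m * \<psi> x" by (simp add: algebra_simps)
    then show "(deriv ^^ 0) ?g (x + s) \<le> exp (m * M * \<bar>s\<bar>) * (deriv ^^ 0) ?g x"
      by (simp add: exp_add[symmetric])
  qed (use c m M0 in auto)
  then show ?thesis by blast
qed

text \<open>exp (m U) solves the linear heat equation. Derivatives of U of positive order are
  polynomials in the ratios H i / H 0, which generate an algebra closed under differentiation and
  bounded uniformly in time; this gives the regularity of a flow with constant coefficient
  m.\<close>

lemma cole_hopf_flow:
  fixes \<psi> :: "real \<Rightarrow> real" and m T :: real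
  assumes m: "0 < m" "m \<le> 1" and T: "0 \<le> T"
    and smooth: "\<And>k x. ((deriv ^^ k) \<psi> has_real_derivative (deriv ^^ Suc k) \<psi> x) (at x)"
    and bdd: "\<And>k. 1 \<le> k \<Longrightarrow> \<exists>M. \<forall>x. \<bar>(deriv ^^ k) \<psi> x\<bar> \<le> M"
    and d_def: "d = (\<lambda>k r. (deriv ^^ k) (cole_hopf m r \<psi>))"
  shows "parisi_flow d (square_deriv d) (\<lambda>_. m) T"
    and "((\<lambda>\<tau>. 1 / 2 * (d 2 \<tau> x + m * (d 1 \<tau> x)\<^sup>2)) has_integral (d 0 T x - d 0 0 x)) {0..T}"
    and "(d 0 T has_real_derivative d 1 T x) (at x)"
proof -
  obtain c L where "gaussian_average (\<lambda>k. (deriv ^^ k) (\<lambda>x. exp (m * \<psi> x))) c L"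
    using gaussian_average_exp[of m \<psi>] m smooth bdd by fastforce
  then interpret gaussian_average "\<lambda>k. (deriv ^^ k) (\<lambda>x. exp (m * \<psi> x))" c L .
  have U: "cole_hopf m r \<psi> = (\<lambda>x. 1 / m * ln (H 0 (sqrt r) x))" for r
    by (simp add: cole_hopf_def[abs_def] heat_def H_def)
  define e where "e = (\<lambda>i r x. H i (sqrt r) x / H 0 (sqrt r) x)"
  have H_nz: "H 0 s x \<noteq> 0" for s x using H_pos[of s x] by simp
  have e_x': "(e i r has_real_derivative e (Suc i) r x + (- 1) * (e i r x * e 1 r x)) (at x)" for i r x
    unfolding e_def using DERIV_divide[OF H_has_x_derivative[of i "sqrt r" x] H_has_x_derivative[of 0 "sqrt r" x] H_nz]
    by (simp add: field_simps H_nz)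
  have e_x: "\<exists>f'\<in>deriv_alg e. \<forall>t\<in>{0..T}. \<forall>x. (e i t has_real_derivative f' t x) (at x)" for i
    by (intro bexI[of _ "\<lambda>t x. e (Suc i) t x + (- 1) * (e i t x * e 1 t x)"] ballI allI e_x' deriv_alg.intros)
  have e_bdd: "\<exists>M. \<forall>t\<in>{0..T}. \<forall>x. \<bar>e i t x\<bar> \<le> M" for i
    using H_bound[of i] H_pos by (intro exI[of _ "c i"]) (simp add: e_def abs_divide abs_of_pos[OF H_pos] pos_divide_le_eq[OF H_pos])
  have H_cont': "continuous_on A (\<lambda>p. H i (sqrt (fst p)) (snd p))" for i A
  proof -
    have "continuous_on UNIV (\<lambda>p. H i (fst p) (snd p))"
      using H_cont by (auto simp: continuous_on_eq_continuous_at)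
    moreover have "continuous_on A (\<lambda>p. (sqrt (fst p), snd p))" by (intro continuous_intros)
    ultimately show ?thesis using continuous_on_compose2[of UNIV _ A "\<lambda>p. (sqrt (fst p), snd p)"] by fastforce
  qed
  have e_cont: "continuous_on ({0..T} \<times> UNIV) (\<lambda>(t, x). e i t x)" for i
    unfolding e_def split_def by (intro continuous_intros H_cont') (simp add: H_nz)
  have U_x: "(cole_hopf m r \<psi> has_real_derivative 1 / m * e 1 r x) (at x)" for r x
    unfolding U e_def using m(1) H_pos[of "sqrt r" x] H_has_x_derivative[of 0 "sqrt r" x]
    by (auto intro!: derivative_eq_intros)
  then have d1: "deriv (cole_hopf m r \<psi>) = (\<lambda>x. 1 / m * e 1 r x)" for r
    by (auto intro!: DERIV_imp_deriv)
  have e1_alg: "(\<lambda>r x. 1 / m * e 1 r x) \<in> deriv_alg e" by (intro deriv_alg.intros)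
  have d_alg: "\<exists>g\<in>deriv_alg e. \<forall>t\<in>{0..T}. d k t = g t" if k: "1 \<le> k" for k
  proof -
    obtain j where "k = Suc j" using k by (cases k) auto
    then have "d k t = (deriv ^^ j) (\<lambda>x. 1 / m * e 1 t x)" for t
      unfolding d_def by (simp only: funpow_Suc_right o_def d1)
    then show ?thesis using deriv_alg_iterate[OF e_x e1_alg, of j] by simp
  qed
  have d2: "d 2 r x = 1 / m * (e 2 r x - (e 1 r x)\<^sup>2)" for r x
  proof -
    have "((\<lambda>x. 1 / m * e 1 r x) has_real_derivative 1 / m * (e 2 r x + (- 1) * (e 1 r x * e 1 r x))) (at x)"
      using e_x'[of 1 r x] by (intro DERIV_cmult) (simp add: numeral_2_eq_2)
    then show ?thesis unfolding d_def by (simp add: numeral_2_eq_2 d1 DERIV_imp_deriv power2_eq_square)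
  qed
  have eq: "((\<lambda>\<tau>. 1 / 2 * (d 2 \<tau> x + m * (d 1 \<tau> x)\<^sup>2)) has_integral (d 0 t x - d 0 s x)) {s..t}"
    if st: "0 \<le> s" "s \<le> t" for s t x
  \<comment> \<open>The square root is not differentiable at time 0, so the derivative is taken in
    the open interval and continuity covers the endpoint.\<close>
  proof (rule fundamental_theorem_of_calculus_interior[OF st(2)])
    have "continuous_on UNIV (\<lambda>p. H 0 (sqrt (fst p)) (snd p))" by (rule H_cont')
    then have "continuous_on {s..t} (\<lambda>\<tau>. H 0 (sqrt (fst (\<tau>, x))) (snd (\<tau>, x)))"
      by (rule continuous_on_compose2) (auto intro!: continuous_intros)
    then show "continuous_on {s..t} (\<lambda>\<tau>. d 0 \<tau> x)"
      unfolding d_def U using H_nz m(1) by (auto intro!: continuous_intros)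
    fix r assume "r \<in> {s<..<t}"
    then have r: "0 < r" using st by simp
    have "((\<lambda>\<tau>. H 0 (sqrt \<tau>) x) has_real_derivative (sqrt r * H 2 (sqrt r) x) * (inverse (sqrt r) / 2)) (at r)"
      using DERIV_chain2[OF H_has_\<sigma>_derivative[of 0 x "sqrt r"] DERIV_real_sqrt[OF r]] by (simp add: numeral_2_eq_2)
    then have "((\<lambda>\<tau>. H 0 (sqrt \<tau>) x) has_real_derivative H 2 (sqrt r) x / 2) (at r)"
      using r by (simp add: field_simps)
    then have "((\<lambda>\<tau>. 1 / m * ln (H 0 (sqrt \<tau>) x)) has_real_derivative 1 / m * (H 2 (sqrt r) x / 2 / H 0 (sqrt r) x)) (at r)"
      using m(1) H_pos[of "sqrt r" x] by (auto intro!: derivative_eq_intros)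
    moreover have "1 / m * (H 2 (sqrt r) x / 2 / H 0 (sqrt r) x) = 1 / 2 * (d 2 r x + m * (d 1 r x)\<^sup>2)"
      unfolding d2 using m by (simp add: d_def d1 e_def field_simps power2_eq_square)
    moreover have "(\<lambda>\<tau>. d 0 \<tau> x) = (\<lambda>\<tau>. 1 / m * ln (H 0 (sqrt \<tau>) x))" by (simp add: d_def U)
    ultimately show "((\<lambda>\<tau>. d 0 \<tau> x) has_vector_derivative 1 / 2 * (d 2 r x + m * (d 1 r x)\<^sup>2)) (at r)"
      by (simp only: has_real_derivative_iff_has_vector_derivative)
  qed
  then show "((\<lambda>\<tau>. 1 / 2 * (d 2 \<tau> x + m * (d 1 \<tau> x)\<^sup>2)) has_integral (d 0 T x - d 0 0 x)) {0..T}"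
    using T by simp
  show "(d 0 T has_real_derivative d 1 T x) (at x)" using U_x[of T x] by (simp add: d_def d1)
  show "parisi_flow d (square_deriv d) (\<lambda>_. m) T"
  proof (rule parisi_flow_of_integral_equation[OF T _ _ _ _ _ _ eq])
    show "(d k t has_real_derivative d (Suc k) t x) (at x)" if t: "t \<in> {0..T}" for k t x
    proof (cases "k = 0")
      case True
      then show ?thesis using U_x[of t x] by (simp add: d_def d1)
    next
      case False
      then obtain g where g: "g \<in> deriv_alg e" "\<forall>t\<in>{0..T}. d k t = g t" using d_alg[of k] by auto
      obtain g' where "\<forall>t\<in>{0..T}. \<forall>x. (g t has_real_derivative g' t x) (at x)"
        using deriv_alg_derivative[OF e_x g(1)] by blast
      then have "(d k t has_real_derivative g' t x) (at x)" using g t by simp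
      moreover from DERIV_imp_deriv[OF this] have "d (Suc k) t x = g' t x" by (simp add: d_def)
      ultimately show ?thesis by simp
    qed
    fix k :: nat assume k: "1 \<le> k"
    then obtain g where g: "g \<in> deriv_alg e" "\<forall>t\<in>{0..T}. d k t = g t" using d_alg[of k] by auto
    show "\<exists>M. \<forall>t\<in>{0..T}. \<forall>x. \<bar>d k t x\<bar> \<le> M" using deriv_alg_bounded[OF e_bdd g(1)] g(2) by simp
    have "continuous_on ({0..T} \<times> UNIV) (\<lambda>(t, x). g t x)" by (rule deriv_alg_continuous[OF e_cont g(1)])
    then show "continuous_on ({0..T} \<times> UNIV) (\<lambda>(t, x). d k t x)"
      by (rule continuous_on_cong[THEN iffD1, OF refl, rotated]) (use g(2) in auto)
  qed (use m in auto)
qed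

section \<open>Slope coordinates\<close>

text \<open>The mean value theorem writes \<zeta> b / b as \<zeta>1 \<xi> with |\<xi>| \<le> |b|, so
  the vanishing derivative of \<zeta>1 at 0 passes to the quotient. It provides K_B at B =
  0.\<close>

lemma quotient_has_derivative_at_0:
  fixes \<zeta> \<zeta>1 :: "real \<Rightarrow> real"
  assumes r: "0 < r" and \<zeta>: "\<And>b. \<bar>b\<bar> < r \<Longrightarrow> (\<zeta> has_real_derivative \<zeta>1 b) (at b)" and "\<zeta> 0 = 0"
    and \<zeta>1: "(\<zeta>1 has_real_derivative 0) (at 0)"
  shows "((\<lambda>b. if b = 0 then \<zeta>1 0 else \<zeta> b / b) has_real_derivative 0) (at 0)"
  unfolding has_field_derivative_iff
proof (rule tendstoI)
  fix \<epsilon> :: real assume \<epsilon>: "0 < \<epsilon>"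
  from \<zeta>1 have "((\<lambda>b. (\<zeta>1 b - \<zeta>1 0) / (b - 0)) \<longlongrightarrow> 0) (at 0)" unfolding has_field_derivative_iff .
  from tendstoD[OF this \<epsilon>] obtain \<delta> where \<delta>: "0 < \<delta>"
    "\<And>b. b \<noteq> 0 \<Longrightarrow> \<bar>b\<bar> < \<delta> \<Longrightarrow> \<bar>(\<zeta>1 b - \<zeta>1 0) / b\<bar> < \<epsilon>"
    unfolding eventually_at by (auto simp: dist_real_def)
  have "\<bar>((if b = 0 then \<zeta>1 0 else \<zeta> b / b) - \<zeta>1 0) / b\<bar> < \<epsilon>" if b: "b \<noteq> 0" "\<bar>b\<bar> < min \<delta> r" for b
  proof -
    have "\<exists>\<xi>. \<bar>\<xi>\<bar> \<le> \<bar>b\<bar> \<and> \<xi> \<noteq> 0 \<and> \<zeta> b = b * \<zeta>1 \<xi>"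
    proof (cases "0 < b")
      case True
      obtain \<xi> where "0 < \<xi>" "\<xi> < b" "\<zeta> b - \<zeta> 0 = (b - 0) * \<zeta>1 \<xi>"
        using MVT2[of 0 b \<zeta> \<zeta>1] True b \<zeta> by auto
      then show ?thesis using \<open>\<zeta> 0 = 0\<close> by (intro exI[of _ \<xi>]) auto
    next
      case False
      obtain \<xi> where "b < \<xi>" "\<xi> < 0" "\<zeta> 0 - \<zeta> b = (0 - b) * \<zeta>1 \<xi>"
        using MVT2[of b 0 \<zeta> \<zeta>1] False b \<zeta> by auto
      then show ?thesis using \<open>\<zeta> 0 = 0\<close> by (intro exI[of _ \<xi>]) auto
    qed
    then obtain \<xi> where \<xi>: "\<bar>\<xi>\<bar> \<le> \<bar>b\<bar>" "\<xi> \<noteq> 0" "\<zeta> b = b * \<zeta>1 \<xi>" by blast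
    have "\<bar>\<zeta>1 \<xi> - \<zeta>1 0\<bar> < \<epsilon> * \<bar>\<xi>\<bar>"
      using \<delta>(2)[of \<xi>] \<xi> b by (simp add: abs_divide pos_divide_less_eq)
    also have "\<dots> \<le> \<epsilon> * \<bar>b\<bar>" using \<xi> \<epsilon> by simp
    finally show ?thesis using b \<xi>(3) by (simp add: abs_divide pos_divide_less_eq)
  qed
  then show "\<forall>\<^sub>F b in at 0. dist (((if b = 0 then \<zeta>1 0 else \<zeta> b / b) - (if 0 = (0::real) then \<zeta>1 0 else \<zeta> 0 / 0)) / (b - 0)) 0 < \<epsilon>"
    unfolding eventually_at using \<delta>(1) r by (intro exI[of _ "min \<delta> r"]) (auto simp: dist_real_def)
qed

lemma ln_cosh_ge: "x - ln 2 \<le> ln (cosh x)" for x :: real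
proof -
  have "x - ln 2 = ln (exp x / 2)" by (simp add: ln_div)
  also have "\<dots> \<le> ln (cosh x)" by (subst ln_le_cancel_iff) (auto simp: cosh_def intro: add_pos_pos)
  finally show ?thesis .
qed

section \<open>Inverting the slope map\<close>

context profile
begin

lemma strict_mono_f1: "strict_mono (f 1)"
proof (rule strict_monoI)
  fix x y :: real assume "x < y"
  then show "f 1 x < f 1 y"
    by (rule DERIV_pos_imp_increasing) (use f_x[of 1] pos in \<open>auto simp: numeral_2_eq_2\<close>)
qed

lemma f1_0: "f 1 0 = 0" using odd1[of 0] by simp

text \<open>U lies above x - ln 2. If its slope stayed at most B < 1 on the positive axis, U would
  grow no faster than B x and eventually fall below that line; so the slope reaches B and the
  intermediate value theorem applies. Oddness covers negative B.\<close>

lemma slope_range: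
  assumes U: "\<And>x. (U has_real_derivative f 1 x) (at x)" and ge: "\<And>x. ln (cosh x) \<le> U x"
    and B: "\<bar>B\<bar> < 1"
  shows "\<exists>x. f 1 x = B"
proof -
  have pos_case: "\<exists>x. f 1 x = B" if B: "0 \<le> B" "B < 1" for B
  proof -
    have "\<exists>x\<ge>0. B \<le> f 1 x"
    proof (rule ccontr)
      assume "\<not> ?thesis"
      then have less: "f 1 x \<le> B" if "0 \<le> x" for x using that by force
      \<comment> \<open>Solves (1 - B) x = |U 0| + ln 2 + 1, so that the two growth bounds
        contradict each other by at least 1.\<close>
      define x where "x = (\<bar>U 0\<bar> + ln 2 + 1) / (1 - B)"
      have x: "0 \<le> x" "(1 - B) * x = \<bar>U 0\<bar> + ln 2 + 1"
        using B by (auto simp: x_def intro!: divide_nonneg_pos add_nonneg_nonneg)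
      have "U x - B * x \<le> U 0 - B * 0"
      proof (rule DERIV_nonpos_imp_nonincreasing[OF x(1)])
        fix y :: real assume "0 \<le> y"
        then show "\<exists>D. ((\<lambda>x. U x - B * x) has_real_derivative D) (at y) \<and> D \<le> 0"
          using U[of y] less[of y] by (intro exI[of _ "f 1 y - B"]) (auto intro!: derivative_eq_intros)
      qed
      then have "U x \<le> U 0 + B * x" by simp
      moreover have "x - ln 2 \<le> U x" using ge[of x] ln_cosh_ge[of x] by linarith
      ultimately show False using x(2) abs_ge_self[of "U 0"] by (simp add: algebra_simps)
    qed
    then obtain x where x: "0 \<le> x" "B \<le> f 1 x" by blast
    have "\<exists>y\<ge>0. y \<le> x \<and> f 1 y = B"
      using x B f1_0 by (intro IVT) (auto intro!: DERIV_isCont[OF f_x])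
    then show ?thesis by blast
  qed
  show ?thesis
  proof (cases "0 \<le> B")
    case False
    then obtain x where "f 1 x = - B" using pos_case[of "- B"] B by auto
    then show ?thesis using odd1[of x] by (intro exI[of _ "- x"]) simp
  qed (use pos_case B in auto)
qed

definition slope_inv :: "real \<Rightarrow> real" where
  "slope_inv B = (THE x. f 1 x = B)"

lemma slope_inv_f1: "slope_inv (f 1 x) = x"
  unfolding slope_inv_def using strict_mono_f1 by (auto simp: strict_mono_eq)

lemma slope_inv_0: "slope_inv 0 = 0" using slope_inv_f1[of 0] unfolding f1_0 .

end

locale slope_profile = profile +
  fixes U :: "real \<Rightarrow> real" and m :: real
  assumes dU: "deriv U = f 1" and ddU: "deriv (deriv U) = f 2"
    and range: "\<And>B. \<bar>B\<bar> < 1 \<Longrightarrow> \<exists>x. f 1 x = B"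
    and N: "\<And>x. 0 \<le> N_prof m f x" and P: "\<And>x. 0 \<le> x \<Longrightarrow> 0 \<le> P_prof f x"
    and W: "\<And>x. 0 \<le> x \<Longrightarrow> 0 \<le> W_prof m f x"
begin

abbreviation "X \<equiv> slope_inv"

lemma f1_X: "\<bar>B\<bar> < 1 \<Longrightarrow> f 1 (X B) = B"
  using range[of B] slope_inv_f1 by auto

lemma X_has_derivative:
  assumes "\<bar>B\<bar> < 1"
  shows "(X has_real_derivative 1 / f 2 (X B)) (at B)"
proof -
  have "isCont X (f 1 (X B))"
    by (rule isCont_inverse_function[of 1 "X B" X "f 1"])
      (rule zero_less_one slope_inv_f1 DERIV_isCont[OF f_x] order_refl)+
  then have "isCont X B" using f1_X[OF assms] by simp
  moreover have "(f 1 has_real_derivative f 2 (X B)) (at (X B))"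
    using f_x[of 1 "X B"] by (simp add: numeral_2_eq_2)
  ultimately show ?thesis
    using DERIV_inverse_function[of "f 1" "f 2 (X B)" X B "-1" 1] f1_X assms pos[of "X B"]
    by (auto simp: inverse_eq_divide abs_less_iff)
qed

lemma comp_X_has_derivative:
  assumes "\<bar>B\<bar> < 1" and "\<And>x. (g has_real_derivative g' x) (at x)"
  shows "((\<lambda>B. g (X B)) has_real_derivative g' (X B) / f 2 (X B)) (at B)"
  using DERIV_chain2[OF assms(2) X_has_derivative[OF assms(1)]] by simp

lemma deriv_comp_X:
  assumes B: "\<bar>B\<bar> < 1" and g: "\<And>x. (g has_real_derivative g' x) (at x)"
    and h: "\<And>B. \<bar>B\<bar> < 1 \<Longrightarrow> h B = g (X B)"
  shows "(h has_real_derivative g' (X B) / f 2 (X B)) (at B)"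
proof (rule has_field_derivative_transform_within_open[OF comp_X_has_derivative[OF B g]])
  show "open {-1<..<1::real}" "B \<in> {-1<..<1}" using B by auto
qed (use h in auto)

abbreviation "C \<equiv> slope_curvature U"

lemma C_eq: "C B = f 2 (X B)"
  unfolding slope_curvature_def ddU unfolding dU slope_inv_def ..

lemma deriv_C: "\<bar>B\<bar> < 1 \<Longrightarrow> deriv C B = ratio f 3 (X B)"
proof -
  assume B: "\<bar>B\<bar> < 1"
  have "(f 2 has_real_derivative f 3 x) (at x)" for x using f_x[of 2 x] by (simp add: eval_nat_numeral)
  from deriv_comp_X[OF B this C_eq] show ?thesis by (auto simp: ratio_def dest: DERIV_imp_deriv)
qed

lemma deriv_C_has_derivative:
  "\<bar>B\<bar> < 1 \<Longrightarrow> (deriv C has_real_derivative ratio_x 3 (X B) / f 2 (X B)) (at B)"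
  by (rule deriv_comp_X[OF _ ratio_has_derivative deriv_C]) auto

lemma J_eq: "\<bar>B\<bar> < 1 \<Longrightarrow> J_fun m C B = N_prof m f (X B) / f 2 (X B)"
  using DERIV_imp_deriv[OF deriv_C_has_derivative, of B] pos[of "X B"]
  by (simp add: J_fun_def N_prof_def ratio_x_def field_simps power2_eq_square)

lemma J_has_derivative:
  assumes B: "\<bar>B\<bar> < 1"
  shows "(J_fun m C has_real_derivative P_prof f (X B) / (f 2 (X B))\<^sup>2) (at B)"
proof -
  have f2: "(f 2 has_real_derivative f 3 x) (at x)" for x using f_x[of 2 x] by (simp add: eval_nat_numeral)
  have "((\<lambda>x. N_prof m f x / f 2 x) has_real_derivative P_prof f x / f 2 x) (at x)" for x
  proof -
    have "(N_prof m f has_real_derivative - (ratio_x 4 x - 2 * ratio f 3 x * ratio_x 3 x) / 2 - m * f 3 x) (at x)"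
      unfolding N_prof_def[abs_def]
      by (rule derivative_eq_intros ratio_has_derivative f2 refl | simp)+
    from DERIV_divide[OF this f2] pos[of x]
    have "((\<lambda>x. N_prof m f x / f 2 x) has_real_derivative
        ((- (ratio_x 4 x - 2 * ratio f 3 x * ratio_x 3 x) / 2 - m * f 3 x) * f 2 x - N_prof m f x * f 3 x) / (f 2 x * f 2 x)) (at x)"
      by simp
    moreover have "((- (ratio_x 4 x - 2 * ratio f 3 x * ratio_x 3 x) / 2 - m * f 3 x) * f 2 x - N_prof m f x * f 3 x)
      = P_prof f x * f 2 x"
      unfolding f_eq[of 3 x] N_prof_def P_prof_def ratio_x_def
      by (simp add: algebra_simps power2_eq_square power3_eq_cube) (simp add: field_simps)
    ultimately show ?thesis using pos[of x] by simp
  qed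
  from deriv_comp_X[OF B this J_eq] show ?thesis by (simp add: power2_eq_square)
qed

lemma X_nonneg: "0 \<le> B \<Longrightarrow> B < 1 \<Longrightarrow> 0 \<le> X B"
  using f1_X[of B] f1_0 strict_mono_less_eq[OF strict_mono_f1, of 0 "X B"] by simp

lemma J_nonneg: "\<bar>B\<bar> < 1 \<Longrightarrow> 0 \<le> J_fun m C B"
  using N[of "X B"] pos[of "X B"] by (simp add: J_eq)

lemma deriv_J: "\<bar>B\<bar> < 1 \<Longrightarrow> deriv (J_fun m C) B = P_prof f (X B) / (f 2 (X B))\<^sup>2"
  by (rule DERIV_imp_deriv[OF J_has_derivative])

lemma deriv_J_nonneg: "0 \<le> B \<Longrightarrow> B < 1 \<Longrightarrow> 0 \<le> deriv (J_fun m C) B"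
  using P[OF X_nonneg] by (simp add: deriv_J)

text \<open>The pointwise identity P + W = 3 z N with z = - \<open>ratio f 3\<close> / 2 turns W
  \<ge> 0 into the claim after division by \<open>f 2\<close>, as J = N / C and J_B = P /
  C^2.\<close>

lemma C_deriv_J_le:
  assumes "0 \<le> B" "B < 1"
  shows "C B * deriv (J_fun m C) B \<le> 3 * z_fun C B * J_fun m C B"
proof -
  let ?x = "X B"
  have B: "\<bar>B\<bar> < 1" using assms by simp
  have "P_prof f ?x + W_prof m f ?x = 3 * (- 1 / 2 * ratio f 3 ?x) * N_prof m f ?x"
    unfolding W_prof_def P_prof_def N_prof_def f_eq[of 3 ?x]
    by (simp add: algebra_simps power2_eq_square power3_eq_cube) (simp add: field_simps)
  then have "P_prof f ?x \<le> 3 * (- 1 / 2 * ratio f 3 ?x) * N_prof m f ?x"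
    using W[OF X_nonneg[OF assms]] by linarith
  then have "P_prof f ?x / f 2 ?x \<le> 3 * (- 1 / 2 * ratio f 3 ?x) * N_prof m f ?x / f 2 ?x"
    using pos[of ?x] by (intro divide_right_mono) auto
  then show ?thesis using pos[of ?x]
    by (simp add: C_eq deriv_J[OF B] z_fun_def deriv_C[OF B] J_eq[OF B] power2_eq_square)
qed

text \<open>On (-1, 1) this is \<open>z_fun C\<close>. Its derivative there is m + J, so J_B \<ge> 0
  makes it convex on [0, 1).\<close>

definition "\<zeta> B = - 1 / 2 * ratio f 3 (X B)"

lemma \<zeta>_0: "\<zeta> 0 = 0" by (simp add: \<zeta>_def slope_inv_0 odd_ratio_0)

lemma \<zeta>_has_derivative: "\<bar>B\<bar> < 1 \<Longrightarrow> (\<zeta> has_real_derivative m + J_fun m C B) (at B)"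
proof -
  assume B: "\<bar>B\<bar> < 1"
  have "((\<lambda>x. - 1 / 2 * ratio f 3 x) has_real_derivative - 1 / 2 * ratio_x 3 x) (at x)" for x
    by (rule DERIV_cmult ratio_has_derivative)+ simp
  from comp_X_has_derivative[OF B this] show ?thesis
    using DERIV_imp_deriv[OF deriv_C_has_derivative[OF B]] by (simp add: \<zeta>_def[abs_def] J_fun_def)
qed

text \<open>At B = 0 the \<open>Lim\<close> in \<open>K_fun\<close> is the limit of difference
  quotients of \<open>deriv C\<close>, because \<open>deriv C 0\<close> vanishes by oddness; its
  value C_BB yields K = J there.\<close>

lemma K_eq:
  assumes "\<bar>B\<bar> < 1"
  shows "K_fun m C B = (if B = 0 then m + J_fun m C 0 else \<zeta> B / B) - m"
proof (cases "B = 0")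
  case True
  have "deriv C 0 = 0" by (simp add: deriv_C slope_inv_0 odd_ratio_0)
  then have "((\<lambda>b. deriv C b / b) \<longlongrightarrow> deriv (deriv C) 0) (at 0)"
    using deriv_C_has_derivative[of 0] DERIV_imp_deriv[OF deriv_C_has_derivative[of 0]]
    by (simp add: has_field_derivative_iff)
  then have "Lim (at 0) (\<lambda>b. deriv C b / b) = deriv (deriv C) 0" by (intro tendsto_Lim) auto
  then show ?thesis using True by (simp add: K_fun_def J_fun_def)
qed (use assms in \<open>simp add: K_fun_def deriv_C \<zeta>_def\<close>)

lemma J_mono:
  assumes "0 \<le> a" "a \<le> b" "b < 1"
  shows "J_fun m C a \<le> J_fun m C b"
proof (rule DERIV_nonneg_imp_nondecreasing[OF assms(2)])
  fix x assume "a \<le> x" "x \<le> b"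
  then have "0 \<le> x" "x < 1" using assms by auto
  then show "\<exists>y. (J_fun m C has_real_derivative y) (at x) \<and> 0 \<le> y"
    using J_has_derivative[of x] P[OF X_nonneg[of x]] by (intro exI[of _ "P_prof f (X x) / (f 2 (X x))\<^sup>2"]) auto
qed

text \<open>Since \<zeta> 0 = 0, the quotient \<zeta> B / B equals m + J at some \<xi> in (0, B). So
  K at B is J at \<xi>, and K_B is the increment of J from \<xi> to B divided by B, nonnegative as J
  increases. At B = 0 the derivative of K is 0 because J_B vanishes there.\<close>

lemma K_nonneg_deriv_K_nonneg:
  assumes B: "0 \<le> B" "B < 1"
  shows "0 \<le> K_fun m C B \<and> 0 \<le> deriv (K_fun m C) B"
proof (cases "B = 0")
  case True
  have "((\<lambda>b. if b = 0 then m + J_fun m C 0 else \<zeta> b / b) has_real_derivative 0) (at 0)"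
  proof (rule quotient_has_derivative_at_0[where r = 1 and ?\<zeta>1.0 = "\<lambda>b. m + J_fun m C b"])
    have "P_prof f 0 = 0" by (simp add: P_prof_def odd_ratio_0)
    then have "(J_fun m C has_real_derivative 0) (at 0)" using J_has_derivative[of 0] by (simp add: slope_inv_0)
    then show "((\<lambda>b. m + J_fun m C b) has_real_derivative 0) (at 0)" by (auto intro!: derivative_eq_intros)
  qed (use \<zeta>_has_derivative \<zeta>_0 in auto)
  then have "((\<lambda>b. (if b = 0 then m + J_fun m C 0 else \<zeta> b / b) - m) has_real_derivative 0) (at 0)"
    by (auto intro!: derivative_eq_intros)
  then have "(K_fun m C has_real_derivative 0) (at 0)"
    by (rule has_field_derivative_transform_within_open[where S = "{-1<..<1}"]) (auto simp: K_eq)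
  then show ?thesis using True K_eq[of 0] J_nonneg[of 0] by (simp add: DERIV_imp_deriv)
next
  case False
  then have B0: "0 < B" "\<bar>B\<bar> < 1" using B by auto
  obtain \<xi> where \<xi>: "0 < \<xi>" "\<xi> < B" "\<zeta> B - \<zeta> 0 = (B - 0) * (m + J_fun m C \<xi>)"
    using MVT2[of 0 B \<zeta> "\<lambda>b. m + J_fun m C b"] B0 \<zeta>_has_derivative by auto
  have \<zeta>B: "\<zeta> B = B * (m + J_fun m C \<xi>)" using \<xi>(3) by (simp add: \<zeta>_0)
  have "((\<lambda>b. \<zeta> b / b - m) has_real_derivative ((m + J_fun m C B) * B - \<zeta> B * 1) / (B * B)) (at B)"
    using DERIV_diff[OF DERIV_divide[OF \<zeta>_has_derivative[OF B0(2)] DERIV_ident False] DERIV_const[of m]]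
    by simp
  then have "(K_fun m C has_real_derivative ((m + J_fun m C B) * B - \<zeta> B * 1) / (B * B)) (at B)"
    by (rule has_field_derivative_transform_within_open[where S = "{0<..<1}"]) (use B0 in \<open>auto simp: K_eq\<close>)
  moreover have "(m + J_fun m C B) * B - \<zeta> B * 1 = B * (J_fun m C B - J_fun m C \<xi>)"
    by (simp add: \<zeta>B algebra_simps)
  moreover have "0 \<le> B * (J_fun m C B - J_fun m C \<xi>)"
    using J_mono[of \<xi> B] \<xi> B0 by auto
  ultimately have "0 \<le> deriv (K_fun m C) B"
    by (metis DERIV_imp_deriv divide_nonneg_nonneg zero_le_square)
  moreover have "0 \<le> K_fun m C B" using K_eq[OF B0(2)] B0 J_nonneg[of \<xi>] \<xi> by (simp add: \<zeta>B)
  ultimately show ?thesis by simp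
qed

end

lemma (in parisi_flow_init) admissible_end:
  assumes a: "0 \<le> a" "a \<le> \<alpha> T"
  shows "admissible a (\<lambda>k. d k T)"
  by (rule admissible_mono[of "\<alpha> T"]) (use admissible_preserved[of T] T_nonneg a d_x in auto)

lemma heat_0: "heat 0 g x = g x"
proof -
  interpret prob_space std_normal by (rule prob_space_std_normal)
  show ?thesis using prob_space by (simp add: heat_def)
qed

lemma cole_hopf_0: "m \<noteq> 0 \<Longrightarrow> cole_hopf m 0 \<psi> = \<psi>"
  by (auto simp: cole_hopf_def heat_0)

lemma prob_space_mixture:
  assumes "prob_space M" "prob_space N" "sets M = sets N" "0 \<le> m" "m \<le> 1"
  shows "prob_space (mixture m M N)"
proof
  have "space N = space M" using sets_eq_imp_space_eq[OF assms(3)] by simp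
  then have "emeasure (mixture m M N) (space M) = ennreal m + ennreal (1 - m)"
    using emeasure_mixture[OF assms(3), of "space M" m] prob_space.emeasure_space_1[OF assms(1)]
      prob_space.emeasure_space_1[OF assms(2)] by simp
  also have "\<dots> = 1" using assms by (simp flip: ennreal_plus)
  finally show "emeasure (mixture m M N) (space (mixture m M N)) = 1" by simp
qed

theorem proposition3p7:
  fixes \<beta> m q :: real and \<rho> :: "real measure" and u :: "real \<Rightarrow> real \<Rightarrow> real"
    and U C K J z :: "real \<Rightarrow> real \<Rightarrow> real"
  assumes "\<beta> > 0" and "0 < m" and "m < 1" and "0 < q" and "q \<le> 1"
    and "borel_prob_on {0..1} \<rho>" and "measure_support \<rho> \<subseteq> {q..1}"
    and "parisi_solution \<beta> (mixture m (return borel 0) \<rho>) u"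
    and "\<And>r. U r = cole_hopf m r (u q)"
    and "\<And>r. C r = slope_curvature (U r)"
    and "\<And>r. K r = K_fun m (C r)"
    and "\<And>r. J r = J_fun m (C r)"
    and "\<And>r. z r = z_fun (C r)"
  shows "\<forall>r\<ge>0. \<forall>B. 0 \<le> B \<and> B < 1 \<longrightarrow>
    K r B \<ge> 0 \<and> deriv (K r) B \<ge> 0 \<and> J r B \<ge> 0 \<and> deriv (J r) B \<ge> 0 \<and>
    C r B * deriv (J r) B \<le> 3 * z r B * J r B"
proof -
  let ?\<nu> = "mixture m (return borel 0) \<rho>"
  note pu = assms(8)
  have \<rho>: "prob_space \<rho>" "sets \<rho> = sets borel" using assms(6) by (auto simp: borel_prob_on_def)
  have \<nu>: "prob_space ?\<nu>" "sets ?\<nu> = sets borel"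
    using \<rho> assms by (auto intro!: prob_space_mixture prob_space_return)
  interpret \<nu>: prob_space ?\<nu> by (rule \<nu>)
  \<comment> \<open>The atom of mass m at 0 lies in [0, q]: the coefficient at the end of the Parisi
    phase is at least that of the Cole--Hopf phase.\<close>
  have \<nu>_ge: "m \<le> measure ?\<nu> {0..q}"
  proof -
    have "ennreal m \<le> emeasure ?\<nu> {0..q}"
      using emeasure_mixture[of "return borel 0" \<rho> "{0..q}" m] \<rho> assms(4) by simp
    then show ?thesis by (simp add: \<nu>.emeasure_eq_measure)
  qed
  define T where "T = \<beta>\<^sup>2 * (1 - q)"
  define \<alpha> where "\<alpha> = (\<lambda>t. measure ?\<nu> {0..1 - t / \<beta>\<^sup>2})"
  define d1 where "d1 = (\<lambda>k t. (deriv ^^ k) (u (1 - t / \<beta>\<^sup>2)))"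
  have qT: "1 - T / \<beta>\<^sup>2 = q" using assms(1) by (simp add: T_def)
  have T: "0 \<le> T" using assms by (simp add: T_def)
  note f1 = parisi_solution_flow[OF assms(1) less_imp_le[OF assms(4)] assms(5) \<nu> pu d1_def \<alpha>_def,
      folded T_def]
  interpret f1: parisi_flow d1 "square_deriv d1" \<alpha> T by (rule f1(1))
  have u1: "u 1 = (\<lambda>x. ln (cosh x))" using pu by (auto simp: parisi_solution_def)
  have "admissible (\<alpha> 0) (\<lambda>k. d1 k 0)"
  proof (rule admissible_mono)
    show "admissible 1 (\<lambda>k. d1 k 0)" using admissible_ln_cosh by (simp add: d1_def u1)
    show "(d1 k 0 has_real_derivative d1 (Suc k) 0 x) (at x)" if "1 \<le> k" for k x
      using f1.d_x[OF that, of 0 x] T by simp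
  qed (use f1.\<alpha>_range[of 0] T in auto)
  then interpret f1: parisi_flow_init d1 "square_deriv d1" \<alpha> T by unfold_locales
  have d1T: "d1 k T = (deriv ^^ k) (u q)" for k by (simp add: d1_def qT)
  \<comment> \<open>At the handover the coefficient may drop from the mass of [0, q] to m; this is a
    downward jump, which \<open>admissible_end\<close> permits.\<close>
  have "admissible m (\<lambda>k. d1 k T)"
    by (rule f1.admissible_end) (use assms \<nu>_ge in \<open>simp_all add: \<alpha>_def qT\<close>)
  then have adm: "admissible m (\<lambda>k. (deriv ^^ k) (u q))" by (simp add: d1T)
  \<comment> \<open>In either phase the solution increases with the reversed time, as (d 2 +
    \<alpha> (d 1)^2) / 2 is nonnegative; staying above \<open>ln cosh\<close> is what makes the
    slopes fill (-1, 1).\<close>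
  have uq_ge: "ln (cosh x) \<le> u q x" for x
  proof -
    have "0 \<le> 1 / 2 * (d1 2 \<tau> x + \<alpha> \<tau> * (d1 1 \<tau> x)\<^sup>2)" if "\<tau> \<in> {0..T}" for \<tau>
      using f1.d2_pos[OF that, of x] f1.\<alpha>_range[OF that] by (simp add: add_nonneg_nonneg less_imp_le)
    from has_integral_nonneg[OF f1(2)[OF T order_refl, of x] this] have "0 \<le> d1 0 T x - d1 0 0 x" .
    then show ?thesis by (simp add: d1_def qT u1)
  qed
  have smooth: "((deriv ^^ k) (u q) has_real_derivative (deriv ^^ Suc k) (u q) x) (at x)" for k x
    using pu assms(4,5) by (auto simp: parisi_solution_def DERIV_deriv_iff_real_differentiable)
  have bdd: "\<exists>M. \<forall>x. \<bar>(deriv ^^ k) (u q) x\<bar> \<le> M" if k: "1 \<le> k" for k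
  proof -
    obtain M where "\<forall>t\<in>{0..T}. \<forall>x. \<bar>d1 k t x\<bar> \<le> M" using f1.d_bdd[OF k] by blast
    then have "\<bar>d1 k T x\<bar> \<le> M" for x using T by simp
    then show ?thesis unfolding d1T by blast
  qed
  show ?thesis
  proof (intro allI impI)
    fix r B :: real assume r: "0 \<le> r" and B: "0 \<le> B \<and> B < 1"
    define d where "d = (\<lambda>k r. (deriv ^^ k) (cole_hopf m r (u q)))"
    note f2 = cole_hopf_flow[OF assms(2) less_imp_le[OF assms(3)] r smooth bdd d_def]
    interpret f2: parisi_flow d "square_deriv d" "\<lambda>_. m" r by (rule f2(1))
    have "admissible m (\<lambda>k. d k 0)" using adm assms(2) by (simp add: d_def cole_hopf_0)
    then interpret f2: parisi_flow_init d "square_deriv d" "\<lambda>_. m" r by unfold_locales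
    have adm': "admissible m (\<lambda>k. d k r)" by (rule f2.admissible_end) (use assms in auto)
    have U_ge: "ln (cosh x) \<le> U r x" for x
    proof -
      have "0 \<le> 1 / 2 * (d 2 \<tau> x + m * (d 1 \<tau> x)\<^sup>2)" if "\<tau> \<in> {0..r}" for \<tau>
        using f2.d2_pos[OF that, of x] assms(2) by (simp add: add_nonneg_nonneg less_imp_le)
      from has_integral_nonneg[OF f2(2)[of x] this] have "0 \<le> d 0 r x - d 0 0 x" .
      then show ?thesis using uq_ge[of x] assms(2,9) by (simp add: d_def cole_hopf_0)
    qed
    interpret profile "\<lambda>k. d k r" by (rule f2.profile) (use r in auto)
    have Ud: "d k r = (deriv ^^ k) (U r)" for k by (simp add: d_def assms(9))
    have U_x: "(U r has_real_derivative d 1 r x) (at x)" for x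
      using f2(3) by (simp add: d_def assms(9))
    interpret slope_profile "\<lambda>k. d k r" "U r" m
    proof
      show "\<exists>x. d 1 r x = B" if "\<bar>B\<bar> < 1" for B by (rule slope_range[OF U_x U_ge that])
    qed (use adm' assms(2) in \<open>auto simp: admissible_def Ud numeral_2_eq_2\<close>)
    show "K r B \<ge> 0 \<and> deriv (K r) B \<ge> 0 \<and> J r B \<ge> 0 \<and> deriv (J r) B \<ge> 0 \<and>
        C r B * deriv (J r) B \<le> 3 * z r B * J r B"
      using K_nonneg_deriv_K_nonneg[of B] J_nonneg[of B] deriv_J_nonneg[of B] C_deriv_J_le[of B] B
      by (simp add: assms(10-13))
  qed
qed

end
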